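(* Let $a<b$ be real numbers, $0<\alpha<1$, and $y_a,y_b\in\mathbb{R}$. Consider the problem of extremizing $$J[y]=\int_a^b L\left(x,y,{_a^CD}^{\alpha}_x y\right)dx$$ with a Lagrangian $L\in C^2([a,b]\times\mathbb{R}^2)$, subject to the boundary conditions $y(a)=y_a$ and $y(b)=y_b$. If $y\in C^1([a,b])$ is a solution to this problem, then $y$ satisfies the fractional Euler--Lagrange differential equation $$\frac{\partial L\left(x,y,{_a^CD}^{\alpha}_x y\right)}{\partial y}+{_x^CD}^{\alpha}_b\,\frac{\partial L\left(x,y,{_a^CD}^{\alpha}_x y\right)}{\partial({_a^CD}^{\alpha}_x y)}=0.$$
   Context: For $\alpha>0$ and $h\in L_1([a,b])$, the left and right Riemann--Liouville fractional integrals are ${_aJ}^{\alpha}_x h(x):=\frac{1}{\Gamma(\alpha)}\int_a^x\frac{h(u)}{(x-u)^{1-\alpha}}\,du$ and ${_xJ}^{\alpha}_b h(x):=\frac{1}{\Gamma(\alpha)}\int_x^b\frac{h(u)}{(u-x)^{1-\alpha}}\,du$. For $0<\alpha<1$, the left and right Caputo fractional derivatives are ${_a^CD}^{\alpha}_x h(x):={_aJ}^{1-\alpha}_x h'(x)=\frac{1}{\Gamma(1-\alpha)}\int_a^x\frac{h'(u)}{(x-u)^{\alpha}}\,du$ and ${_x^CD}^{\alpha}_b h(x):=-\,{_xJ}^{1-\alpha}_b h'(x)=\frac{-1}{\Gamma(1-\alpha)}\int_x^b\frac{h'(u)}{(u-x)^{\alpha}}\,du$. In $L(x,y,{_a^CD}^{\alpha}_x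 y)$, the function $y$ and its Caputo derivative are evaluated at $x$; $\frac{\partial L}{\partial y}$ and $\frac{\partial L}{\partial({_a^CD}^{\alpha}_x y)}$ denote the partial derivatives of $L$ with respect to its second and third arguments, evaluated at $(x,y(x),{_a^CD}^{\alpha}_x y(x))$; the right Caputo derivative in the equation acts on the latter as a function of $x$. The admissible functions are those $y\in C^1([a,b])$ satisfying the boundary conditions; a solution of the extremization problem is an admissible function that minimizes or maximizes $J$ over the admissible functions. *)

theory Defs
  imports "HOL-Analysis.Analysis"
begin

text \<open>
  Smoothness on a set that need not be open, with derivatives relative to the set (hence
  one-sided at end points). It is only used for \<open>{a..b}\<close> and \<open>{a..b} \<times> UNIV\<close> with \<open>a < b\<close>: convex
  sets with nonempty interior, on which the derivative relative to the set is unique.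
\<close>

definition C1_on :: "'a::real_normed_vector set \<Rightarrow> ('a \<Rightarrow> 'b::real_normed_vector) \<Rightarrow> bool" where
  "C1_on S f \<longleftrightarrow> (\<exists>f' :: 'a \<Rightarrow> 'a \<Rightarrow>\<^sub>L 'b.
     (\<forall>x\<in>S. (f has_derivative blinfun_apply (f' x)) (at x within S)) \<and> continuous_on S f')"

definition C2_on :: "'a::real_normed_vector set \<Rightarrow> ('a \<Rightarrow> 'b::real_normed_vector) \<Rightarrow> bool" where
  "C2_on S f \<longleftrightarrow> (\<exists>f' :: 'a \<Rightarrow> 'a \<Rightarrow>\<^sub>L 'b.
     (\<forall>x\<in>S. (f has_derivative blinfun_apply (f' x)) (at x within S)) \<and> C1_on S f')"

definition left_RL_integral :: "real \<Rightarrow> real \<Rightarrow> (real \<Rightarrow> real) \<Rightarrow> real \<Rightarrow> real" where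
  "left_RL_integral \<alpha> a h x =
     1 / Gamma \<alpha> * (LINT u:{a..x}|lebesgue. h u / (x - u) powr (1 - \<alpha>))"

definition right_RL_integral :: "real \<Rightarrow> real \<Rightarrow> (real \<Rightarrow> real) \<Rightarrow> real \<Rightarrow> real" where
  "right_RL_integral \<alpha> b h x =
     1 / Gamma \<alpha> * (LINT u:{x..b}|lebesgue. h u / (u - x) powr (1 - \<alpha>))"

text \<open>
  The Caputo derivatives see \<open>deriv h\<close> only up to a null set, so its values at the end points of
  the interval, where \<open>h\<close> is constrained from one side only, are irrelevant.
\<close>

definition left_caputo :: "real \<Rightarrow> real \<Rightarrow> (real \<Rightarrow> real) \<Rightarrow> real \<Rightarrow> real" where
  "left_caputo \<alpha> a h x = left_RL_integral (1 - \<alpha>) a (deriv h) x"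

definition right_caputo :: "real \<Rightarrow> real \<Rightarrow> (real \<Rightarrow> real) \<Rightarrow> real \<Rightarrow> real" where
  "right_caputo \<alpha> b h x = - right_RL_integral (1 - \<alpha>) b (deriv h) x"

text \<open>
  \<open>deriv\<close> and the Lebesgue integral are total functions. The following says that the value of
  \<open>right_caputo\<close> at \<open>x\<close> is genuine: \<open>h'\<close> exists almost everywhere on \<open>[x, b]\<close> and the defining
  integral converges. As \<open>(u - x) powr \<alpha>\<close> is bounded on \<open>[x, b]\<close> for \<open>\<alpha> > 0\<close>, this includes the
  integrability of \<open>h'\<close> on \<open>[x, b]\<close>.
\<close>

definition right_caputo_exists :: "real \<Rightarrow> real \<Rightarrow> (real \<Rightarrow> real) \<Rightarrow> real \<Rightarrow> bool" where
  "right_caputo_exists \<alpha> b h x \<longleftrightarrow>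
     (AE u in lebesgue. u \<in> {x..b} \<longrightarrow> h field_differentiable (at u)) \<and>
     set_integrable lebesgue {x..b} (\<lambda>u. deriv h u / (u - x) powr \<alpha>)"

definition partial2 :: "(real \<times> real \<times> real \<Rightarrow> real) \<Rightarrow> real \<Rightarrow> real \<Rightarrow> real \<Rightarrow> real" where
  "partial2 L x y v = deriv (\<lambda>s. L (x, s, v)) y"

definition partial3 :: "(real \<times> real \<times> real \<Rightarrow> real) \<Rightarrow> real \<Rightarrow> real \<Rightarrow> real \<Rightarrow> real" where
  "partial3 L x y v = deriv (\<lambda>s. L (x, y, s)) v"

definition action ::
  "real \<Rightarrow> real \<Rightarrow> real \<Rightarrow> (real \<times> real \<times> real \<Rightarrow> real) \<Rightarrow> (real \<Rightarrow> real) \<Rightarrow> real" where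
  "action \<alpha> a b L y = (LINT x:{a..b}|lebesgue. L (x, y x, left_caputo \<alpha> a y x))"

definition admissible :: "real \<Rightarrow> real \<Rightarrow> real \<Rightarrow> real \<Rightarrow> (real \<Rightarrow> real) set" where
  "admissible a b ya yb = {y. C1_on {a..b} y \<and> y a = ya \<and> y b = yb}"

definition is_extremizer ::
  "real \<Rightarrow> real \<Rightarrow> real \<Rightarrow> (real \<times> real \<times> real \<Rightarrow> real) \<Rightarrow> real \<Rightarrow> real \<Rightarrow> (real \<Rightarrow> real) \<Rightarrow> bool" where
  "is_extremizer \<alpha> a b L ya yb y \<longleftrightarrow> y \<in> admissible a b ya yb \<and>
     ((\<forall>z\<in>admissible a b ya yb. action \<alpha> a b L y \<le> action \<alpha> a b L z) \<or>
      (\<forall>z\<in>admissible a b ya yb. action \<alpha> a b L z \<le> action \<alpha> a b L y))"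

text \<open>
  The fractional Euler--Lagrange equation, on \<open>{a..<b}\<close>. The end point \<open>b\<close> has to be excluded: there
  the right Caputo derivative is an integral over a null set, so it vanishes identically, and in
  general it is not the limit of its values as \<open>x\<close> tends to \<open>b\<close>.
\<close>

definition euler_lagrange ::
  "real \<Rightarrow> real \<Rightarrow> real \<Rightarrow> (real \<times> real \<times> real \<Rightarrow> real) \<Rightarrow> (real \<Rightarrow> real) \<Rightarrow> bool" where
  "euler_lagrange \<alpha> a b L y \<longleftrightarrow>
     (let g = (\<lambda>x. partial3 L x (y x) (left_caputo \<alpha> a y x)) in
      \<forall>x\<in>{a..<b}. right_caputo_exists \<alpha> b g x \<and>
        partial2 L x (y x) (left_caputo \<alpha> a y x) + right_caputo \<alpha> b g x = 0)"

end

(*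
  Let v be the Caputo derivative of y, and p, g the partial derivatives of L with respect to y and v along
  the extremal. The first variation and the du Bois-Reymond lemma give the integrated equation
  J_b^(1-alpha) g = - int_x^b p, and Abel inversion turns it into g = - J_b^alpha p. Differentiating the integrated
  equation yields the Euler-Lagrange equation as soon as g is absolutely continuous on [c, b] and g' is
  integrable against the singular weight (u - c)^(-alpha), for every c < b. This regularity cannot be read off
  the Hoelder continuity of p and is the core of the proof.

  It comes from a quadratic energy estimate at the critical exponent. Expanding the square shows that the
  fractional integral v of the bounded function y' has finite Gagliardo energy
  int int (v(x+t) - v(x))^2 t^(-1-2(1-alpha)) dt dx: the logarithmic divergence at t = 0 cancels because the
  increment of the kernel has mean zero. As L is C^2, the energy passes from v to p. It bounds the integral of
  d^(-3) (q(l) - 2 q(l+d) + q(l+2d))^2 for q = J_b^alpha p, and averaging over dyadic grids makes some grid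
  have bounded dyadic energy. The dyadic slopes of q then form a martingale bounded in L^2, whose limit is the
  integrable derivative of q. The estimates on windows of length R at distance R from c, summed over R = 2^(-k),
  give the weighted integrability.
*)
theory Submission
  imports Defs
begin

section \<open>Fractional integration kernels\<close>

text \<open>Since \<open>y'\<close> is merely continuous, \<open>v\<close> and \<open>p\<close> are
  in general only Hoelder of exponent 1 - \<alpha>, and J_b^\<alpha> adds \<alpha>: the exponents
  sum to exactly 1, the Zygmund borderline, where a function may be nowhere differentiable. Square
  integrability in place of suprema survives there: an energy of order 1 - \<alpha> for p becomes a
  square integrable derivative of J_b^\<alpha> p, without loss. A global L^2 bound on g' would still
  not control its integral against (u - c)^(-\<alpha>), a weight that is square integrable only for
  \<alpha> < 1/2. Hence the energy is localised: on windows of length R it is O(R^\<alpha>), so by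
  Cauchy-Schwarz g' has L^1 norm O(R^((1 + \<alpha>) / 2)) there; the weight costs R^(-\<alpha>),
  and R^((1 - \<alpha>) / 2) remains, which is summable for every \<alpha> < 1. As p need not vanish
  at b, its cut-off there jumps. The constant p b is therefore split off; its fractional integral is
  a multiple of (b - x)^\<alpha>, whose derivative is explicit.\<close>

text \<open>The Riemann--Liouville kernel without its factor \<open>1 / Gamma s\<close>.\<close>

definition rker :: "real \<Rightarrow> real \<Rightarrow> real" where
  "rker s t = (if 0 < t then t powr (s - 1) else 0)"

definition rdiff :: "real \<Rightarrow> real \<Rightarrow> real" where
  "rdiff s t = rker s (t + 1) - rker s t"

text \<open>Unfolds to \<open>rker s t - 2 * rker s (t - 1) + rker s (t - 2)\<close>, the kernel
  that represents the second difference \<open>d2\<close> of a right fractional integral at unit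
  scale.\<close>

definition rdiff2 :: "real \<Rightarrow> real \<Rightarrow> real" where
  "rdiff2 s t = rdiff s (t - 1) - rdiff s (t - 2)"

lemma rker_measurable [measurable]: "rker s \<in> borel_measurable borel"
  unfolding rker_def[abs_def] by measurable

lemma rdiff_measurable [measurable]: "rdiff s \<in> borel_measurable borel"
  unfolding rdiff_def[abs_def] by measurable

lemma rdiff2_measurable [measurable]: "rdiff2 s \<in> borel_measurable borel"
  unfolding rdiff2_def[abs_def] by measurable

lemma rker_nonneg [simp]: "0 \<le> rker s t"
  by (simp add: rker_def)

lemma rker_nonpos: "t \<le> 0 \<Longrightarrow> rker s t = 0"
  by (simp add: rker_def)

text \<open>Homogeneity of degree s - 1. The additional factor \<open>h\<close> on the left is the
  Jacobian of the dilation, so a change of scale under the integral costs exactly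
  \<open>h powr s\<close>.\<close>

lemma rker_scale: "0 < h \<Longrightarrow> h * rker s (h * t) = h powr s * rker s t"
  by (auto simp: rker_def powr_mult powr_diff zero_less_mult_iff)

lemma has_bochner_integral_powr_from_0:
  assumes "a > (-1::real)" "c \<ge> 0"
  shows "has_bochner_integral lborel (\<lambda>t. indicator {0<..c} t * t powr a) (c powr (a+1) / (a+1))"
proof (rule has_bochner_integral_nn_integral)
  have "(\<integral>\<^sup>+t. ennreal (indicator {0..c} t * t powr a) \<partial>lborel) = ennreal (c powr (a+1) / (a+1))"
    by (rule nn_integral_has_integral_lebesgue) (use has_integral_powr_from_0[OF assms] in auto)
  then show "(\<integral>\<^sup>+t. ennreal (indicator {0<..c} t * t powr a) \<partial>lborel) = ennreal (c powr (a+1) / (a+1))"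
    by (smt (verit) nn_integral_cong indicator_simps greaterThanAtMost_iff atLeastAtMost_iff powr_0 mult_eq_0_iff)
qed (use assms in auto)

lemma has_bochner_integral_powr_to_inf:
  assumes "a < (-1::real)" "c > 0"
  shows "has_bochner_integral lborel (\<lambda>t. indicator {c..} t * t powr a) (- (c powr (a+1)) / (a+1))"
proof (rule has_bochner_integral_nn_integral)
  show "(\<integral>\<^sup>+t. ennreal (indicator {c..} t * t powr a) \<partial>lborel) = ennreal (- (c powr (a+1)) / (a+1))"
    by (rule nn_integral_has_integral_lebesgue) (use has_integral_powr_to_inf[OF assms] in auto)
  show "0 \<le> - (c powr (a+1)) / (a+1)"
    using assms by (intro divide_nonpos_neg) auto
qed auto

lemma integrable_indicator_powr_from_0:
  "a > (-1::real) \<Longrightarrow> integrable lborel (\<lambda>t. indicator {0<..c} t * t powr a)"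
proof (cases "c \<ge> 0")
  case False
  then have "{0<..c} = {}" by auto
  then show ?thesis by simp
qed (use has_bochner_integral_powr_from_0 in \<open>auto simp: has_bochner_integral_iff\<close>)

lemma integrable_indicator_powr_to_inf:
  "a < (-1::real) \<Longrightarrow> c > 0 \<Longrightarrow> integrable lborel (\<lambda>t. indicator {c..} t * t powr a)"
  using has_bochner_integral_powr_to_inf by (auto simp: has_bochner_integral_iff)

lemma integrable_rker_bounded:
  assumes "0 < s"
  shows "integrable lborel (\<lambda>t. indicator {..c} t * rker s (t + d))"
proof -
  have "integrable lborel (\<lambda>t. indicator {0<..c+d} t * t powr (s - 1))"
    by (rule integrable_indicator_powr_from_0) (use assms in auto)
  from lborel_integrable_real_affine[OF this, of 1 d]
  show ?thesis
    by (rule Bochner_Integration.integrable_cong[THEN iffD1, rotated -1])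
       (auto simp: rker_def indicator_def add.commute)
qed

lemma rker_increment_bound:
  assumes "0 < t" "0 \<le> h" "0 < s" "s < 1"
  shows "\<bar>rker s (t + h) - rker s t\<bar> \<le> h * t powr (s - 2)"
proof (cases "h = 0")
  case False
  then have h: "h > 0" using assms by auto
  have "\<exists>z>t. z < t + h \<and> (t+h) powr (s-1) - t powr (s-1) = (t + h - t) * ((s-1) * z powr (s - 1 - 1))"
  proof (rule MVT2)
    show "t < t + h" using h by simp
    fix x assume "t \<le> x"
    then show "((\<lambda>x. x powr (s-1)) has_real_derivative (s-1) * x powr (s - 1 - 1)) (at x)"
      using assms by (intro has_real_derivative_powr) auto
  qed
  then obtain z where z: "z > t" "z < t + h" "(t+h) powr (s-1) - t powr (s-1) = h * ((s-1) * z powr (s - 2))"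
    by auto
  have "\<bar>rker s (t + h) - rker s t\<bar> = h * ((1-s) * z powr (s-2))"
    using z assms h by (simp add: rker_def abs_mult)
  also have "\<dots> \<le> h * (1 * t powr (s-2))"
    using z assms h by (intro mult_left_mono mult_mono powr_mono2') auto
  finally show ?thesis by simp
qed (use assms in auto)

lemma rdiff_bound: "0 < t \<Longrightarrow> 0 < s \<Longrightarrow> s < 1 \<Longrightarrow> \<bar>rdiff s t\<bar> \<le> t powr (s - 2)"
  using rker_increment_bound[of t 1 s] by (simp add: rdiff_def)

lemma rdiff_eq_0: "t \<le> -1 \<Longrightarrow> rdiff s t = 0"
  by (simp add: rdiff_def rker_def)

lemma rdiff2_eq_0: "t \<le> 0 \<Longrightarrow> rdiff2 s t = 0"
  by (simp add: rdiff2_def rdiff_eq_0)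

text \<open>On (-1, 1] the singularities at -1 and 0 have order s - 1 and are integrable; beyond 1
  the increment decays like t^(s - 2), which leaves room for a weight of exponent below 1 -
  s.\<close>

lemma rdiff_weight_integrable:
  assumes "0 < s" "0 \<le> \<delta>" "s + \<delta> < 1"
  shows "integrable lborel (\<lambda>t. (1 + \<bar>t\<bar>) powr \<delta> * rdiff s t)"
proof (rule Bochner_Integration.integrable_bound)
  let ?F = "\<lambda>t. 2 powr \<delta> * (indicator {..1} t * rker s (t + 1) + indicator {..1} t * rker s (t + 0)
     + indicator {1..} t * t powr (s - 2 + \<delta>))"
  show "integrable lborel ?F"
    using assms by (intro integrable_mult_right Bochner_Integration.integrable_add integrable_rker_bounded integrable_indicator_powr_to_inf) auto
  show "AE t in lborel. norm ((1 + \<bar>t\<bar>) powr \<delta> * rdiff s t) \<le> norm (?F t)"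
  proof (rule AE_I2)
    fix t :: real
    consider "t \<le> -1" | "-1 < t" "t \<le> 1" | "1 < t" by linarith
    then show "norm ((1 + \<bar>t\<bar>) powr \<delta> * rdiff s t) \<le> norm (?F t)"
    proof cases
      case 2
      have "(1 + \<bar>t\<bar>) powr \<delta> \<le> 2 powr \<delta>"
        using 2 assms by (intro powr_mono2) auto
      moreover have "\<bar>rdiff s t\<bar> \<le> rker s (t + 1) + rker s (t + 0)"
        using rker_nonneg[of s t] rker_nonneg[of s "t+1"] by (simp add: rdiff_def del: rker_nonneg)
      ultimately have "(1 + \<bar>t\<bar>) powr \<delta> * \<bar>rdiff s t\<bar> \<le> 2 powr \<delta> * (rker s (t + 1) + rker s (t + 0))"
        by (intro mult_mono) auto
      also have "\<dots> \<le> ?F t" using 2 by (auto intro!: mult_left_mono)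
      finally show ?thesis by (simp add: abs_mult)
    next
      case 3
      have "(1 + \<bar>t\<bar>) powr \<delta> \<le> (2 * t) powr \<delta>"
        using 3 assms by (intro powr_mono2) auto
      moreover have "\<bar>rdiff s t\<bar> \<le> t powr (s - 2)"
        using 3 assms by (intro rdiff_bound) auto
      ultimately have "(1 + \<bar>t\<bar>) powr \<delta> * \<bar>rdiff s t\<bar> \<le> (2 * t) powr \<delta> * t powr (s-2)"
        by (intro mult_mono) auto
      also have "\<dots> = ?F t" using 3 by (simp add: powr_mult powr_add)
      finally show ?thesis by (simp add: abs_mult)
    qed (simp add: rdiff_eq_0)
  qed
qed measurable

lemma rdiff_integrable: "0 < s \<Longrightarrow> s < 1 \<Longrightarrow> integrable lborel (rdiff s)"
  using rdiff_weight_integrable[of s 0] by (simp add: add_pos_nonneg[THEN less_imp_neq, symmetric])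

text \<open>The two kernels in \<open>rdiff s\<close> have infinite integrals and cannot be
  cancelled one by one. Self-similarity helps: two consecutive unit increments make an increment
  over length 2, which is a dilated copy of \<open>rdiff s\<close>. Hence the integral I satisfies 2
  * I = 2 powr s * I, and s < 1 forces I = 0.\<close>

lemma integral_rdiff:
  assumes "0 < s" "s < 1"
  shows "(\<integral>t. rdiff s t \<partial>lborel) = 0"
proof -
  let ?I = "\<integral>t. rdiff s t \<partial>lborel"
  note int = rdiff_integrable[OF assms]
  have int1: "integrable lborel (\<lambda>t. rdiff s (t + 1))"
    using lborel_integrable_real_affine[OF int, of 1 1] by (simp add: add.commute)
  have I1: "(\<integral>t. rdiff s (t + 1) \<partial>lborel) = ?I"
    using lborel_integral_real_affine[of 1 "rdiff s" 1] by (simp add: add.commute)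
  have *: "2 * (rdiff s (2 * t) + rdiff s (2 * t + 1)) = 2 powr s * rdiff s t" for t
    using rker_scale[of 2 s t] rker_scale[of 2 s "t + 1"] unfolding rdiff_def
    by (simp add: algebra_simps)
  have "?I + ?I = (\<integral>t. rdiff s t + rdiff s (t+1) \<partial>lborel)"
    by (simp add: int int1 I1)
  also have "\<dots> = (\<integral>t. 2 * (rdiff s (2 * t) + rdiff s (2 * t + 1)) \<partial>lborel)"
    using lborel_integral_real_affine[of 2 "\<lambda>t. rdiff s t + rdiff s (t + 1)" 0]
    by (simp del: distrib_left_numeral)
  also have "\<dots> = 2 powr s * ?I"
    unfolding * by simp
  finally have "(2 - 2 powr s) * ?I = 0" by (simp add: algebra_simps)
  moreover have "2 powr s < 2 powr 1"
    using assms by (intro powr_less_mono) auto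
  ultimately show ?thesis by simp
qed

lemma rdiff2_integrable:
  assumes "0 < s" "s < 1"
  shows "integrable lborel (rdiff2 s)"
proof -
  note int = rdiff_integrable[OF assms]
  show ?thesis
    using lborel_integrable_real_affine[OF int, of 1 "-1"] lborel_integrable_real_affine[OF int, of 1 "-2"]
    unfolding rdiff2_def[abs_def] by (auto simp: algebra_simps)
qed

lemma integral_rdiff2:
  assumes "0 < s" "s < 1"
  shows "(\<integral>t. rdiff2 s t \<partial>lborel) = 0"
proof -
  note int = rdiff_integrable[OF assms]
  show ?thesis
    using lborel_integrable_real_affine[OF int, of 1 "-1"] lborel_integrable_real_affine[OF int, of 1 "-2"]
      lborel_integral_real_affine[of 1 "rdiff s" "-1"] lborel_integral_real_affine[of 1 "rdiff s" "-2"]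
    unfolding rdiff2_def[abs_def] by (auto simp: algebra_simps)
qed

text \<open>The mean value theorem is applied twice. For t \<ge> 4 the intermediate point exceeds t
  - 2 \<ge> t/2, and 16 = 2 * 2^3 bounds the product of (1 - s) * (2 - s) \<le> 2 with the factor 2
  powr (3 - s) from halving \<open>t\<close>.\<close>

lemma rdiff2_bound:
  assumes "4 \<le> t" "0 < s" "s < 1"
  shows "\<bar>rdiff2 s t\<bar> \<le> 16 * t powr (s - 3)"
proof -
  have "\<exists>z>t-2. z < t - 1 \<and> rdiff s (t-1) - rdiff s (t-2) = (t - 1 - (t - 2)) * ((s-1) * (z+1) powr (s - 2) - (s-1) * z powr (s-2))"
  proof (rule MVT2)
    fix x assume "t - 2 \<le> x"
    then have x: "x > 0" using assms by auto
    have "((\<lambda>x. (x+1) powr (s-1) - x powr (s-1)) has_real_derivative (s-1) * (x+1) powr (s - 1 - 1) - (s-1) * x powr (s-1-1)) (at x)"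
      using x by (auto intro!: derivative_eq_intros)
    then have "((\<lambda>x. (x+1) powr (s-1) - x powr (s-1)) has_real_derivative (s-1) * (x+1) powr (s - 2) - (s-1) * x powr (s-2)) (at x)"
      by (simp add: diff_diff_eq)
    then show "(rdiff s has_real_derivative (s-1) * (x+1) powr (s - 2) - (s-1) * x powr (s-2)) (at x)"
      by (rule has_field_derivative_transform_within_open[where S="{0<..}"])
         (use x in \<open>auto simp: rdiff_def rker_def\<close>)
  qed auto
  then obtain z where z: "z > t-2" "rdiff2 s t = (s-1) * ((z+1) powr (s - 2) - z powr (s-2))"
    unfolding rdiff2_def by (auto simp: algebra_simps)
  have "\<exists>w>z. w < z + 1 \<and> (z+1) powr (s-2) - z powr (s-2) = (z + 1 - z) * ((s-2) * w powr (s - 2 - 1))"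
    using z assms by (intro MVT2 has_real_derivative_powr) auto
  then obtain w where w: "w > z" "(z+1) powr (s-2) - z powr (s-2) = (s-2) * w powr (s-3)"
    by auto
  have "\<bar>rdiff2 s t\<bar> = (1-s) * (2-s) * w powr (s-3)"
    using z w assms by (simp add: abs_mult)
  also have "\<dots> \<le> 2 * (t/2) powr (s-3)"
  proof (rule mult_mono)
    have "(1-s)*(2-s) \<le> 1 * 2" using assms by (intro mult_mono) auto
    then show "(1-s)*(2-s) \<le> 2" by simp
    show "w powr (s-3) \<le> (t/2) powr (s-3)" using z w assms by (intro powr_mono2') auto
  qed auto
  also have "(t/2) powr (s-3) = t powr (s-3) * 2 powr (3 - s)"
    using assms by (simp add: powr_divide powr_diff powr_minus field_simps)
  also have "2 * (t powr (s-3) * 2 powr (3-s)) \<le> 2 * (t powr (s-3) * 2 powr 3)"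
    using assms by (intro mult_left_mono powr_mono) auto
  finally show ?thesis by simp
qed

text \<open>Second differences gain one more power of decay. The exponent used later is 2 - 2 * s:
  it lies below 2 - s, but above the limit 1 - s of \<open>rdiff_weight_integrable\<close>, so first
  differences would not suffice.\<close>

lemma rdiff2_weight_integrable:
  assumes "0 < s" "s < 1" "0 \<le> \<theta>" "\<theta> < 2 - s"
  shows "integrable lborel (\<lambda>t. \<bar>t\<bar> powr \<theta> * rdiff2 s t)"
proof (rule Bochner_Integration.integrable_bound)
  let ?F = "\<lambda>t. 4 powr \<theta> * \<bar>rdiff2 s t\<bar> + 16 * (indicator {4..} t * t powr (s - 3 + \<theta>))"
  show "integrable lborel ?F"
    using assms by (intro Bochner_Integration.integrable_add integrable_mult_right integrable_abs rdiff2_integrable integrable_indicator_powr_to_inf) auto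
  show "AE t in lborel. norm (\<bar>t\<bar> powr \<theta> * rdiff2 s t) \<le> norm (?F t)"
  proof (rule AE_I2)
    fix t :: real
    consider "t \<le> 0" | "0 < t" "t < 4" | "4 \<le> t" by linarith
    then show "norm (\<bar>t\<bar> powr \<theta> * rdiff2 s t) \<le> norm (?F t)"
    proof cases
      case 2
      have "\<bar>t\<bar> powr \<theta> \<le> 4 powr \<theta>"
        using 2 assms by (intro powr_mono2) auto
      then show ?thesis using 2 by (auto simp: abs_mult intro!: mult_right_mono)
    next
      case 3
      have "\<bar>t\<bar> powr \<theta> * \<bar>rdiff2 s t\<bar> \<le> t powr \<theta> * (16 * t powr (s - 3))"
        using 3 assms by (intro mult_mono rdiff2_bound) auto
      also have "\<dots> = 16 * (indicator {4..} t * t powr (s - 3 + \<theta>))"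
        using 3 by (simp add: powr_add)
      also have "\<dots> \<le> ?F t" by simp
      finally show ?thesis by (simp add: abs_mult)
    qed (simp add: rdiff2_eq_0)
  qed
qed measurable

lemma
  fixes f g :: "real \<Rightarrow> real"
  assumes f: "integrable lborel f" and g: "integrable lborel g"
  shows integrable_lborel_mult_prod: "integrable lborel (\<lambda>p. f (fst p) * g (snd p))"
    and integral_lborel_mult_prod: "(\<integral>p. f (fst p) * g (snd p) \<partial>lborel) = (\<integral>x. f x \<partial>lborel) * (\<integral>x. g x \<partial>lborel)"
proof -
  have [measurable]: "f \<in> borel_measurable borel" "g \<in> borel_measurable borel"
    using assms by auto
  show i: "integrable lborel (\<lambda>p. f (fst p) * g (snd p))"
    unfolding lborel_prod[symmetric]
    by (rule lborel_pair.Fubini_integrable) (use f g in \<open>auto simp: abs_mult\<close>)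
  show "(\<integral>p. f (fst p) * g (snd p) \<partial>lborel) = (\<integral>x. f x \<partial>lborel) * (\<integral>x. g x \<partial>lborel)"
    using lborel_pair.integral_fst'[OF i[unfolded lborel_prod[symmetric]]] by (simp add: lborel_prod)
qed

section \<open>Integrability of the kernel product against a logarithm\<close>

lemma abs_ln_le:
  assumes "0 < (z::real)" "0 < \<delta>"
  shows "\<bar>ln z\<bar> \<le> (z powr \<delta> + z powr (-\<delta>)) / \<delta>"
proof (cases "1 \<le> z")
  case True
  have "ln z \<le> z powr \<delta> / \<delta>" by (rule ln_powr_bound) (use assms True in auto)
  also have "\<dots> \<le> (z powr \<delta> + z powr (-\<delta>)) / \<delta>" using assms by (intro divide_right_mono) auto
  finally show ?thesis using True by simp
next
  case False
  then have "ln (1/z) \<le> (1/z) powr \<delta> / \<delta>"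
    using assms by (intro ln_powr_bound) auto
  also have "(1/z) powr \<delta> = z powr (-\<delta>)"
    using assms by (simp add: powr_divide powr_minus field_simps)
  also have "z powr (-\<delta>) / \<delta> \<le> (z powr \<delta> + z powr (-\<delta>)) / \<delta>" using assms by (intro divide_right_mono) auto
  finally show ?thesis using False assms by (simp add: ln_div)
qed

lemma integrable_abs_powr_local:
  assumes "-1 < (a::real)"
  shows "integrable lborel (\<lambda>t. indicator {-1<..<1} t * \<bar>t\<bar> powr a)"
proof (rule Bochner_Integration.integrable_bound)
  note i = integrable_indicator_powr_from_0[OF assms, of 1]
  let ?F = "\<lambda>t. indicator {0<..1} t * t powr a + indicator {0<..1} (0 + (-1) * t) * (0 + (-1) * t) powr a"
  show "integrable lborel ?F"
    by (intro Bochner_Integration.integrable_add i lborel_integrable_real_affine[OF i]) auto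
  show "AE t in lborel. norm (indicator {-1<..<1} t * \<bar>t\<bar> powr a) \<le> norm (?F t)"
    by (rule AE_I2) (auto simp: indicator_def)
qed measurable

text \<open>The point where the logarithm meets the two singularities of the kernel is
  handled by \<open>A\<^sup>-\<^sup>p B\<^sup>-\<^sup>q \<le> A\<^sup>-\<^sup>p\<^sup>-\<^sup>q + B\<^sup>-\<^sup>p\<^sup>-\<^sup>q\<close>.\<close>

lemma powr_neg_mult_le:
  assumes "0 < A" "0 < (B::real)" "p \<le> 0" "q \<le> 0"
  shows "A powr p * B powr q \<le> A powr (p + q) + B powr (p + q)"
proof (cases "A \<le> B")
  case True
  then have "A powr p * B powr q \<le> A powr p * A powr q"
    using assms by (intro mult_left_mono powr_mono2') auto
  also have "\<dots> \<le> A powr (p + q) + B powr (p + q)" by (simp add: powr_add)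
  finally show ?thesis .
next
  case False
  then have "A powr p * B powr q \<le> B powr p * B powr q"
    using assms by (intro mult_right_mono powr_mono2') auto
  also have "\<dots> \<le> A powr (p + q) + B powr (p + q)" by (simp add: powr_add)
  finally show ?thesis .
qed

lemma rdiff_log_integrable:
  assumes s: "0 < s" "s < 1"
  shows "integrable lborel (\<lambda>p. rdiff s (fst p) * rdiff s (snd p) * ln \<bar>fst p - snd p\<bar>)"
proof -
  \<comment> \<open>The logarithm is bounded by powers of exponent \<delta> and -\<delta>. The
    choice leaves room on both sides: s + \<delta> < 1 keeps the weighted kernel integrable at
    infinity, and \<delta> < s keeps the exponent \<open>a\<close> of the merged singularity above
    -1.\<close>
  define \<delta> where "\<delta> = min s (1 - s) / 2"
  have \<delta>: "0 < \<delta>" "\<delta> < s" "s + \<delta> < 1" using s by (auto simp: \<delta>_def min_def field_simps)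
  define a where "a = s - 1 - \<delta>"
  have a: "-1 < a" "a < 0" using \<delta> s by (auto simp: a_def)
  define \<phi> :: "real \<Rightarrow> real" where "\<phi> t = indicator {-1<..<1} t * \<bar>t\<bar> powr a" for t
  \<comment> \<open>\<open>\<psi>\<close> accounts for the constant 1 in
    \<open>z powr a \<le> \<phi> z + 1\<close>, which occurs only where x and y are closer than
    1.\<close>
  define \<psi> :: "real \<Rightarrow> real" where "\<psi> t = indicator {-1<..<1} t" for t
  define W where "W t = (1 + \<bar>t\<bar>) powr \<delta> * \<bar>rdiff s t\<bar>" for t
  have [measurable]: "\<phi> \<in> borel_measurable borel" "\<psi> \<in> borel_measurable borel" "W \<in> borel_measurable borel"
    unfolding \<phi>_def \<psi>_def W_def by measurable
  have int_\<phi>: "integrable lborel \<phi>" using integrable_abs_powr_local[OF a(1)] by (simp add: \<phi>_def[abs_def])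
  have int_\<psi>: "integrable lborel \<psi>" unfolding \<psi>_def[abs_def] by (intro integrable_real_indicator) auto
  have int_W: "integrable lborel W"
    using integrable_abs[OF rdiff_weight_integrable[of s \<delta>]] s \<delta> unfolding W_def[abs_def] by (auto simp: abs_mult)
  have int_r: "integrable lborel (rdiff s)" using rdiff_integrable s by auto
  \<comment> \<open>\<open>D x\<close> dominates the inner integrand for fixed x. Only its first
    term grows with x; by translation invariance the integrals of the others do not depend on x. The
    resulting growth (1 + |x|) powr \<delta> is absorbed by the outer factor
    \<open>rdiff s x\<close>, which turns it into \<open>W x\<close>.\<close>
  define D where "D x y = (1 + \<bar>x\<bar>) powr \<delta> * W y + \<bar>rdiff s y\<bar> + \<phi> y + \<phi> (y + 1) + 2 * (\<phi> (y - x) + \<psi> (y - x))" for x y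
  have D: "\<bar>rdiff s y\<bar> * \<bar>ln \<bar>x - y\<bar>\<bar> \<le> D x y / \<delta>" for x y
  proof (cases "x = y")
    case False
    have "0 \<le> \<bar>x\<bar> * \<bar>y\<bar>" by simp
    then have "\<bar>x - y\<bar> \<le> (1 + \<bar>x\<bar>) * (1 + \<bar>y\<bar>)" unfolding distrib_left distrib_right by linarith
    then have "\<bar>x - y\<bar> powr \<delta> \<le> ((1 + \<bar>x\<bar>) * (1 + \<bar>y\<bar>)) powr \<delta>"
      using \<delta> by (intro powr_mono2) auto
    then have 1: "\<bar>rdiff s y\<bar> * \<bar>x - y\<bar> powr \<delta> \<le> (1 + \<bar>x\<bar>) powr \<delta> * W y"
      unfolding W_def by (subst (asm) powr_mult) (auto simp: mult_ac intro: mult_left_mono order_trans)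
    \<comment> \<open>Used with z = y and z = y + 1, the arguments at which the two kernels in
      \<open>rdiff s y\<close> are taken.\<close>
    have aux: "rker s z * \<bar>x - y\<bar> powr (-\<delta>) \<le> \<phi> z + \<phi> (y - x) + \<psi> (y - x)" if "\<bar>x - y\<bar> < 1" for z
    proof (cases "0 < z")
      case True
      have "rker s z * \<bar>x - y\<bar> powr (-\<delta>) \<le> z powr a + \<bar>x - y\<bar> powr a"
        unfolding rker_def a_def using powr_neg_mult_le[of z "\<bar>x-y\<bar>" "s-1" "-\<delta>"] True False s \<delta> by (auto simp: algebra_simps)
      also have "z powr a \<le> \<phi> z + 1"
        using True a powr_mono2'[of a 1 z] by (auto simp: \<phi>_def indicator_def)
      finally show ?thesis using that by (auto simp: \<phi>_def \<psi>_def indicator_def abs_minus_commute)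
    qed (auto simp: rker_def \<phi>_def \<psi>_def)
    have 2: "\<bar>rdiff s y\<bar> * \<bar>x - y\<bar> powr (-\<delta>) \<le> \<bar>rdiff s y\<bar> + \<phi> y + \<phi> (y + 1) + 2 * (\<phi> (y - x) + \<psi> (y - x))"
    proof (cases "\<bar>x - y\<bar> < 1")
      case True
      have "\<bar>rdiff s y\<bar> \<le> rker s (y + 1) + rker s y"
        using rker_nonneg[of s y] rker_nonneg[of s "y+1"] by (simp add: rdiff_def del: rker_nonneg)
      then have "\<bar>rdiff s y\<bar> * \<bar>x - y\<bar> powr (-\<delta>) \<le> (rker s (y + 1) + rker s y) * \<bar>x - y\<bar> powr (-\<delta>)"
        by (rule mult_right_mono) auto
      then show ?thesis using aux[OF True, of y] aux[OF True, of "y+1"] by (simp add: algebra_simps)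
    next
      case F: False
      have "\<bar>x - y\<bar> powr (-\<delta>) \<le> 1 powr (-\<delta>)" by (rule powr_mono2') (use F \<delta> in auto)
      then have "\<bar>rdiff s y\<bar> * \<bar>x - y\<bar> powr (-\<delta>) \<le> \<bar>rdiff s y\<bar> * 1" by (intro mult_left_mono) auto
      then show ?thesis by (auto simp: \<phi>_def \<psi>_def intro!: add_increasing2)
    qed
    have "\<bar>rdiff s y\<bar> * \<bar>ln \<bar>x - y\<bar>\<bar> \<le> \<bar>rdiff s y\<bar> * ((\<bar>x - y\<bar> powr \<delta> + \<bar>x - y\<bar> powr (-\<delta>)) / \<delta>)"
      by (intro mult_left_mono abs_ln_le) (use False \<delta> in auto)
    also have "\<dots> = (\<bar>rdiff s y\<bar> * \<bar>x - y\<bar> powr \<delta> + \<bar>rdiff s y\<bar> * \<bar>x - y\<bar> powr (-\<delta>)) / \<delta>"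
      by (simp add: algebra_simps)
    also have "\<dots> \<le> D x y / \<delta>"
      using 1 2 \<delta> by (intro divide_right_mono) (auto simp: D_def)
    finally show ?thesis .
  next
    case True
    have "0 \<le> D x y" unfolding D_def W_def \<phi>_def \<psi>_def by (intro add_nonneg_nonneg mult_nonneg_nonneg) auto
    then show ?thesis using True \<delta> by auto
  qed
  define C where "C = (\<integral>t. W t \<partial>lborel) + (\<integral>t. \<bar>rdiff s t\<bar> \<partial>lborel) + 4 * (\<integral>t. \<phi> t \<partial>lborel) + 2 * (\<integral>t. \<psi> t \<partial>lborel)"
  have sh: "integrable lborel (\<lambda>y. g (y + c))" "(\<integral>y. g (y + c) \<partial>lborel) = (\<integral>y. g y \<partial>lborel)"
    if "integrable lborel g" for g :: "real \<Rightarrow> real" and c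
    using lborel_integrable_real_affine[OF that, of 1 c] lborel_integral_real_affine[of 1 g c] by (auto simp: add.commute)
  note ii = int_W int_r int_\<phi> sh(1)[OF int_\<phi>] sh(1)[OF int_\<phi>, of "-x" for x, simplified] sh(1)[OF int_\<psi>, of "-x" for x, simplified]
  note ie = sh(2)[OF int_\<phi>] sh(2)[OF int_\<phi>, of "-x" for x, simplified] sh(2)[OF int_\<psi>, of "-x" for x, simplified]
  have int_D: "integrable lborel (D x)" for x
    unfolding D_def[abs_def] using ii by simp
  have I_D: "(\<integral>y. D x y \<partial>lborel) \<le> (1 + \<bar>x\<bar>) powr \<delta> * C" for x
  proof -
    have "(\<integral>y. D x y \<partial>lborel) = (1 + \<bar>x\<bar>) powr \<delta> * (\<integral>t. W t \<partial>lborel) + 1 * (\<integral>t. \<bar>rdiff s t\<bar> \<partial>lborel) + 1 * (4 * (\<integral>t. \<phi> t \<partial>lborel)) + 1 * (2 * (\<integral>t. \<psi> t \<partial>lborel))"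
      unfolding D_def using ii ie by simp
    also have "\<dots> \<le> (1 + \<bar>x\<bar>) powr \<delta> * (\<integral>t. W t \<partial>lborel) + (1 + \<bar>x\<bar>) powr \<delta> * (\<integral>t. \<bar>rdiff s t\<bar> \<partial>lborel) + (1 + \<bar>x\<bar>) powr \<delta> * (4 * (\<integral>t. \<phi> t \<partial>lborel)) + (1 + \<bar>x\<bar>) powr \<delta> * (2 * (\<integral>t. \<psi> t \<partial>lborel))"
    proof (intro add_mono mult_right_mono order_refl)
      show "1 \<le> (1 + \<bar>x\<bar>) powr \<delta>" "1 \<le> (1 + \<bar>x\<bar>) powr \<delta>" "1 \<le> (1 + \<bar>x\<bar>) powr \<delta>" using \<delta> by (auto intro!: ge_one_powr_ge_zero)
    qed (auto simp: \<phi>_def \<psi>_def W_def intro!: Bochner_Integration.integral_nonneg)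
    also have "\<dots> = (1 + \<bar>x\<bar>) powr \<delta> * C" by (simp add: C_def algebra_simps)
    finally show ?thesis .
  qed
  have int2: "integrable lborel (\<lambda>y. rdiff s x * rdiff s y * ln \<bar>x - y\<bar>)" for x
  proof (rule Bochner_Integration.integrable_bound[where f="\<lambda>y. \<bar>rdiff s x\<bar> * (D x y / \<delta>)"])
    show "integrable lborel (\<lambda>y. \<bar>rdiff s x\<bar> * (D x y / \<delta>))" using int_D by auto
    show "AE y in lborel. norm (rdiff s x * rdiff s y * ln \<bar>x - y\<bar>) \<le> norm (\<bar>rdiff s x\<bar> * (D x y / \<delta>))"
    proof (rule AE_I2)
      fix y
      have "\<bar>rdiff s x\<bar> * (\<bar>rdiff s y\<bar> * \<bar>ln \<bar>x - y\<bar>\<bar>) \<le> \<bar>rdiff s x\<bar> * (D x y / \<delta>)"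
        by (rule mult_left_mono[OF D]) auto
      also have "\<dots> \<le> norm (\<bar>rdiff s x\<bar> * (D x y / \<delta>))" unfolding real_norm_def by (rule abs_ge_self)
      finally show "norm (rdiff s x * rdiff s y * ln \<bar>x - y\<bar>) \<le> norm (\<bar>rdiff s x\<bar> * (D x y / \<delta>))" by (simp add: abs_mult mult.assoc)
    qed
  qed measurable
  show ?thesis
    unfolding lborel_prod[symmetric]
  proof (rule lborel_pair.Fubini_integrable)
    show "integrable lborel (\<lambda>x. \<integral>y. norm (rdiff s (fst (x, y)) * rdiff s (snd (x, y)) * ln \<bar>fst (x, y) - snd (x, y)\<bar>) \<partial>lborel)"
    proof (rule Bochner_Integration.integrable_bound[where f="\<lambda>x. W x * C / \<delta>"])
      show "integrable lborel (\<lambda>x. W x * C / \<delta>)" using int_W by auto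
      show "AE x in lborel. norm (\<integral>y. norm (rdiff s (fst (x, y)) * rdiff s (snd (x, y)) * ln \<bar>fst (x, y) - snd (x, y)\<bar>) \<partial>lborel) \<le> norm (W x * C / \<delta>)"
      proof (rule AE_I2)
        fix x
        have "(\<integral>y. norm (rdiff s x * rdiff s y * ln \<bar>x - y\<bar>) \<partial>lborel) \<le> (\<integral>y. \<bar>rdiff s x\<bar> * (D x y / \<delta>) \<partial>lborel)"
        proof (rule integral_mono)
          show "integrable lborel (\<lambda>y. \<bar>rdiff s x\<bar> * (D x y / \<delta>))" using int_D by auto
          show "integrable lborel (\<lambda>y. norm (rdiff s x * rdiff s y * ln \<bar>x - y\<bar>))" using int2 by (rule integrable_norm)
          fix y show "norm (rdiff s x * rdiff s y * ln \<bar>x - y\<bar>) \<le> \<bar>rdiff s x\<bar> * (D x y / \<delta>)"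
            using mult_left_mono[OF D[of y x], of "\<bar>rdiff s x\<bar>"] by (simp add: abs_mult mult.assoc)
        qed
        also have "\<dots> = \<bar>rdiff s x\<bar> * (\<integral>y. D x y \<partial>lborel) / \<delta>" by simp
        also have "\<dots> \<le> \<bar>rdiff s x\<bar> * ((1 + \<bar>x\<bar>) powr \<delta> * C) / \<delta>"
          using I_D \<delta> by (intro divide_right_mono mult_left_mono) auto
        also have "\<dots> = W x * C / \<delta>" by (simp add: W_def)
        also have "\<dots> \<le> norm (W x * C / \<delta>)" unfolding real_norm_def by (rule abs_ge_self)
        finally show "norm (\<integral>y. norm (rdiff s (fst (x, y)) * rdiff s (snd (x, y)) * ln \<bar>fst (x, y) - snd (x, y)\<bar>) \<partial>lborel) \<le> norm (W x * C / \<delta>)"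
          by auto
      qed
    qed measurable
    show "AE x in lborel. integrable lborel (\<lambda>y. rdiff s (fst (x, y)) * rdiff s (snd (x, y)) * ln \<bar>fst (x, y) - snd (x, y)\<bar>)"
      using int2 by simp
  qed measurable
qed

section \<open>The Gagliardo energy of a fractional integral\<close>

definition autocorr :: "(real \<Rightarrow> real) \<Rightarrow> real \<Rightarrow> real" where
  "autocorr f z = (\<integral>x. f x * f (x + z) \<partial>lborel)"

lemma autocorr_even: "autocorr f (- z) = autocorr f z"
  unfolding autocorr_def
  using lborel_integral_real_affine[of 1 "\<lambda>x. f x * f (x - z)" z] by (simp add: mult.commute add.commute)

lemma autocorr_measurable [measurable]:
  assumes [measurable]: "f \<in> borel_measurable borel"
  shows "autocorr f \<in> borel_measurable borel"
  unfolding autocorr_def[abs_def] by measurable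

locale bounded_support =
  fixes f :: "real \<Rightarrow> real" and M c d :: real
  assumes f_meas [measurable]: "f \<in> borel_measurable borel"
    and f_bound: "\<And>x. \<bar>f x\<bar> \<le> M"
    and f_supp: "\<And>x. x \<notin> {c..d} \<Longrightarrow> f x = 0"
    and c_le_d: "c \<le> d"
begin

lemma M_nonneg: "0 \<le> M"
  using f_bound[of 0] by linarith

lemma f_bound_indicator: "\<bar>f x\<bar> \<le> M * indicator {c..d} x"
  using f_bound[of x] f_supp[of x] by (auto simp: indicator_def)

lemma f_integrable: "integrable lborel f"
proof (rule Bochner_Integration.integrable_bound)
  show "integrable lborel (\<lambda>x. M * indicator {c..d} x)"
    by (intro integrable_mult_right integrable_real_indicator) (auto simp: emeasure_lborel_Icc_eq)
  show "AE x in lborel. norm (f x) \<le> norm (M * indicator {c..d} x)"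
    using f_bound_indicator M_nonneg by (intro AE_I2) (auto simp: abs_mult)
qed measurable

lemma integral_abs_f: "(\<integral>x. \<bar>f x\<bar> \<partial>lborel) \<le> M * (d - c)"
proof -
  have "(\<integral>x. \<bar>f x\<bar> \<partial>lborel) \<le> (\<integral>x. M * indicator {c..d} x \<partial>lborel)"
    by (intro integral_mono integrable_abs f_integrable integrable_mult_right integrable_real_indicator f_bound_indicator) (auto simp: emeasure_lborel_Icc_eq)
  then show ?thesis using c_le_d by simp
qed

lemma
  shows shift_prod_integrable: "integrable lborel (\<lambda>x. f (x + u) * f (x + w))"
    and integral_shift_prod: "(\<integral>x. f (x + u) * f (x + w) \<partial>lborel) = autocorr f (w - u)"
    and integral_abs_shift_prod: "(\<integral>x. \<bar>f (x + u) * f (x + w)\<bar> \<partial>lborel) \<le> M^2 * (d - c)"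
proof -
  have i: "integrable lborel (\<lambda>x. f (x + u))"
    using lborel_integrable_real_affine[OF f_integrable, of 1 u] by (simp add: add.commute)
  have b: "\<bar>f (x + u) * f (x + w)\<bar> \<le> M * \<bar>f (x + u)\<bar>" for x
    using mult_right_mono[OF f_bound[of "x+w"], of "\<bar>f (x+u)\<bar>"] by (simp add: abs_mult mult.commute)
  show j: "integrable lborel (\<lambda>x. f (x + u) * f (x + w))"
    by (rule Bochner_Integration.integrable_bound[OF integrable_mult_right[OF i, of M]])
       (use b M_nonneg in \<open>auto simp: abs_mult\<close>)
  show "(\<integral>x. f (x + u) * f (x + w) \<partial>lborel) = autocorr f (w - u)"
    unfolding autocorr_def
    using lborel_integral_real_affine[of 1 "\<lambda>x. f x * f (x + (w - u))" u] by (simp add: add.commute)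
  have "(\<integral>x. \<bar>f (x + u) * f (x + w)\<bar> \<partial>lborel) \<le> (\<integral>x. M * \<bar>f (x + u)\<bar> \<partial>lborel)"
    using i j b by (intro integral_mono) auto
  also have "\<dots> = M * (\<integral>x. \<bar>f x\<bar> \<partial>lborel)"
    using lborel_integral_real_affine[of 1 "\<lambda>x. \<bar>f x\<bar>" u] by (simp add: add.commute)
  also have "\<dots> \<le> M * (M * (d - c))" using integral_abs_f M_nonneg by (intro mult_left_mono)
  finally show "(\<integral>x. \<bar>f (x + u) * f (x + w)\<bar> \<partial>lborel) \<le> M^2 * (d - c)" by (simp add: power2_eq_square)
qed

lemma autocorr_bound: "\<bar>autocorr f z\<bar> \<le> M^2 * (d - c)"
  using order_trans[OF integral_abs_bound integral_abs_shift_prod[of 0 z]]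
  unfolding autocorr_def by simp

text \<open>The increment of the fractional integral of \<open>f\<close> over a step
  \<open>h\<close>, divided by \<open>h powr s\<close>; see \<open>LI_increment\<close>.\<close>

definition conv :: "real \<Rightarrow> real \<Rightarrow> real \<Rightarrow> real" where
  "conv s h x = (\<integral>t. f (x - h * t) * rdiff s t \<partial>lborel)"

lemma conv_measurable [measurable]: "case_prod (conv s) \<in> borel_measurable (borel \<Otimes>\<^sub>M borel)"
proof -
  have "(\<lambda>p. \<integral>t. f (snd p - fst p * t) * rdiff s t \<partial>lborel) \<in> borel_measurable (borel \<Otimes>\<^sub>M borel)"
    by measurable
  then show ?thesis unfolding conv_def by (simp add: case_prod_beta')
qed

lemma conv_integrand_integrable:
  assumes "0 < s" "s < 1"
  shows "integrable lborel (\<lambda>t. f (x - h * t) * rdiff s t)"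
proof (rule Bochner_Integration.integrable_bound)
  show "integrable lborel (\<lambda>t. M * rdiff s t)" using rdiff_integrable[OF assms] by auto
  show "AE t in lborel. norm (f (x - h * t) * rdiff s t) \<le> norm (M * rdiff s t)"
    using f_bound M_nonneg by (intro AE_I2) (auto simp: abs_mult intro!: mult_right_mono)
qed measurable

text \<open>The square is a double integral over two kernel variables. Integrating in
  \<open>x\<close> first leaves only the relative shift of the two factors, that is, the
  autocorrelation. Everything converges absolutely, since \<open>rdiff s\<close> is integrable and
  the autocorrelation is bounded.\<close>

lemma
  assumes s: "0 < s" "s < 1" and h: "0 < h"
  shows conv_square_integrable: "integrable lborel (\<lambda>x. (conv s h x)^2)"
    and integral_conv_square: "(\<integral>x. (conv s h x)^2 \<partial>lborel) =
       (\<integral>p. rdiff s (fst p) * rdiff s (snd p) * autocorr f (h * (fst p - snd p)) \<partial>lborel)"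
proof -
  define H where "H x p = (f (x - h * fst p) * rdiff s (fst p)) * (f (x - h * snd p) * rdiff s (snd p))" for x p
  note r = rdiff_integrable[OF s]
  have [measurable]: "(\<lambda>(p, x). H x p) \<in> borel_measurable (borel \<Otimes>\<^sub>M borel)"
    unfolding H_def borel_prod[symmetric] by measurable
  have eq: "(\<lambda>p. norm (H x p)) = (\<lambda>p. norm (H x p))" for x ..
  have 1: "(\<integral>x. norm (H x p) \<partial>lborel) \<le> \<bar>rdiff s (fst p) * rdiff s (snd p)\<bar> * (M^2 * (d - c))"
    and 2: "integrable lborel (\<lambda>x. H x p)"
    and 3: "(\<integral>x. H x p \<partial>lborel) = rdiff s (fst p) * rdiff s (snd p) * autocorr f (h * (fst p - snd p))" for p
  proof -
    have H: "H x p = rdiff s (fst p) * rdiff s (snd p) * (f (x + - h * fst p) * f (x + - h * snd p))" for x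
      by (simp add: H_def)
    show "integrable lborel (\<lambda>x. H x p)" unfolding H by (intro integrable_mult_right shift_prod_integrable)
    show "(\<integral>x. H x p \<partial>lborel) = rdiff s (fst p) * rdiff s (snd p) * autocorr f (h * (fst p - snd p))"
      unfolding H integral_mult_right_zero integral_shift_prod by (simp add: algebra_simps)
    have "(\<integral>x. norm (H x p) \<partial>lborel) = \<bar>rdiff s (fst p) * rdiff s (snd p)\<bar> * (\<integral>x. \<bar>f (x + - h * fst p) * f (x + - h * snd p)\<bar> \<partial>lborel)"
      unfolding H real_norm_def by (subst abs_mult) simp
    also have "\<dots> \<le> \<bar>rdiff s (fst p) * rdiff s (snd p)\<bar> * (M^2 * (d - c))"
      by (intro mult_left_mono integral_abs_shift_prod) auto
    finally show "(\<integral>x. norm (H x p) \<partial>lborel) \<le> \<bar>rdiff s (fst p) * rdiff s (snd p)\<bar> * (M^2 * (d - c))" .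
  qed
  have int: "integrable (lborel \<Otimes>\<^sub>M lborel) (\<lambda>(p, x). H x p)"
  proof (rule lborel_pair.Fubini_integrable)
    show "integrable lborel (\<lambda>p. \<integral>x. norm (case (p, x) of (p, x) \<Rightarrow> H x p) \<partial>lborel)"
    proof (rule Bochner_Integration.integrable_bound[where f="\<lambda>p. rdiff s (fst p) * rdiff s (snd p) * (M^2 * (d - c))"])
      show "integrable lborel (\<lambda>p. rdiff s (fst p) * rdiff s (snd p) * (M^2 * (d - c)))"
        by (intro integrable_mult_left integrable_lborel_mult_prod r)
      show "AE p in lborel. norm (\<integral>x. norm (case (p, x) of (p, x) \<Rightarrow> H x p) \<partial>lborel) \<le> norm (rdiff s (fst p) * rdiff s (snd p) * (M^2 * (d - c)))"
        using 1 c_le_d by (intro AE_I2) (simp add: abs_mult)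
    qed measurable
  qed (use 2 in auto)
  have sq: "(\<integral>p. H x p \<partial>lborel) = (conv s h x)^2" for x
    unfolding H_def conv_def power2_eq_square
    by (rule integral_lborel_mult_prod) (intro conv_integrand_integrable s)+
  show "integrable lborel (\<lambda>x. (conv s h x)^2)"
    using lborel_pair.integrable_snd[OF int] by (simp add: sq)
  show "(\<integral>x. (conv s h x)^2 \<partial>lborel) =
       (\<integral>p. rdiff s (fst p) * rdiff s (snd p) * autocorr f (h * (fst p - snd p)) \<partial>lborel)"
    using lborel_pair.Fubini_integral[OF int] by (simp add: sq 3)
qed

end

section \<open>Integrals of the autocorrelation over scales\<close>

lemma
  assumes "0 < \<alpha>" "\<alpha> \<le> \<beta>"
  shows integrable_inverse_Icc: "integrable lborel (\<lambda>x. indicator {\<alpha>..\<beta>} x / x :: real)"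
    and integral_inverse_Icc: "(\<integral>x. indicator {\<alpha>..\<beta>} x / x \<partial>lborel) = ln \<beta> - ln (\<alpha>::real)"
proof -
  have "has_bochner_integral lborel (\<lambda>x. inverse x * indicator {\<alpha>..\<beta>} x) (ln \<beta> - ln \<alpha>)"
    by (rule has_bochner_integral_FTC_Icc_nonneg) (use assms in \<open>auto intro!: derivative_eq_intros simp: field_simps\<close>)
  then show "integrable lborel (\<lambda>x. indicator {\<alpha>..\<beta>} x / x)" "(\<integral>x. indicator {\<alpha>..\<beta>} x / x \<partial>lborel) = ln \<beta> - ln \<alpha>"
    by (simp_all add: has_bochner_integral_iff divide_inverse mult.commute)
qed

text \<open>The factor 2 comes from the two end pieces in \<open>dil_diff_bound\<close>.\<close>

definition energy_const :: "real \<Rightarrow> real" where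
  "energy_const s = 2 * (\<integral>p. \<bar>rdiff s (fst p) * rdiff s (snd p) * ln \<bar>fst p - snd p\<bar>\<bar> \<partial>lborel)"

context bounded_support
begin

text \<open>Mean of the autocorrelation over the dilations of \<open>z\<close> by scales in
  [\<epsilon>, R], in the dilation invariant measure dh / h.\<close>

definition dil :: "real \<Rightarrow> real \<Rightarrow> real \<Rightarrow> real" where
  "dil \<epsilon> R z = (\<integral>h. indicator {\<epsilon>..R} h / h * autocorr f (h * z) \<partial>lborel)"

lemma autocorr_div_integrable:
  assumes "0 < \<alpha>" "\<alpha> \<le> \<beta>"
  shows "integrable lborel (\<lambda>h. indicator {\<alpha>..\<beta>} h / h * autocorr f (h * z))"
proof (rule Bochner_Integration.integrable_bound)
  show "integrable lborel (\<lambda>h. indicator {\<alpha>..\<beta>} h / h * (M^2 * (d - c)))"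
    by (rule integrable_mult_left) (use integrable_inverse_Icc[OF assms] in auto)
  show "AE h in lborel. norm (indicator {\<alpha>..\<beta>} h / h * autocorr f (h * z)) \<le> norm (indicator {\<alpha>..\<beta>} h / h * (M^2 * (d - c)))"
    using autocorr_bound c_le_d by (intro AE_I2) (auto simp: abs_mult intro!: mult_left_mono divide_right_mono)
qed measurable

lemma integral_autocorr_div_le:
  assumes "0 < \<alpha>" "\<alpha> \<le> \<beta>"
  shows "\<bar>\<integral>h. indicator {\<alpha>..\<beta>} h / h * autocorr f h \<partial>lborel\<bar> \<le> (ln \<beta> - ln \<alpha>) * (M^2 * (d - c))"
proof -
  note i = autocorr_div_integrable[OF assms, of 1, unfolded mult_1_right]
  have "\<bar>\<integral>h. indicator {\<alpha>..\<beta>} h / h * autocorr f h \<partial>lborel\<bar> \<le> (\<integral>h. \<bar>indicator {\<alpha>..\<beta>} h / h * autocorr f h\<bar> \<partial>lborel)"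
    by (rule integral_abs_bound)
  also have "\<dots> \<le> (\<integral>h. indicator {\<alpha>..\<beta>} h / h * (M^2 * (d - c)) \<partial>lborel)"
  proof (rule integral_mono)
    show "integrable lborel (\<lambda>h. \<bar>indicator {\<alpha>..\<beta>} h / h * autocorr f h\<bar>)" using i by (rule integrable_abs)
    show "integrable lborel (\<lambda>h. indicator {\<alpha>..\<beta>} h / h * (M^2 * (d - c)))"
      by (rule integrable_mult_left) (use integrable_inverse_Icc[OF assms] in auto)
    fix h show "\<bar>indicator {\<alpha>..\<beta>} h / h * autocorr f h\<bar> \<le> indicator {\<alpha>..\<beta>} h / h * (M^2 * (d - c))"
      using autocorr_bound[of h] assms by (auto simp: indicator_def abs_mult divide_simps)
  qed
  also have "\<dots> = (ln \<beta> - ln \<alpha>) * (M^2 * (d - c))"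
    using integral_inverse_Icc[OF assms] by (simp only: integral_mult_left_zero)
  finally show ?thesis .
qed

lemma dil_scale:
  assumes "0 < z"
  shows "dil \<epsilon> R z = (\<integral>y. indicator {\<epsilon>*z..R*z} y / y * autocorr f y \<partial>lborel)"
proof -
  have "(\<integral>y. indicator {\<epsilon>*z..R*z} y / y * autocorr f y \<partial>lborel) =
     z * (\<integral>h. indicator {\<epsilon>*z..R*z} (0 + z * h) / (0 + z * h) * autocorr f (0 + z * h) \<partial>lborel)"
    using assms by (subst lborel_integral_real_affine[of z _ 0]) auto
  also have "\<dots> = (\<integral>h. z * (indicator {\<epsilon>*z..R*z} (z * h) / (z * h) * autocorr f (z * h)) \<partial>lborel)"
    by (simp only: integral_mult_right_zero add_0_left)
  also have "\<dots> = dil \<epsilon> R z"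
    unfolding dil_def using assms
    by (intro Bochner_Integration.integral_cong refl) (auto simp: indicator_def mult.commute)
  finally show ?thesis by simp
qed

lemma integral_Icc_split:
  assumes "0 < \<alpha>" "\<alpha> \<le> \<beta>" "\<beta> \<le> \<gamma>"
  shows "(\<integral>y. indicator {\<alpha>..\<gamma>} y / y * autocorr f y \<partial>lborel) =
    (\<integral>y. indicator {\<alpha>..\<beta>} y / y * autocorr f y \<partial>lborel) + (\<integral>y. indicator {\<beta>..\<gamma>} y / y * autocorr f y \<partial>lborel)"
proof -
  have "(\<integral>y. indicator {\<alpha>..\<gamma>} y / y * autocorr f y \<partial>lborel) = (\<integral>y. indicator {\<alpha>..\<beta>} y / y * autocorr f y + indicator {\<beta>..\<gamma>} y / y * autocorr f y \<partial>lborel)"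
  proof (rule integral_cong_AE)
    show "AE y in lborel. indicator {\<alpha>..\<gamma>} y / y * autocorr f y = indicator {\<alpha>..\<beta>} y / y * autocorr f y + indicator {\<beta>..\<gamma>} y / y * autocorr f y"
      using AE_lborel_singleton[of \<beta>] by eventually_elim (use assms in \<open>auto simp: indicator_def\<close>)
  qed measurable
  then show ?thesis
    using autocorr_div_integrable[of \<alpha> \<beta> 1] autocorr_div_integrable[of \<beta> \<gamma> 1] assms by simp
qed

text \<open>By invariance of dh / h, passing from 1 to \<open>z\<close> slides the interval
  [\<epsilon>, R] to [\<epsilon> * z, R * z]. The two differ by end pieces of logarithmic length |ln
  z| each. The bound involves neither \<epsilon> nor R, which is what later lets \<epsilon> tend to
  0.\<close>

lemma dil_diff_bound:
  assumes e: "0 < \<epsilon>" "\<epsilon> \<le> R" and z: "0 < z"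
  shows "\<bar>dil \<epsilon> R z - dil \<epsilon> R 1\<bar> \<le> 2 * \<bar>ln z\<bar> * (M^2 * (d - c))"
proof -
  define I where "I \<alpha> \<beta> = (\<integral>y. indicator {\<alpha>..\<beta>} y / y * autocorr f y \<partial>lborel)" for \<alpha> \<beta>
  have d: "dil \<epsilon> R z = I (\<epsilon>*z) (R*z)" "dil \<epsilon> R 1 = I \<epsilon> R"
    using dil_scale[of z] dil_scale[of 1] z by (simp_all add: I_def)
  have b: "\<bar>I \<alpha> \<beta>\<bar> \<le> (ln \<beta> - ln \<alpha>) * (M^2 * (d - c))" if "0 < \<alpha>" "\<alpha> \<le> \<beta>" for \<alpha> \<beta>
    unfolding I_def by (rule integral_autocorr_div_le[OF that])
  have sp: "I \<alpha> \<gamma> = I \<alpha> \<beta> + I \<beta> \<gamma>" if "0 < \<alpha>" "\<alpha> \<le> \<beta>" "\<beta> \<le> \<gamma>" for \<alpha> \<beta> \<gamma>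
    unfolding I_def by (rule integral_Icc_split[OF that])
  have R: "0 < R" using e by simp
  have l: "ln (\<epsilon>*z) = ln \<epsilon> + ln z" "ln (R*z) = ln R + ln z"
    using e z R by (simp_all add: ln_mult)
  show ?thesis
  proof (cases "1 \<le> z")
    case True
    have m: "\<epsilon> \<le> \<epsilon> * z" "R \<le> R * z" using True e R by auto
    have m2: "\<epsilon>*z \<le> R*z" using e z by auto
    have "I \<epsilon> (R*z) = I \<epsilon> R + I R (R*z)" "I \<epsilon> (R*z) = I \<epsilon> (\<epsilon>*z) + I (\<epsilon>*z) (R*z)"
      by (intro sp; use e m m2 R z in auto)+
    then have "dil \<epsilon> R z - dil \<epsilon> R 1 = I R (R*z) - I \<epsilon> (\<epsilon>*z)" using d by simp
    moreover have "\<bar>I R (R*z)\<bar> \<le> ln z * (M^2 * (d - c))" "\<bar>I \<epsilon> (\<epsilon>*z)\<bar> \<le> ln z * (M^2 * (d - c))"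
      using b[of R "R*z"] b[of \<epsilon> "\<epsilon>*z"] m e R l by auto
    ultimately show ?thesis using True by simp
  next
    case False
    have m: "\<epsilon> * z \<le> \<epsilon>" "R * z \<le> R" using False e R by auto
    have m2: "\<epsilon>*z \<le> R*z" "0 < \<epsilon>*z" using e z by auto
    have "I (\<epsilon>*z) R = I (\<epsilon>*z) (R*z) + I (R*z) R" "I (\<epsilon>*z) R = I (\<epsilon>*z) \<epsilon> + I \<epsilon> R"
      by (intro sp; use e m m2 R z in auto)+
    then have "dil \<epsilon> R z - dil \<epsilon> R 1 = I (\<epsilon>*z) \<epsilon> - I (R*z) R" using d by simp
    moreover have "\<bar>I (\<epsilon>*z) \<epsilon>\<bar> \<le> - ln z * (M^2 * (d - c))" "\<bar>I (R*z) R\<bar> \<le> - ln z * (M^2 * (d - c))"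
      using b[of "R*z" R] b[of "\<epsilon>*z" \<epsilon>] m e R z l by auto
    moreover have "\<bar>ln z\<bar> = - ln z" using False z by simp
    ultimately show ?thesis by (simp only:)
  qed
qed

lemma dil_abs: "dil \<epsilon> R \<bar>z\<bar> = dil \<epsilon> R z"
proof -
  have "autocorr f (h * \<bar>z\<bar>) = autocorr f (h * z)" for h
    using autocorr_even[of f "h * z"] by (auto simp: abs_if)
  then show ?thesis by (simp add: dil_def)
qed

text \<open>Up to the factor \<open>h\<^sup>2\<^sup>s\<close>, the function \<open>conv s h\<close> is the increment at scale \<open>h\<close> of the
  fractional integral of \<open>f\<close>. Integrating over all scales, the diagonal contribution \<open>dil 1\<close>,
  which would diverge as \<open>\<epsilon>\<close> tends to 0, is annihilated by the vanishing mean of the kernel.\<close>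

lemma energy_bound_truncated:
  assumes s: "0 < s" "s < 1" and e: "0 < \<epsilon>" "\<epsilon> \<le> R"
  shows "(\<integral>\<^sup>+h. \<integral>\<^sup>+x. ennreal (indicator {\<epsilon>..R} h / h * (conv s h x)^2) \<partial>lborel \<partial>lborel)
    \<le> ennreal (energy_const s * (M^2 * (d - c)))"
proof -
  define B where "B = M^2 * (d - c)"
  have B: "0 \<le> B" using c_le_d by (simp add: B_def)
  define k where "k p = rdiff s (fst p) * rdiff s (snd p)" for p
  have [measurable]: "k \<in> borel_measurable borel" unfolding k_def borel_prod[symmetric] by measurable
  note r = rdiff_integrable[OF s]
  have int_k: "integrable lborel k" unfolding k_def[abs_def] by (intro integrable_lborel_mult_prod r)
  have k0: "(\<integral>p. k p \<partial>lborel) = 0"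
    unfolding k_def by (simp add: integral_lborel_mult_prod[OF r r] integral_rdiff[OF s])
  define G where "G h = (\<integral>p. k p * autocorr f (h * (fst p - snd p)) \<partial>lborel)" for h
  have G_eq: "G h = (\<integral>x. (conv s h x)^2 \<partial>lborel)" if "0 < h" for h
    using integral_conv_square[OF s that] by (simp add: G_def k_def)
  define F where "F h p = indicator {\<epsilon>..R} h / h * (k p * autocorr f (h * (fst p - snd p)))" for h :: real and p
  have [measurable]: "(\<lambda>(h, p). F h p) \<in> borel_measurable (lborel \<Otimes>\<^sub>M lborel)"
    unfolding F_def k_def lborel_prod[symmetric] by measurable
  have Fb: "\<bar>F h p\<bar> \<le> indicator {\<epsilon>..R} h / h * (\<bar>k p\<bar> * B)" for h p
  proof -
    have "\<bar>k p * autocorr f (h * (fst p - snd p))\<bar> \<le> \<bar>k p\<bar> * B"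
      unfolding abs_mult B_def by (intro mult_left_mono autocorr_bound) auto
    moreover have "0 \<le> indicator {\<epsilon>..R} h / h" using e by (auto simp: indicator_def)
    ultimately show ?thesis unfolding F_def abs_mult[of "_ / _"] by (simp only: abs_of_nonneg mult_left_mono)
  qed
  have intFp: "integrable lborel (F h)" for h
  proof (rule Bochner_Integration.integrable_bound)
    show "integrable lborel (\<lambda>p. indicator {\<epsilon>..R} h / h * (\<bar>k p\<bar> * B))" using int_k by auto
    show "AE p in lborel. norm (F h p) \<le> norm (indicator {\<epsilon>..R} h / h * (\<bar>k p\<bar> * B))"
      unfolding real_norm_def by (intro AE_I2 order_trans[OF Fb abs_ge_self])
    show "F h \<in> borel_measurable lborel" unfolding F_def k_def lborel_prod[symmetric] by measurable
  qed
  have int: "integrable (lborel \<Otimes>\<^sub>M lborel) (\<lambda>(h, p). F h p)"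
  proof (rule lborel_pair.Fubini_integrable)
    let ?K = "\<integral>p. \<bar>k p\<bar> * B \<partial>lborel"
    show "integrable lborel (\<lambda>h. \<integral>p. norm (case (h, p) of (h, p) \<Rightarrow> F h p) \<partial>lborel)"
    proof (rule Bochner_Integration.integrable_bound[where f="\<lambda>h. indicator {\<epsilon>..R} h / h * ?K"])
      show "integrable lborel (\<lambda>h. indicator {\<epsilon>..R} h / h * ?K)"
        by (rule integrable_mult_left) (use integrable_inverse_Icc[OF e] in auto)
      show "AE h in lborel. norm (\<integral>p. norm (case (h, p) of (h, p) \<Rightarrow> F h p) \<partial>lborel) \<le> norm (indicator {\<epsilon>..R} h / h * ?K)"
      proof (rule AE_I2)
        fix h :: real
        have "(\<integral>p. \<bar>F h p\<bar> \<partial>lborel) \<le> (\<integral>p. indicator {\<epsilon>..R} h / h * (\<bar>k p\<bar> * B) \<partial>lborel)"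
          using intFp int_k Fb by (intro integral_mono) auto
        also have "\<dots> = indicator {\<epsilon>..R} h / h * ?K" by simp
        also have "\<dots> \<le> norm (indicator {\<epsilon>..R} h / h * ?K)" unfolding real_norm_def by (rule abs_ge_self)
        finally have "(\<integral>p. \<bar>F h p\<bar> \<partial>lborel) \<le> norm (indicator {\<epsilon>..R} h / h * ?K)" .
        moreover have "0 \<le> (\<integral>p. \<bar>F h p\<bar> \<partial>lborel)" by simp
        ultimately show "norm (\<integral>p. norm (case (h, p) of (h, p) \<Rightarrow> F h p) \<partial>lborel) \<le> norm (indicator {\<epsilon>..R} h / h * ?K)"
          by (simp only: real_norm_def prod.case abs_of_nonneg)
      qed
    qed measurable
  qed (use intFp in auto)
  have FG: "(\<integral>p. F h p \<partial>lborel) = indicator {\<epsilon>..R} h / h * G h" for h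
    unfolding F_def G_def by simp
  have FN: "(\<integral>h. F h p \<partial>lborel) = k p * dil \<epsilon> R (fst p - snd p)" for p
    unfolding F_def dil_def by (subst integral_mult_right_zero[symmetric]) (simp add: mult_ac)
  have intG: "integrable lborel (\<lambda>h. indicator {\<epsilon>..R} h / h * G h)"
    using lborel_pair.integrable_fst[OF int] by (simp add: FG)
  have Gpos: "0 \<le> indicator {\<epsilon>..R} h / h * G h" for h
    using G_eq[of h] e by (auto simp: indicator_def)
  have intN: "integrable lborel (\<lambda>p. k p * dil \<epsilon> R (fst p - snd p))"
    using lborel_pair.integrable_snd[OF int] by (simp add: FN)
  have "(\<integral>\<^sup>+h. \<integral>\<^sup>+x. ennreal (indicator {\<epsilon>..R} h / h * (conv s h x)^2) \<partial>lborel \<partial>lborel) =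
     (\<integral>\<^sup>+h. ennreal (indicator {\<epsilon>..R} h / h * G h) \<partial>lborel)"
  proof (intro nn_integral_cong)
    fix h :: real
    show "(\<integral>\<^sup>+x. ennreal (indicator {\<epsilon>..R} h / h * (conv s h x)^2) \<partial>lborel) = ennreal (indicator {\<epsilon>..R} h / h * G h)"
    proof (cases "h \<in> {\<epsilon>..R}")
      case True
      then have h: "0 < h" using e by auto
      then show ?thesis
        by (subst nn_integral_eq_integral) (use conv_square_integrable[OF s h] G_eq[OF h] True in auto)
    qed simp
  qed
  also have "\<dots> = ennreal (\<integral>h. indicator {\<epsilon>..R} h / h * G h \<partial>lborel)"
    by (rule nn_integral_eq_integral) (use intG Gpos in auto)
  also have "(\<integral>h. indicator {\<epsilon>..R} h / h * G h \<partial>lborel) = (\<integral>p. k p * dil \<epsilon> R (fst p - snd p) \<partial>lborel)"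
    using lborel_pair.Fubini_integral[OF int] by (simp add: FG FN)
  also have "\<dots> = (\<integral>p. k p * dil \<epsilon> R (fst p - snd p) \<partial>lborel) - (\<integral>p. k p * dil \<epsilon> R 1 \<partial>lborel)"
    using k0 by simp
  also have "\<dots> = (\<integral>p. k p * (dil \<epsilon> R (fst p - snd p) - dil \<epsilon> R 1) \<partial>lborel)"
    unfolding right_diff_distrib using intN int_k by (subst Bochner_Integration.integral_diff) auto
  also have "\<dots> \<le> (\<integral>p. 2 * B * \<bar>k p * ln \<bar>fst p - snd p\<bar>\<bar> \<partial>lborel)"
  proof (rule integral_mono_AE)
    show "integrable lborel (\<lambda>p. k p * (dil \<epsilon> R (fst p - snd p) - dil \<epsilon> R 1))"
      unfolding right_diff_distrib using intN int_k by auto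
    show "integrable lborel (\<lambda>p. 2 * B * \<bar>k p * ln \<bar>fst p - snd p\<bar>\<bar>)"
      unfolding k_def by (intro integrable_mult_right integrable_abs rdiff_log_integrable s)
    \<comment> \<open>The diagonal is a null set; off it \<open>dil_diff_bound\<close> applies to
      |fst p - snd p|.\<close>
    have "AE p in lborel \<Otimes>\<^sub>M lborel. fst p \<noteq> (snd p :: real)"
    proof (rule lborel_pair.AE_pair_measure)
      show "AE x in lborel. AE y in lborel. fst (x, y) \<noteq> (snd (x, y) :: real)"
      proof (rule AE_I2)
        fix x :: real
        show "AE y in lborel. fst (x, y) \<noteq> snd (x, y)"
          using AE_lborel_singleton[of x] by eventually_elim auto
      qed
    qed measurable
    then show "AE p in lborel. k p * (dil \<epsilon> R (fst p - snd p) - dil \<epsilon> R 1) \<le> 2 * B * \<bar>k p * ln \<bar>fst p - snd p\<bar>\<bar>"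
      unfolding lborel_prod
    proof eventually_elim
      fix p :: "real \<times> real" assume "fst p \<noteq> snd p"
      then have "\<bar>dil \<epsilon> R (fst p - snd p) - dil \<epsilon> R 1\<bar> \<le> 2 * \<bar>ln \<bar>fst p - snd p\<bar>\<bar> * B"
        using dil_diff_bound[OF e, of "\<bar>fst p - snd p\<bar>"] by (simp add: dil_abs B_def)
      then have "\<bar>k p\<bar> * \<bar>dil \<epsilon> R (fst p - snd p) - dil \<epsilon> R 1\<bar> \<le> \<bar>k p\<bar> * (2 * \<bar>ln \<bar>fst p - snd p\<bar>\<bar> * B)"
        by (rule mult_left_mono) auto
      then show "k p * (dil \<epsilon> R (fst p - snd p) - dil \<epsilon> R 1) \<le> 2 * B * \<bar>k p * ln \<bar>fst p - snd p\<bar>\<bar>"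
        by - (rule order_trans[OF abs_ge_self], simp add: abs_mult mult_ac)
    qed
  qed
  also have "\<dots> = energy_const s * (M^2 * (d - c))"
    by (simp add: energy_const_def k_def B_def)
  finally show ?thesis by (simp add: ennreal_leI)
qed

end

section \<open>Left fractional integrals: increments, energy, localisation\<close>

definition LI :: "real \<Rightarrow> (real \<Rightarrow> real) \<Rightarrow> real \<Rightarrow> real" where
  "LI s f x = (\<integral>t. f t * rker s (x - t) \<partial>lborel)"

lemma LI_measurable [measurable]:
  assumes [measurable]: "f \<in> borel_measurable borel"
  shows "LI s f \<in> borel_measurable borel"
  unfolding LI_def[abs_def] by measurable

context bounded_support
begin

lemma LI_integrable:
  assumes "0 < s"
  shows "integrable lborel (\<lambda>t. f t * rker s (x - t))"
proof (rule Bochner_Integration.integrable_bound)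
  have "integrable lborel (\<lambda>t. indicator {..x - c} t * rker s (t + 0))"
    by (rule integrable_rker_bounded[OF assms])
  from lborel_integrable_real_affine[OF this, of "-1" x]
  show "integrable lborel (\<lambda>t. M * (indicator {..x - c} (x + (-1) * t) * rker s (x - t)))"
    by (intro integrable_mult_right) simp
  show "AE t in lborel. norm (f t * rker s (x - t)) \<le> norm (M * (indicator {..x - c} (x + (-1) * t) * rker s (x - t)))"
  proof (rule AE_I2)
    fix t
    have "\<bar>f t\<bar> * rker s (x - t) \<le> M * indicator {..x - c} (x + (-1) * t) * rker s (x - t)"
      using f_bound[of t] f_supp[of t] M_nonneg by (intro mult_right_mono) (auto simp: indicator_def)
    then show "norm (f t * rker s (x - t)) \<le> norm (M * (indicator {..x - c} (x + (-1) * t) * rker s (x - t)))"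
      using M_nonneg by (simp add: abs_mult mult_ac)
  qed
qed measurable

lemma LI_increment:
  assumes s: "0 < s" and h: "0 < h"
  shows "LI s f (x + h) - LI s f x = h powr s * conv s h x"
proof -
  have "LI s f (x + h) - LI s f x = (\<integral>t. f t * (rker s (x + h - t) - rker s (x - t)) \<partial>lborel)"
    unfolding LI_def right_diff_distrib by (subst Bochner_Integration.integral_diff) (simp_all add: LI_integrable[OF s])
  also have "\<dots> = \<bar>-h\<bar> * (\<integral>t. f (x + (-h) * t) * (rker s (x + h - (x + (-h) * t)) - rker s (x - (x + (-h) * t))) \<partial>lborel)"
    using h lborel_integral_real_affine[of "-h" "\<lambda>t. f t * (rker s (x + h - t) - rker s (x - t))" x] by simp
  also have "\<dots> = (\<integral>t. f (x - h * t) * (h * rker s (h * (t + 1)) - h * rker s (h * t)) \<partial>lborel)"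
    using h by (subst integral_mult_right_zero[symmetric], intro Bochner_Integration.integral_cong refl) (simp add: algebra_simps)
  also have "\<dots> = h powr s * conv s h x"
    unfolding rker_scale[OF h] conv_def
    by (subst integral_mult_right_zero[symmetric], intro Bochner_Integration.integral_cong refl) (simp add: algebra_simps rdiff_def)
  finally show ?thesis .
qed

lemma conv_bound:
  assumes "0 < s" "s < 1"
  shows "\<bar>conv s h x\<bar> \<le> M * (\<integral>t. \<bar>rdiff s t\<bar> \<partial>lborel)"
proof -
  have "\<bar>conv s h x\<bar> \<le> (\<integral>t. \<bar>f (x - h * t) * rdiff s t\<bar> \<partial>lborel)"
    unfolding conv_def by (rule integral_abs_bound)
  also have "\<dots> \<le> (\<integral>t. M * \<bar>rdiff s t\<bar> \<partial>lborel)"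
    using f_bound
    by (intro integral_mono integrable_abs conv_integrand_integrable integrable_mult_right rdiff_integrable assms)
      (auto simp: abs_mult intro!: mult_right_mono)
  finally show ?thesis by simp
qed

text \<open>A bounded function gains the full order s, by the scaling law
  \<open>LI_increment\<close> and the integrability of \<open>rdiff s\<close>.\<close>

lemma LI_Holder:
  assumes "0 < s" "s < 1" "0 \<le> h"
  shows "\<bar>LI s f (x + h) - LI s f x\<bar> \<le> M * (\<integral>t. \<bar>rdiff s t\<bar> \<partial>lborel) * h powr s"
proof (cases "h = 0")
  case False
  then show ?thesis
    using LI_increment[of s h x] conv_bound[of s h x] assms
    by (auto simp: abs_mult mult.commute intro!: mult_left_mono)
qed simp

text \<open>The weight exponent -1 - 2 * s is the one for which the factor
  \<open>(h powr s)^2\<close> of a squared increment leaves exactly 1 / h. The integral is then the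
  monotone limit of the truncated ones with \<epsilon> = 1 / (n + 1), whose bound does not depend on
  n.\<close>

lemma energy_bound:
  assumes s: "0 < s" "s < 1"
  shows "(\<integral>\<^sup>+h. \<integral>\<^sup>+x. ennreal (indicator {0<..R} h * ((LI s f (x + h) - LI s f x)^2 * h powr (-1 - 2 * s))) \<partial>lborel \<partial>lborel)
    \<le> ennreal (energy_const s * (M^2 * (d - c)))" (is "_ \<le> ?C")
proof -
  define g where "g h = (\<integral>\<^sup>+x. ennreal ((conv s h x)^2 / h) \<partial>lborel)" for h
  have [measurable]: "g \<in> borel_measurable borel" unfolding g_def by measurable
  define F where "F n h = indicator {1 / Suc n..R} h * g h" for n h
  have F_le: "(\<integral>\<^sup>+h. F n h \<partial>lborel) \<le> ?C" for n
  proof (cases "1 / Suc n \<le> R")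
    case True
    have "F n h = (\<integral>\<^sup>+x. ennreal (indicator {1 / Suc n..R} h / h * (conv s h x)^2) \<partial>lborel)" for h
      by (simp add: F_def g_def indicator_def)
    then show ?thesis using energy_bound_truncated[OF s _ True] by simp
  next
    case False
    then have "F n h = 0" for h by (simp add: F_def)
    then show ?thesis by simp
  qed
  have "(\<integral>\<^sup>+h. \<integral>\<^sup>+x. ennreal (indicator {0<..R} h * ((LI s f (x + h) - LI s f x)^2 * h powr (-1 - 2 * s))) \<partial>lborel \<partial>lborel)
     = (\<integral>\<^sup>+h. indicator {0<..R} h * g h \<partial>lborel)"
  proof (intro nn_integral_cong)
    fix h :: real
    show "(\<integral>\<^sup>+x. ennreal (indicator {0<..R} h * ((LI s f (x + h) - LI s f x)^2 * h powr (-1 - 2 * s))) \<partial>lborel) = indicator {0<..R} h * g h"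
    proof (cases "h \<in> {0<..R}")
      case True
      have 1: "(h powr s)^2 * h powr (-1 - 2 * s) = 1 / h"
        using True by (simp add: power2_eq_square powr_add[symmetric] powr_minus divide_inverse)
      have "(LI s f (x + h) - LI s f x)^2 * h powr (-1 - 2 * s) = (conv s h x)^2 / h" for x
      proof -
        have "(h powr s * conv s h x)^2 * h powr (-1 - 2 * s) = ((h powr s)^2 * h powr (-1 - 2 * s)) * (conv s h x)^2"
          by (simp only: power_mult_distrib mult_ac)
        then show ?thesis using LI_increment[OF s(1), of h x] True 1 by simp
      qed
      then show ?thesis using True by (simp add: g_def)
    qed simp
  qed
  also have "\<dots> \<le> ?C"
  proof (rule LIMSEQ_le_const2)
    show "(\<lambda>n. \<integral>\<^sup>+h. F n h \<partial>lborel) \<longlonglongrightarrow> (\<integral>\<^sup>+h. indicator {0<..R} h * g h \<partial>lborel)"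
    proof (rule nn_integral_LIMSEQ)
      show "incseq F"
        unfolding incseq_def le_fun_def
      proof (intro allI impI)
        fix m n :: nat and h :: real assume "m \<le> n"
        then have "1 / real (Suc n) \<le> 1 / real (Suc m)" by (intro frac_le) auto
        then show "F m h \<le> F n h" by (auto simp: F_def indicator_def)
      qed
      fix h :: real
      have "\<exists>N. \<forall>n\<ge>N. F n h = indicator {0<..R} h * g h"
      proof (cases "0 < h")
        case True
        then obtain N where N: "inverse (of_nat (Suc N)) < h" using reals_Archimedean by blast
        have "1 / Suc n \<le> h" if "N \<le> n" for n
        proof -
          have "1 / real (Suc n) \<le> 1 / real (Suc N)" using that by (intro frac_le) auto
          then show ?thesis using N by (simp add: inverse_eq_divide)
        qed
        then show ?thesis using True by (intro exI[of _ N]) (auto simp: F_def indicator_def)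
      next
        case False
        have "\<not> 1 / real (Suc n) \<le> h" for n
        proof -
          have "0 < 1 / real (Suc n)" by simp
          then show ?thesis using False by linarith
        qed
        then show ?thesis using False by (auto simp: F_def)
      qed
      then show "(\<lambda>n. F n h) \<longlonglongrightarrow> indicator {0<..R} h * g h"
        by (intro tendsto_eventually) (simp only: eventually_sequentially)
    qed (unfold F_def, measurable)
    show "\<exists>N. \<forall>n\<ge>N. (\<integral>\<^sup>+h. F n h \<partial>lborel) \<le> ?C" using F_le by blast
  qed
  finally show ?thesis .
qed

end

lemma nn_integral_powr_from_0:
  assumes "a > (-1::real)" "c \<ge> 0"
  shows "(\<integral>\<^sup>+t. ennreal (indicator {0<..c} t * t powr a) \<partial>lborel) = ennreal (c powr (a+1) / (a+1))"
  using has_bochner_integral_powr_from_0[OF assms]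
  by (subst nn_integral_eq_integral) (auto simp: has_bochner_integral_iff)

lemma nn_integral_powr_to_inf:
  assumes "a < (-1::real)" "c > 0"
  shows "(\<integral>\<^sup>+t. ennreal (indicator {c..} t * t powr a) \<partial>lborel) = ennreal (- (c powr (a+1)) / (a+1))"
  using has_bochner_integral_powr_to_inf[OF assms]
  by (subst nn_integral_eq_integral) (auto simp: has_bochner_integral_iff)

text \<open>At distance at least R from the support of \<open>f\<close> the kernel is smooth, so the
  increment is linear in h. The power of R is the integral of t^(s - 2) over [R,
  \<infinity>).\<close>

lemma (in bounded_support) LI_far:
  assumes s: "0 < s" "s < 1" and R: "0 < R" and supp: "\<And>u. x - R < u \<Longrightarrow> f u = 0" and h: "0 \<le> h"
  shows "\<bar>LI s f (x + h) - LI s f x\<bar> \<le> M * h * R powr (s - 1) / (1 - s)"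
proof -
  let ?g = "\<lambda>t. M * h * (indicator {R..} (x + (-1) * t) * (x + (-1) * t) powr (s - 2))"
  have hb: "has_bochner_integral lborel (\<lambda>t. indicator {R..} t * t powr (s - 2)) (R powr (s - 1) / (1 - s))"
    using has_bochner_integral_powr_to_inf[of "s - 2" R] s R by (simp add: minus_divide_right)
  have ig: "integrable lborel ?g"
    using lborel_integrable_real_affine[of "\<lambda>t. indicator {R..} t * t powr (s - 2)" "-1" x] hb
    by (intro integrable_mult_right) (simp add: has_bochner_integral_iff)
  have Ig: "(\<integral>t. ?g t \<partial>lborel) = M * h * (R powr (s - 1) / (1 - s))"
    using lborel_integral_real_affine[of "-1" "\<lambda>t. indicator {R..} t * t powr (s - 2)" x] hb
    by (simp add: has_bochner_integral_iff)
  have "LI s f (x + h) - LI s f x = (\<integral>t. f t * (rker s (x + h - t) - rker s (x - t)) \<partial>lborel)"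
    unfolding LI_def right_diff_distrib by (subst Bochner_Integration.integral_diff) (simp_all add: LI_integrable[OF s(1)])
  also have "\<bar>\<dots>\<bar> \<le> (\<integral>t. \<bar>f t * (rker s (x + h - t) - rker s (x - t))\<bar> \<partial>lborel)"
    by (rule integral_abs_bound)
  also have "\<dots> \<le> (\<integral>t. ?g t \<partial>lborel)"
  proof (intro integral_mono ig integrable_abs)
    show "integrable lborel (\<lambda>t. f t * (rker s (x + h - t) - rker s (x - t)))"
      unfolding right_diff_distrib by (intro Bochner_Integration.integrable_diff LI_integrable s)
    fix t
    show "\<bar>f t * (rker s (x + h - t) - rker s (x - t))\<bar> \<le> ?g t"
    proof (cases "x - R < t")
      case True
      then show ?thesis using supp[of t] M_nonneg h by simp
    next
      case False
      then have t: "0 < x - t" "R \<le> x - t" using R by auto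
      have "\<bar>rker s (x + h - t) - rker s (x - t)\<bar> \<le> h * (x - t) powr (s - 2)"
        using rker_increment_bound[OF t(1) h s] by (simp add: algebra_simps)
      then have "\<bar>f t\<bar> * \<bar>rker s (x + h - t) - rker s (x - t)\<bar> \<le> M * (h * (x - t) powr (s - 2))"
        by (intro mult_mono f_bound) (use M_nonneg in auto)
      then show ?thesis using t by (simp add: abs_mult mult.assoc)
    qed
  qed
  finally show ?thesis using Ig by simp
qed

lemma nn_integral_indicator_cmult:
  fixes g :: "real \<Rightarrow> real"
  assumes [measurable]: "g \<in> borel_measurable borel" and "0 \<le> C" "\<And>t. 0 \<le> g t"
  shows "(\<integral>\<^sup>+t. ennreal (indicator J l * C * g t) \<partial>lborel) = ennreal C * (\<integral>\<^sup>+t. ennreal (g t) \<partial>lborel) * indicator J l"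
  using assms(2,3) by (cases "l \<in> J") (simp_all add: ennreal_mult nn_integral_cmult)

text \<open>Integrand of the squared Gagliardo seminorm of order \<open>s\<close>, kept as a
  function of base point and increment because it is later localised in the base point
  alone.\<close>

definition sqinc :: "(real \<Rightarrow> real) \<Rightarrow> real \<Rightarrow> real \<Rightarrow> real \<Rightarrow> real" where
  "sqinc v s l t = (v (l + t) - v l)^2 * t powr (-1 - 2 * s)"

lemma sqinc_nonneg: "0 \<le> sqinc v s l t"
  by (simp add: sqinc_def)

lemma sqinc_measurable [measurable]:
  assumes [measurable]: "v \<in> borel_measurable borel"
  shows "(\<lambda>(l, t). sqinc v s l t) \<in> borel_measurable (borel \<Otimes>\<^sub>M borel)"
  unfolding sqinc_def by measurable

text \<open>A Morrey-type estimate: the part of \<open>f\<close> supported far to the left of the window contributes only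
  through its smooth tail, and the remaining part has support of length comparable to \<open>R\<close>.\<close>

lemma (in bounded_support) local_energy_bound:
  assumes s: "0 < s" "s < 1" and T: "0 < T"
  obtains C where "0 \<le> C"
    "\<And>x R. \<lbrakk>0 < R; R \<le> T\<rbrakk> \<Longrightarrow>
      (\<integral>\<^sup>+l. \<integral>\<^sup>+t. ennreal (indicator {x..x + 5/2 * R} l * indicator {0<..T} t * sqinc (LI s f) s l t) \<partial>lborel \<partial>lborel)
        \<le> ennreal (C * R powr (1 - s))"
proof -
  define K where "K = M * (\<integral>t. \<bar>rdiff s t\<bar> \<partial>lborel)"
  define A1 where "A1 = 2 * energy_const s * M^2 * 5 * T powr s"
  define A2 where "A2 = 5 * M^2 / (1-s)^2 / (2 - 2 * s) * T powr s"
  define A3 where "A3 = 5/2 * K^2 * T powr s / s"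
  have ec: "0 \<le> energy_const s" unfolding energy_const_def by simp
  have A: "0 \<le> A1" "0 \<le> A2" "0 \<le> A3" using s ec by (auto simp: A1_def A2_def A3_def)
  define v where "v = LI s f"
  have [measurable]: "v \<in> borel_measurable borel" unfolding v_def by measurable
  show ?thesis
  proof (rule that[of "A1 + A2 + A3"])
    fix x R :: real assume R: "0 < R" "R \<le> T"
    \<comment> \<open>The length 5/2 * R is dictated by the grids of
      \<open>exists_good_grid\<close>: they start at most R/2 to the right of x and have length at
      most 2 * R.\<close>
    define J where "J = {x..x + 5/2 * R}"
    \<comment> \<open>The two near terms are of order R. They are weakened to the order R powr (1 -
      s) of the far term, which decides the rate.\<close>
    have Rp: "R \<le> T powr s * R powr (1 - s)"
    proof -
      have "R = R powr s * R powr (1 - s)" using R by (simp add: powr_add[symmetric])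
      also have "\<dots> \<le> T powr s * R powr (1 - s)" using R s by (intro mult_right_mono powr_mono2) auto
      finally show ?thesis .
    qed
    \<comment> \<open>For l in the window and t \<le> R, both l and l + t stay to the left of x + 4
      * R, where the left integral of \<open>f3\<close> vanishes; \<open>f2\<close> ends at distance
      R to the left of the window, so \<open>LI_far\<close> applies to it; \<open>f1\<close> has
      support of length 5 * R, and the energy bound is linear in that length.\<close>
    define f1 where "f1 u = indicator {x - R..x + 4 * R} u * f u" for u
    define f2 where "f2 u = indicator {..<x - R} u * f u" for u
    define f3 where "f3 u = indicator {x + 4 * R<..} u * f u" for u
    have meas: "f1 \<in> borel_measurable borel" "f2 \<in> borel_measurable borel" "f3 \<in> borel_measurable borel"
      unfolding f1_def[abs_def] f2_def[abs_def] f3_def[abs_def] by measurable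
    interpret f1: bounded_support f1 M "x - R" "x + 4 * R"
      using meas R f_bound M_nonneg by unfold_locales (auto simp: f1_def indicator_def)
    interpret f2: bounded_support f2 M c d
      using meas f_bound M_nonneg f_supp c_le_d by unfold_locales (auto simp: f2_def indicator_def)
    interpret f3: bounded_support f3 M c d
      using meas f_bound M_nonneg f_supp c_le_d by unfold_locales (auto simp: f3_def indicator_def)
    have f_eq: "f u = f1 u + f2 u + f3 u" for u using R by (auto simp: f1_def f2_def f3_def indicator_def)
    have v_eq: "v z = LI s f1 z + LI s f2 z + LI s f3 z" for z
      unfolding v_def LI_def f_eq distrib_right
      using f1.LI_integrable[OF s(1)] f2.LI_integrable[OF s(1)] f3.LI_integrable[OF s(1)] by simp
    have L3: "LI s f3 z = 0" if "z \<le> x + 4 * R" for z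
    proof -
      have "f3 t * rker s (z - t) = 0" for t
        using that rker_nonpos[of "z - t" s] by (auto simp: f3_def indicator_def)
      then show ?thesis unfolding LI_def by (simp only: Bochner_Integration.integral_zero)
    qed
    let ?near1 = "\<lambda>l t. 2 * (indicator {0<..R} t * sqinc (LI s f1) s l t)"
    let ?near2 = "\<lambda>l t. indicator J l * (2 * (M * R powr (s-1) / (1-s))^2) * (indicator {0<..R} t * t powr (1 - 2 * s))"
    let ?far = "\<lambda>l t. indicator J l * (K^2 * T powr s) * (indicator {R..} t * t powr (-1 - s))"
    have pw: "indicator J l * indicator {0<..T} t * sqinc v s l t \<le> ?near1 l t + ?near2 l t + ?far l t" for l t
    proof (cases "l \<in> J \<and> t \<in> {0<..T}")
      case True
      show ?thesis
      proof (cases "t \<le> R")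
        case tR: True
        have lt: "l + t \<le> x + 4 * R" "l \<le> x + 4 * R" using True tR R by (auto simp: J_def)
        define d1 where "d1 = LI s f1 (l + t) - LI s f1 l"
        define d2 where "d2 = LI s f2 (l + t) - LI s f2 l"
        have vd: "v (l + t) - v l = d1 + d2" using lt by (simp add: v_eq L3 d1_def d2_def)
        have "\<bar>d2\<bar> \<le> M * t * R powr (s - 1) / (1 - s)"
          unfolding d2_def using True by (intro f2.LI_far s R(1)) (auto simp: f2_def J_def)
        then have "d2^2 \<le> (M * t * R powr (s - 1) / (1 - s))^2"
          by (metis abs_ge_zero power2_abs power_mono)
        also have "\<dots> = (M * R powr (s-1) / (1-s))^2 * t^2" by (simp add: power_mult_distrib power_divide)
        finally have d2: "d2^2 \<le> (M * R powr (s-1) / (1-s))^2 * t^2" .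
        have "(d1 + d2)^2 \<le> 2 * d1^2 + 2 * d2^2"
          using sum_squares_bound[of d1 d2] by (simp add: power2_sum)
        also have "\<dots> \<le> 2 * d1^2 + 2 * ((M * R powr (s-1) / (1-s))^2 * t^2)" using d2 by simp
        finally have "(d1 + d2)^2 * t powr (-1 - 2 * s) \<le> (2 * d1^2 + 2 * ((M * R powr (s-1) / (1-s))^2 * t^2)) * t powr (-1 - 2 * s)"
          by (rule mult_right_mono) auto
        also have "\<dots> = 2 * (d1^2 * t powr (-1 - 2 * s)) + 2 * (M * R powr (s-1) / (1-s))^2 * (t^2 * t powr (-1 - 2 * s))"
          by (simp add: algebra_simps)
        also have "t^2 * t powr (-1 - 2 * s) = t powr (1 - 2 * s)"
          using True by (simp add: powr_add[symmetric] flip: powr_numeral)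
        finally have "sqinc v s l t \<le> ?near1 l t + ?near2 l t"
          using True tR by (simp add: sqinc_def vd d1_def)
        moreover have "0 \<le> ?far l t" by (simp add: indicator_def)
        moreover have "indicator J l * indicator {0<..T} t * sqinc v s l t = sqinc v s l t"
          using True by simp
        ultimately show ?thesis by linarith
      next
        case tR: False
        have "\<bar>v (l + t) - v l\<bar> \<le> K * t powr s"
          unfolding v_def K_def using True by (intro LI_Holder s) auto
        then have "(v (l + t) - v l)^2 \<le> (K * t powr s)^2"
          by (metis abs_ge_zero power2_abs power_mono)
        then have "sqinc v s l t \<le> (K * t powr s)^2 * t powr (-1 - 2 * s)"
          unfolding sqinc_def by (rule mult_right_mono) auto
        also have "\<dots> = K^2 * ((t powr s)^2 * t powr (-1 - 2 * s))" by (simp add: power_mult_distrib)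
        \<comment> \<open>The bare Hoelder bound leaves 1 / t, whose integral from R to T is
          logarithmic. Replacing one factor \<open>t powr s\<close> by \<open>T powr s\<close>
          trades the logarithm for the power R^(-s), which is good enough.\<close>
        also have "(t powr s)^2 * t powr (-1 - 2 * s) = t powr s * t powr (-1 - s)"
          using True by (simp add: power2_eq_square powr_add[symmetric])
        also have "K^2 * (t powr s * t powr (-1 - s)) \<le> K^2 * (T powr s * t powr (-1 - s))"
          using True s by (intro mult_left_mono mult_right_mono powr_mono2) auto
        finally show ?thesis using True tR by (simp add: sqinc_nonneg mult.assoc)
      qed
    next
      case False
      have "0 \<le> ?near1 l t" "0 \<le> ?near2 l t" "0 \<le> ?far l t" by (auto simp: indicator_def sqinc_nonneg)
      then show ?thesis using False by (auto simp: indicator_def)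
    qed
    have emJ: "emeasure lborel J = ennreal (5/2 * R)" using R by (simp add: J_def emeasure_lborel_Icc_eq)
    have [measurable]: "J \<in> sets borel" by (simp add: J_def)
    have split: "(\<integral>\<^sup>+l. \<integral>\<^sup>+t. ennreal (indicator J l * indicator {0<..T} t * sqinc v s l t) \<partial>lborel \<partial>lborel)
      \<le> (\<integral>\<^sup>+l. \<integral>\<^sup>+t. ennreal (?near1 l t) + ennreal (?near2 l t) + ennreal (?far l t) \<partial>lborel \<partial>lborel)"
    proof (intro nn_integral_mono)
      fix l t :: real
      have "0 \<le> ?near1 l t" "0 \<le> ?near2 l t" "0 \<le> ?far l t" by (auto simp: indicator_def sqinc_nonneg)
      then show "ennreal (indicator J l * indicator {0<..T} t * sqinc v s l t) \<le> ennreal (?near1 l t) + ennreal (?near2 l t) + ennreal (?far l t)"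
        using pw[of l t] by (simp add: ennreal_leI flip: ennreal_plus)
    qed
    also have "\<dots> = (\<integral>\<^sup>+l. \<integral>\<^sup>+t. ennreal (?near1 l t) \<partial>lborel \<partial>lborel) + (\<integral>\<^sup>+l. \<integral>\<^sup>+t. ennreal (?near2 l t) \<partial>lborel \<partial>lborel)
       + (\<integral>\<^sup>+l. \<integral>\<^sup>+t. ennreal (?far l t) \<partial>lborel \<partial>lborel)"
      by (simp add: nn_integral_add)
    also have "(\<integral>\<^sup>+l. \<integral>\<^sup>+t. ennreal (?near1 l t) \<partial>lborel \<partial>lborel) \<le> ennreal (A1 * R powr (1 - s))"
    proof -
      have "(\<integral>\<^sup>+l. \<integral>\<^sup>+t. ennreal (?near1 l t) \<partial>lborel \<partial>lborel) = 2 * (\<integral>\<^sup>+l. \<integral>\<^sup>+t. ennreal (indicator {0<..R} t * sqinc (LI s f1) s l t) \<partial>lborel \<partial>lborel)"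
        by (simp add: ennreal_mult' nn_integral_cmult)
      also have "(\<integral>\<^sup>+l. \<integral>\<^sup>+t. ennreal (indicator {0<..R} t * sqinc (LI s f1) s l t) \<partial>lborel \<partial>lborel)
        = (\<integral>\<^sup>+t. \<integral>\<^sup>+l. ennreal (indicator {0<..R} t * sqinc (LI s f1) s l t) \<partial>lborel \<partial>lborel)"
        by (rule lborel_pair.Fubini'[symmetric]) measurable
      also have "\<dots> \<le> ennreal (energy_const s * (M^2 * (x + 4 * R - (x - R))))"
        using f1.energy_bound[OF s, of R] by (simp add: sqinc_def)
      also have "2 * ennreal (energy_const s * (M^2 * (x + 4 * R - (x - R)))) = ennreal (2 * energy_const s * M^2 * 5 * R)"
        using ec R by (simp add: ennreal_mult'[symmetric] algebra_simps flip: ennreal_numeral)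
      also have "\<dots> \<le> ennreal (A1 * R powr (1 - s))"
        unfolding A1_def using mult_left_mono[OF Rp, of "2 * energy_const s * M^2 * 5"] ec by (intro ennreal_leI) (simp add: mult_ac)
      finally show ?thesis by (simp add: mult_left_mono)
    qed
    also have "(\<integral>\<^sup>+l. \<integral>\<^sup>+t. ennreal (?near2 l t) \<partial>lborel \<partial>lborel) \<le> ennreal (A2 * R powr (1 - s))"
    proof -
      have "(\<integral>\<^sup>+l. \<integral>\<^sup>+t. ennreal (?near2 l t) \<partial>lborel \<partial>lborel) =
         (\<integral>\<^sup>+l. ennreal (2 * (M * R powr (s-1) / (1-s))^2) * ennreal (R powr (2 - 2 * s) / (2 - 2 * s)) * indicator J l \<partial>lborel)"
      proof (intro nn_integral_cong)
        fix l
        show "(\<integral>\<^sup>+t. ennreal (?near2 l t) \<partial>lborel) = ennreal (2 * (M * R powr (s-1) / (1-s))^2) * ennreal (R powr (2 - 2 * s) / (2 - 2 * s)) * indicator J l"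
          using nn_integral_powr_from_0[of "1 - 2 * s" R] s R
          by (subst nn_integral_indicator_cmult) auto
      qed
      also have "\<dots> = ennreal (2 * (M * R powr (s-1) / (1-s))^2 * (R powr (2 - 2 * s) / (2 - 2 * s)) * (5/2 * R))"
        using s R by (simp add: nn_integral_cmult_indicator emJ ennreal_mult'[symmetric])
      also have "2 * (M * R powr (s-1) / (1-s))^2 * (R powr (2 - 2 * s) / (2 - 2 * s)) * (5/2 * R)
         = 5 * M^2 / (1-s)^2 / (2 - 2 * s) * R * ((R powr (s-1))^2 * R powr (2 - 2 * s))"
        by (simp add: power_mult_distrib power_divide)
      also have "(R powr (s-1))^2 * R powr (2 - 2 * s) = 1"
        using R by (simp add: power2_eq_square powr_add[symmetric])
      also have "ennreal (5 * M^2 / (1-s)^2 / (2 - 2 * s) * R * 1) \<le> ennreal (A2 * R powr (1 - s))"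
        unfolding A2_def using mult_left_mono[OF Rp, of "5 * M^2 / (1-s)^2 / (2 - 2 * s)"] s by (intro ennreal_leI) (simp add: mult_ac)
      finally show ?thesis .
    qed
    also have "(\<integral>\<^sup>+l. \<integral>\<^sup>+t. ennreal (?far l t) \<partial>lborel \<partial>lborel) \<le> ennreal (A3 * R powr (1 - s))"
    proof -
      have "(\<integral>\<^sup>+l. \<integral>\<^sup>+t. ennreal (?far l t) \<partial>lborel \<partial>lborel) =
         (\<integral>\<^sup>+l. ennreal (K^2 * T powr s) * ennreal (R powr (-s) / s) * indicator J l \<partial>lborel)"
      proof (intro nn_integral_cong)
        fix l
        show "(\<integral>\<^sup>+t. ennreal (?far l t) \<partial>lborel) = ennreal (K^2 * T powr s) * ennreal (R powr (-s) / s) * indicator J l"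
          using nn_integral_powr_to_inf[of "-1 - s" R] s R
          by (subst nn_integral_indicator_cmult) auto
      qed
      also have "\<dots> = ennreal (K^2 * T powr s * (R powr (-s) / s) * (5/2 * R))"
        using s R by (simp add: nn_integral_cmult_indicator emJ ennreal_mult'[symmetric])
      also have "K^2 * T powr s * (R powr (-s) / s) * (5/2 * R) = A3 * (R powr 1 * R powr (-s))"
        using R by (simp add: A3_def field_simps)
      also have "R powr 1 * R powr (-s) = R powr (1 - s)"
        by (simp only: powr_add[symmetric]) simp
      finally show ?thesis by simp
    qed
    finally show "(\<integral>\<^sup>+l. \<integral>\<^sup>+t. ennreal (indicator {x..x + 5/2 * R} l * indicator {0<..T} t * sqinc (LI s f) s l t) \<partial>lborel \<partial>lborel)
        \<le> ennreal ((A1 + A2 + A3) * R powr (1 - s))"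
      using A by (simp add: v_def J_def distrib_right ennreal_plus add_mono)
  qed (use A in auto)
qed

section \<open>Right fractional integrals and their second differences\<close>

definition RI :: "real \<Rightarrow> (real \<Rightarrow> real) \<Rightarrow> real \<Rightarrow> real" where
  "RI s f x = (\<integral>t. f t * rker s (t - x) \<partial>lborel)"

lemma RI_measurable [measurable]:
  assumes [measurable]: "f \<in> borel_measurable borel"
  shows "RI s f \<in> borel_measurable borel"
  unfolding RI_def[abs_def] by measurable

definition d2 :: "(real \<Rightarrow> real) \<Rightarrow> real \<Rightarrow> real \<Rightarrow> real" where
  "d2 q d l = q l - 2 * q (l + d) + q (l + 2 * d)"

lemma d2_measurable [measurable]:
  assumes [measurable]: "q \<in> borel_measurable borel"
  shows "(\<lambda>(d, l). d2 q d l) \<in> borel_measurable (borel \<Otimes>\<^sub>M borel)"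
  unfolding d2_def by measurable

text \<open>The first factor stems from Cauchy-Schwarz against the density |rdiff2 s|, the second
  from rescaling the increments d * t in \<open>d2_energy_le\<close>.\<close>

definition rdiff2_const :: "real \<Rightarrow> real" where
  "rdiff2_const s = (\<integral>t. \<bar>rdiff2 s t\<bar> \<partial>lborel) * (\<integral>t. \<bar>t\<bar> powr (2 - 2 * s) * \<bar>rdiff2 s t\<bar> \<partial>lborel)"

lemma rdiff2_const_nonneg: "0 \<le> rdiff2_const s"
  by (simp add: rdiff2_const_def)

locale bounded_left_support =
  fixes p :: "real \<Rightarrow> real" and P b :: real
  assumes p_meas [measurable]: "p \<in> borel_measurable borel"
    and p_bound: "\<And>x. \<bar>p x\<bar> \<le> P"
    and p_zero: "\<And>x. b \<le> x \<Longrightarrow> p x = 0"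
begin

lemma P_nonneg: "0 \<le> P"
  using p_bound[of 0] by linarith

lemma RI_integrable:
  assumes "0 < s"
  shows "integrable lborel (\<lambda>t. p t * rker s (t - x))"
proof (rule Bochner_Integration.integrable_bound)
  have "integrable lborel (\<lambda>t. indicator {..b} t * rker s (t + (- x)))"
    by (rule integrable_rker_bounded[OF assms])
  then show "integrable lborel (\<lambda>t. P * (indicator {..b} t * rker s (t - x)))"
    by (intro integrable_mult_right) simp
  show "AE t in lborel. norm (p t * rker s (t - x)) \<le> norm (P * (indicator {..b} t * rker s (t - x)))"
  proof (rule AE_I2)
    fix t
    have "\<bar>p t\<bar> * rker s (t - x) \<le> P * indicator {..b} t * rker s (t - x)"
      using p_bound[of t] p_zero[of t] P_nonneg by (intro mult_right_mono) (auto simp: indicator_def)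
    then show "norm (p t * rker s (t - x)) \<le> norm (P * (indicator {..b} t * rker s (t - x)))"
      using P_nonneg by (simp add: abs_mult mult_ac)
  qed
qed measurable

lemma RI_zero: "b \<le> x \<Longrightarrow> RI s p x = 0"
proof -
  assume "b \<le> x"
  then have "p t * rker s (t - x) = 0" for t
    using p_zero[of t] rker_nonpos[of "t - x" s] by (cases "b \<le> t") auto
  then show ?thesis unfolding RI_def by (simp only: Bochner_Integration.integral_zero)
qed

lemma shifted_integrable:
  assumes "integrable lborel k"
  shows "integrable lborel (\<lambda>t. p (c + d * t) * k t)"
proof (rule Bochner_Integration.integrable_bound)
  show "integrable lborel (\<lambda>t. P * k t)" using assms by auto
  have [measurable]: "k \<in> borel_measurable borel" using assms by auto
  show "(\<lambda>t. p (c + d * t) * k t) \<in> borel_measurable lborel" by measurable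
  show "AE t in lborel. norm (p (c + d * t) * k t) \<le> norm (P * k t)"
    using p_bound P_nonneg by (intro AE_I2) (auto simp: abs_mult intro!: mult_right_mono)
qed

text \<open>The vanishing mean of \<open>rdiff s\<close> permits subtracting the constant
  \<open>p x\<close>, so that regularity of \<open>p\<close> at the point x becomes decay in
  h.\<close>

lemma RI_increment:
  assumes s: "0 < s" "s < 1" and h: "0 < h"
  shows "RI s p (x + h) - RI s p x = - (h powr s * (\<integral>t. (p (x + h * (1 + t)) - p x) * rdiff s t \<partial>lborel))"
proof -
  have "RI s p (x + h) - RI s p x = (\<integral>t. p t * (rker s (t - (x + h)) - rker s (t - x)) \<partial>lborel)"
    unfolding RI_def right_diff_distrib by (subst Bochner_Integration.integral_diff) (simp_all add: RI_integrable[OF s(1)])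
  also have "\<dots> = h * (\<integral>t. p (x + h + h * t) * (rker s (x + h + h * t - (x + h)) - rker s (x + h + h * t - x)) \<partial>lborel)"
    using h lborel_integral_real_affine[of h "\<lambda>t. p t * (rker s (t - (x + h)) - rker s (t - x))" "x + h"] by simp
  also have "\<dots> = (\<integral>t. p (x + h + h * t) * (h * rker s (h * t) - h * rker s (h * (t + 1))) \<partial>lborel)"
    using h by (subst integral_mult_right_zero[symmetric], intro Bochner_Integration.integral_cong refl) (simp add: algebra_simps)
  also have "\<dots> = - (h powr s * (\<integral>t. p (x + h + h * t) * rdiff s t \<partial>lborel))"
    unfolding rker_scale[OF h]
    by (subst integral_mult_right_zero[symmetric], subst integral_minus[symmetric], intro Bochner_Integration.integral_cong refl) (simp add: algebra_simps rdiff_def)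
  also have "(\<integral>t. p (x + h + h * t) * rdiff s t \<partial>lborel) = (\<integral>t. p (x + h + h * t) * rdiff s t \<partial>lborel) - (\<integral>t. p x * rdiff s t \<partial>lborel)"
    by (simp add: integral_rdiff[OF s])
  also have "\<dots> = (\<integral>t. p (x + h + h * t) * rdiff s t - p x * rdiff s t \<partial>lborel)"
    by (intro Bochner_Integration.integral_diff[symmetric] shifted_integrable integrable_mult_right rdiff_integrable s)
  also have "\<dots> = (\<integral>t. (p (x + h * (1 + t)) - p x) * rdiff s t \<partial>lborel)"
    by (simp add: algebra_simps)
  finally show ?thesis .
qed

lemma RI_d2:
  assumes s: "0 < s" "s < 1" and d: "0 < d"
  shows "d2 (RI s p) d l = d powr s * (\<integral>t. (p (l + d * t) - p l) * rdiff2 s t \<partial>lborel)"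
proof -
  note i = RI_integrable[OF s(1)]
  have "d2 (RI s p) d l = (\<integral>t. p t * rker s (t - l) - 2 * (p t * rker s (t - (l + d))) + p t * rker s (t - (l + 2 * d)) \<partial>lborel)"
    unfolding RI_def d2_def by (simp add: i)
  also have "\<dots> = (\<integral>t. p t * (rker s (t - l) - 2 * rker s (t - (l + d)) + rker s (t - (l + 2 * d))) \<partial>lborel)"
    by (simp add: algebra_simps)
  also have "\<dots> = d * (\<integral>t. p (l + d * t) * (rker s (l + d * t - l) - 2 * rker s (l + d * t - (l + d)) + rker s (l + d * t - (l + 2 * d))) \<partial>lborel)"
    using d lborel_integral_real_affine[of d "\<lambda>t. p t * (rker s (t - l) - 2 * rker s (t - (l + d)) + rker s (t - (l + 2 * d)))" l] by simp
  also have "\<dots> = (\<integral>t. p (l + d * t) * (d * rker s (d * t) - 2 * (d * rker s (d * (t - 1))) + d * rker s (d * (t - 2))) \<partial>lborel)"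
    using d by (subst integral_mult_right_zero[symmetric], intro Bochner_Integration.integral_cong refl) (simp add: algebra_simps)
  also have "\<dots> = d powr s * (\<integral>t. p (l + d * t) * rdiff2 s t \<partial>lborel)"
    unfolding rker_scale[OF d]
    by (subst integral_mult_right_zero[symmetric], intro Bochner_Integration.integral_cong refl) (simp add: algebra_simps rdiff_def rdiff2_def)
  also have "(\<integral>t. p (l + d * t) * rdiff2 s t \<partial>lborel) = (\<integral>t. p (l + d * t) * rdiff2 s t \<partial>lborel) - (\<integral>t. p l * rdiff2 s t \<partial>lborel)"
    by (simp add: integral_rdiff2[OF s])
  also have "\<dots> = (\<integral>t. p (l + d * t) * rdiff2 s t - p l * rdiff2 s t \<partial>lborel)"
    by (intro Bochner_Integration.integral_diff[symmetric] shifted_integrable integrable_mult_right rdiff2_integrable s)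
  also have "\<dots> = (\<integral>t. (p (l + d * t) - p l) * rdiff2 s t \<partial>lborel)"
    by (simp add: algebra_simps)
  finally show ?thesis .
qed

text \<open>The restriction s + \<delta> < 1 is the integrability of the weighted kernel. The
  exponent \<delta> = 1 - s is just excluded. Only increments of \<open>p\<close> to the right of x
  enter, since \<open>rdiff s\<close> vanishes to the left of -1.\<close>

lemma RI_Holder:
  assumes s: "0 < s" "s < 1" and \<delta>: "0 \<le> \<delta>" "s + \<delta> < 1"
    and H: "\<And>t. 0 \<le> t \<Longrightarrow> \<bar>p (x + t) - p x\<bar> \<le> H * t powr \<delta>" and h: "0 \<le> h"
  shows "\<bar>RI s p (x + h) - RI s p x\<bar> \<le> H * (\<integral>t. (1 + \<bar>t\<bar>) powr \<delta> * \<bar>rdiff s t\<bar> \<partial>lborel) * h powr (s + \<delta>)"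
proof (cases "h = 0")
  case False
  then have h: "0 < h" using assms by simp
  have H0: "0 \<le> H" using H[of 1] by simp
  have iW: "integrable lborel (\<lambda>t. (1 + \<bar>t\<bar>) powr \<delta> * \<bar>rdiff s t\<bar>)"
    using integrable_abs[OF rdiff_weight_integrable[OF s(1) \<delta>]] by (simp add: abs_mult)
  have "\<bar>\<integral>t. (p (x + h * (1 + t)) - p x) * rdiff s t \<partial>lborel\<bar> \<le> (\<integral>t. \<bar>(p (x + h * (1 + t)) - p x) * rdiff s t\<bar> \<partial>lborel)"
    by (rule integral_abs_bound)
  also have "\<dots> \<le> (\<integral>t. H * h powr \<delta> * ((1 + \<bar>t\<bar>) powr \<delta> * \<bar>rdiff s t\<bar>) \<partial>lborel)"
  proof (rule integral_mono)
    show "integrable lborel (\<lambda>t. H * h powr \<delta> * ((1 + \<bar>t\<bar>) powr \<delta> * \<bar>rdiff s t\<bar>))" using iW by auto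
    have "integrable lborel (\<lambda>t. p (x + h + h * t) * rdiff s t - p x * rdiff s t)"
      by (intro Bochner_Integration.integrable_diff shifted_integrable integrable_mult_right rdiff_integrable s)
    then show "integrable lborel (\<lambda>t. \<bar>(p (x + h * (1 + t)) - p x) * rdiff s t\<bar>)"
      by (intro integrable_abs) (simp add: algebra_simps)
    fix t
    show "\<bar>(p (x + h * (1 + t)) - p x) * rdiff s t\<bar> \<le> H * h powr \<delta> * ((1 + \<bar>t\<bar>) powr \<delta> * \<bar>rdiff s t\<bar>)"
    proof (cases "t \<le> -1")
      case False
      have "\<bar>p (x + h * (1 + t)) - p x\<bar> \<le> H * (h * (1 + t)) powr \<delta>"
        using False h by (intro H) auto
      also have "\<dots> \<le> H * (h * (1 + \<bar>t\<bar>)) powr \<delta>"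
        using False h \<delta> H0 by (intro mult_left_mono powr_mono2) auto
      also have "\<dots> = H * h powr \<delta> * (1 + \<bar>t\<bar>) powr \<delta>" using h by (simp add: powr_mult)
      finally show ?thesis
        unfolding abs_mult mult.assoc[symmetric] by (rule mult_right_mono) auto
    qed (simp add: rdiff_eq_0)
  qed
  finally have "\<bar>\<integral>t. (p (x + h * (1 + t)) - p x) * rdiff s t \<partial>lborel\<bar> \<le> H * h powr \<delta> * (\<integral>t. (1 + \<bar>t\<bar>) powr \<delta> * \<bar>rdiff s t\<bar> \<partial>lborel)"
    by simp
  from mult_left_mono[OF this, of "h powr s"] show ?thesis
    unfolding RI_increment[OF s h] by (simp add: abs_mult powr_add mult_ac)
qed (use assms in simp)

text \<open>Cauchy-Schwarz with |rdiff2 s| split into two square roots, so that squared increments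
  are averaged against |rdiff2 s|. The estimate lives in \<open>ennreal\<close> because the
  right-hand side may be infinite.\<close>

lemma d2_square_le:
  assumes s: "0 < s" "s < 1" and d: "0 < d"
  shows "ennreal ((d2 (RI s p) d l)^2) \<le>
    ennreal (d powr (2 * s) * (\<integral>t. \<bar>rdiff2 s t\<bar> \<partial>lborel)) * (\<integral>\<^sup>+t. ennreal ((p (l + d * t) - p l)^2 * \<bar>rdiff2 s t\<bar>) \<partial>lborel)"
proof -
  let ?\<delta> = "\<lambda>t. p (l + d * t) - p l"
  let ?I = "\<integral>t. ?\<delta> t * rdiff2 s t \<partial>lborel"
  have int: "integrable lborel (\<lambda>t. ?\<delta> t * rdiff2 s t)"
    unfolding left_diff_distrib
    by (intro Bochner_Integration.integrable_diff shifted_integrable integrable_mult_right rdiff2_integrable s)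
  have "ennreal \<bar>?I\<bar> \<le> (\<integral>\<^sup>+t. ennreal \<bar>?\<delta> t * rdiff2 s t\<bar> \<partial>lborel)"
    using integral_norm_bound_ennreal[OF int] by simp
  also have "\<dots> = (\<integral>\<^sup>+t. ennreal (\<bar>?\<delta> t\<bar> * sqrt \<bar>rdiff2 s t\<bar>) * ennreal (sqrt \<bar>rdiff2 s t\<bar>) \<partial>lborel)"
    by (intro nn_integral_cong) (simp add: ennreal_mult'[symmetric] abs_mult mult.assoc)
  finally have "(ennreal \<bar>?I\<bar>)^2 \<le> (\<integral>\<^sup>+t. ennreal (\<bar>?\<delta> t\<bar> * sqrt \<bar>rdiff2 s t\<bar>) * ennreal (sqrt \<bar>rdiff2 s t\<bar>) \<partial>lborel)^2"
    by (rule power_mono) simp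
  also have "\<dots> \<le> (\<integral>\<^sup>+t. (ennreal (\<bar>?\<delta> t\<bar> * sqrt \<bar>rdiff2 s t\<bar>))^2 \<partial>lborel) * (\<integral>\<^sup>+t. (ennreal (sqrt \<bar>rdiff2 s t\<bar>))^2 \<partial>lborel)"
    by (rule Cauchy_Schwarz_nn_integral) measurable
  also have "(\<integral>\<^sup>+t. (ennreal (\<bar>?\<delta> t\<bar> * sqrt \<bar>rdiff2 s t\<bar>))^2 \<partial>lborel) = (\<integral>\<^sup>+t. ennreal ((?\<delta> t)^2 * \<bar>rdiff2 s t\<bar>) \<partial>lborel)"
    by (simp add: ennreal_power power_mult_distrib)
  also have "(\<integral>\<^sup>+t. (ennreal (sqrt \<bar>rdiff2 s t\<bar>))^2 \<partial>lborel) = ennreal (\<integral>t. \<bar>rdiff2 s t\<bar> \<partial>lborel)"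
    using rdiff2_integrable[OF s] by (subst nn_integral_eq_integral[symmetric]) (auto simp: ennreal_power)
  finally have *: "ennreal (?I^2) \<le> (\<integral>\<^sup>+t. ennreal ((?\<delta> t)^2 * \<bar>rdiff2 s t\<bar>) \<partial>lborel) * ennreal (\<integral>t. \<bar>rdiff2 s t\<bar> \<partial>lborel)"
    by (simp add: ennreal_power)
  have "(d2 (RI s p) d l)^2 = d powr (2 * s) * ?I^2"
    unfolding RI_d2[OF s d] using d by (simp add: power_mult_distrib power2_eq_square powr_add[symmetric])
  then have "ennreal ((d2 (RI s p) d l)^2) = ennreal (d powr (2 * s)) * ennreal (?I^2)"
    by (simp add: ennreal_mult)
  also have "\<dots> \<le> ennreal (d powr (2 * s)) * ((\<integral>\<^sup>+t. ennreal ((?\<delta> t)^2 * \<bar>rdiff2 s t\<bar>) \<partial>lborel) * ennreal (\<integral>t. \<bar>rdiff2 s t\<bar> \<partial>lborel))"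
    by (rule mult_left_mono[OF *]) simp
  also have "\<dots> = ennreal (d powr (2 * s) * (\<integral>t. \<bar>rdiff2 s t\<bar> \<partial>lborel)) * (\<integral>\<^sup>+t. ennreal ((?\<delta> t)^2 * \<bar>rdiff2 s t\<bar>) \<partial>lborel)"
    by (simp add: ennreal_mult mult_ac)
  finally show ?thesis .
qed

text \<open>Pointwise in \<open>l\<close>: an energy of order 1 - s of \<open>p\<close> controls an
  energy of order 1 of its fractional integral. The exponents fit because d^(-3) * d^(2 * s) = d^(-1
  - 2 * (1 - s)). After exchanging the integrals, the substitution d * t for fixed t yields the
  factor t^(2 - 2 * s) times the energy density of \<open>p\<close> at l.\<close>

lemma d2_energy_le:
  assumes s: "0 < s" "s < 1"
  shows "(\<integral>\<^sup>+d. ennreal (indicator {0<..} d * d powr (-3) * (d2 (RI s p) d l)^2) \<partial>lborel)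
    \<le> ennreal (rdiff2_const s) * (\<integral>\<^sup>+t. ennreal (indicator {0<..} t * sqinc p (1 - s) l t) \<partial>lborel)"
proof -
  let ?\<delta> = "\<lambda>t. p (l + t) - p l"
  define N where "N = (\<integral>t. \<bar>rdiff2 s t\<bar> \<partial>lborel)"
  have N: "0 \<le> N" by (simp add: N_def)
  define e where "e = (\<integral>\<^sup>+t. ennreal (indicator {0<..} t * sqinc p (1 - s) l t) \<partial>lborel)"
  let ?F = "\<lambda>d t. indicator {0<..} d * d powr (2 * s - 3) * (?\<delta> (d * t))^2 * \<bar>rdiff2 s t\<bar>"
  have "(\<integral>\<^sup>+d. ennreal (indicator {0<..} d * d powr (-3) * (d2 (RI s p) d l)^2) \<partial>lborel)
     \<le> (\<integral>\<^sup>+d. ennreal N * (\<integral>\<^sup>+t. ennreal (?F d t) \<partial>lborel) \<partial>lborel)"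
  proof (intro nn_integral_mono)
    fix d :: real
    show "ennreal (indicator {0<..} d * d powr (-3) * (d2 (RI s p) d l)^2) \<le> ennreal N * (\<integral>\<^sup>+t. ennreal (?F d t) \<partial>lborel)"
    proof (cases "0 < d")
      case True
      have "ennreal (indicator {0<..} d * d powr (-3) * (d2 (RI s p) d l)^2) = ennreal (d powr (-3)) * ennreal ((d2 (RI s p) d l)^2)"
        using True by (simp add: ennreal_mult)
      also have "\<dots> \<le> ennreal (d powr (-3)) * (ennreal (d powr (2 * s) * N) * (\<integral>\<^sup>+t. ennreal ((?\<delta> (d * t))^2 * \<bar>rdiff2 s t\<bar>) \<partial>lborel))"
        unfolding N_def by (intro mult_left_mono d2_square_le s True) simp
      also have "\<dots> = ennreal N * (ennreal (d powr (2 * s - 3)) * (\<integral>\<^sup>+t. ennreal ((?\<delta> (d * t))^2 * \<bar>rdiff2 s t\<bar>) \<partial>lborel))"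
      proof -
        have "d powr (-3) * (d powr (2 * s) * N) = N * d powr (2 * s - 3)"
          using True by (simp add: powr_diff powr_minus field_simps)
        then have "ennreal (d powr (-3)) * ennreal (d powr (2 * s) * N) = ennreal N * ennreal (d powr (2 * s - 3))"
          using N by (simp add: ennreal_mult'[symmetric])
        then show ?thesis by (simp only: mult.assoc[symmetric])
      qed
      also have "ennreal (d powr (2 * s - 3)) * (\<integral>\<^sup>+t. ennreal ((?\<delta> (d * t))^2 * \<bar>rdiff2 s t\<bar>) \<partial>lborel) = (\<integral>\<^sup>+t. ennreal (?F d t) \<partial>lborel)"
        using True by (subst nn_integral_cmult[symmetric]) (auto simp: ennreal_mult'[symmetric] mult.assoc)
      finally show ?thesis .
    qed simp
  qed
  also have "\<dots> = ennreal N * (\<integral>\<^sup>+d. \<integral>\<^sup>+t. ennreal (?F d t) \<partial>lborel \<partial>lborel)"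
    by (rule nn_integral_cmult) measurable
  also have "(\<integral>\<^sup>+d. \<integral>\<^sup>+t. ennreal (?F d t) \<partial>lborel \<partial>lborel) = (\<integral>\<^sup>+t. \<integral>\<^sup>+d. ennreal (?F d t) \<partial>lborel \<partial>lborel)"
    by (rule lborel_pair.Fubini'[symmetric]) measurable
  also have "\<dots> = (\<integral>\<^sup>+t. ennreal (\<bar>t\<bar> powr (2 - 2 * s) * \<bar>rdiff2 s t\<bar>) * e \<partial>lborel)"
  proof (intro nn_integral_cong)
    fix t :: real
    show "(\<integral>\<^sup>+d. ennreal (?F d t) \<partial>lborel) = ennreal (\<bar>t\<bar> powr (2 - 2 * s) * \<bar>rdiff2 s t\<bar>) * e"
    proof (cases "0 < t")
      case True
      have "e = \<bar>t\<bar> * (\<integral>\<^sup>+d. ennreal (indicator {0<..} (0 + t * d) * sqinc p (1 - s) l (0 + t * d)) \<partial>lborel)"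
        unfolding e_def using True by (intro nn_integral_real_affine) auto
      also have "\<dots> = (\<integral>\<^sup>+d. ennreal (t powr (2 * s - 2) * (indicator {0<..} d * d powr (2 * s - 3) * (?\<delta> (d * t))^2)) \<partial>lborel)"
      proof (subst nn_integral_cmult[symmetric], measurable, intro nn_integral_cong)
        fix d :: real
        have "t * (t * d) powr (-1 - 2 * (1 - s)) = t powr (2 * s - 2) * d powr (2 * s - 3)" if "0 < d"
        proof -
          have "t * (t * d) powr (-1 - 2 * (1 - s)) = (t powr 1 * t powr (2 * s - 3)) * d powr (2 * s - 3)"
            using True that by (simp add: powr_mult)
          also have "t powr 1 * t powr (2 * s - 3) = t powr (2 * s - 2)"
            by (simp only: powr_add[symmetric]) simp
          finally show ?thesis .
        qed
        then have "t * (indicator {0<..} (t * d) * sqinc p (1 - s) l (t * d)) = t powr (2 * s - 2) * (indicator {0<..} d * d powr (2 * s - 3) * (?\<delta> (d * t))^2)"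
          using True by (cases "0 < d") (auto simp: sqinc_def indicator_def zero_less_mult_iff mult_ac)
        then show "ennreal \<bar>t\<bar> * ennreal (indicator {0<..} (0 + t * d) * sqinc p (1 - s) l (0 + t * d)) = ennreal (t powr (2 * s - 2) * (indicator {0<..} d * d powr (2 * s - 3) * (?\<delta> (d * t))^2))"
          using True by (simp add: ennreal_mult'[symmetric])
      qed
      finally have "ennreal (\<bar>t\<bar> powr (2 - 2 * s) * \<bar>rdiff2 s t\<bar>) * e =
        (\<integral>\<^sup>+d. ennreal (\<bar>t\<bar> powr (2 - 2 * s) * \<bar>rdiff2 s t\<bar>) * ennreal (t powr (2 * s - 2) * (indicator {0<..} d * d powr (2 * s - 3) * (?\<delta> (d * t))^2)) \<partial>lborel)"
        by (simp only:) (rule nn_integral_cmult[symmetric], measurable)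
      also have "\<dots> = (\<integral>\<^sup>+d. ennreal (?F d t) \<partial>lborel)"
      proof (intro nn_integral_cong)
        fix d
        have "t powr (2 - 2 * s) * t powr (2 * s - 2) = 1" using True by (simp add: powr_add[symmetric])
        then have "(\<bar>t\<bar> powr (2 - 2 * s) * \<bar>rdiff2 s t\<bar>) * (t powr (2 * s - 2) * (indicator {0<..} d * d powr (2 * s - 3) * (?\<delta> (d * t))^2)) = ?F d t"
          using True by (simp add: mult_ac)
        then show "ennreal (\<bar>t\<bar> powr (2 - 2 * s) * \<bar>rdiff2 s t\<bar>) * ennreal (t powr (2 * s - 2) * (indicator {0<..} d * d powr (2 * s - 3) * (?\<delta> (d * t))^2)) = ennreal (?F d t)"
          by (simp only: ennreal_mult'[symmetric] mult_nonneg_nonneg powr_ge_zero abs_ge_zero)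
      qed
      finally show ?thesis by simp
    qed (simp add: rdiff2_eq_0)
  qed
  also have "\<dots> = (\<integral>\<^sup>+t. ennreal (\<bar>t\<bar> powr (2 - 2 * s) * \<bar>rdiff2 s t\<bar>) \<partial>lborel) * e"
    by (rule nn_integral_multc) measurable
  also have "(\<integral>\<^sup>+t. ennreal (\<bar>t\<bar> powr (2 - 2 * s) * \<bar>rdiff2 s t\<bar>) \<partial>lborel) = ennreal (\<integral>t. \<bar>t\<bar> powr (2 - 2 * s) * \<bar>rdiff2 s t\<bar> \<partial>lborel)"
    using integrable_abs[OF rdiff2_weight_integrable[OF s, of "2 - 2 * s"]] s
    by (intro nn_integral_eq_integral) (auto simp: abs_mult)
  finally show ?thesis
    by (simp add: rdiff2_const_def N_def e_def ennreal_mult mult_ac)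
qed

end

section \<open>Dyadic energies and primitives\<close>

definition didx :: "nat \<Rightarrow> real \<Rightarrow> nat" where
  "didx n x = nat \<lfloor>2 ^ n * x\<rfloor>"

definition dinc :: "(real \<Rightarrow> real) \<Rightarrow> nat \<Rightarrow> nat \<Rightarrow> real" where
  "dinc u n j = u ((real j + 1) / 2 ^ n) - u (real j / 2 ^ n)"

definition dslope :: "(real \<Rightarrow> real) \<Rightarrow> nat \<Rightarrow> real \<Rightarrow> real" where
  "dslope u n x = indicator {0..<1} x * (2 ^ n * dinc u n (didx n x))"

definition dvar :: "(real \<Rightarrow> real) \<Rightarrow> nat \<Rightarrow> real" where
  "dvar u n = 2 ^ n * (\<Sum>j<2 ^ n. (dinc u n j)^2)"

lemma didx_measurable [measurable]: "didx n \<in> measurable borel (count_space UNIV)"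
  unfolding didx_def[abs_def] by measurable

lemma dslope_measurable [measurable]: "dslope u n \<in> borel_measurable borel"
  unfolding dslope_def[abs_def] by measurable

lemma didx_eq_iff:
  assumes "0 \<le> x"
  shows "didx n x = j \<longleftrightarrow> real j / 2 ^ n \<le> x \<and> x < (real j + 1) / 2 ^ n"
proof -
  have "didx n x = j \<longleftrightarrow> \<lfloor>2 ^ n * x\<rfloor> = int j"
    using assms by (auto simp: didx_def nat_eq_iff2)
  also have "\<dots> \<longleftrightarrow> real j \<le> 2 ^ n * x \<and> 2 ^ n * x < real j + 1"
    by (simp add: floor_eq_iff)
  finally show ?thesis by (simp add: field_simps)
qed

lemma didx_less: "0 \<le> x \<Longrightarrow> x < 1 \<Longrightarrow> didx n x < 2 ^ n"
proof -
  assume x: "0 \<le> x" "x < 1"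
  have "real (didx n x) / 2 ^ n \<le> x" using didx_eq_iff[of x n "didx n x"] x by blast
  with x have "real (didx n x) / 2 ^ n < 1" by linarith
  then have "real (didx n x) < real (2 ^ n)" by simp
  then show ?thesis by (simp only: of_nat_less_iff)
qed

lemma didx_div: "didx n x = didx (n + k) x div 2 ^ k"
proof -
  have "nat \<lfloor>2 ^ (n + k) * x\<rfloor> div 2 ^ k = nat (\<lfloor>2 ^ (n + k) * x\<rfloor> div 2 ^ k)"
    by (cases "0 \<le> \<lfloor>2 ^ (n + k) * x\<rfloor>") (auto simp: nat_div_distrib nat_power_eq div_nonpos_pos_le0)
  also have "\<lfloor>2 ^ (n + k) * x\<rfloor> div 2 ^ k = \<lfloor>2 ^ (n + k) * x / of_int (2 ^ k)\<rfloor>"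
    by (rule floor_divide_real_eq_div[symmetric]) simp
  also have "2 ^ (n + k) * x / of_int (2 ^ k) = 2 ^ n * x" by (simp add: power_add)
  finally show ?thesis by (simp add: didx_def)
qed

lemma has_bochner_integral_didx:
  "has_bochner_integral lborel (\<lambda>x. indicator {0..<1} x * F (didx n x)) ((\<Sum>j<2 ^ n. F j) / 2 ^ n :: real)"
proof -
  have eq: "indicator {0..<1} x * F (didx n x) = (\<Sum>j<2 ^ n. F j * indicator {real j / 2 ^ n..<(real j + 1) / 2 ^ n} x)" for x
  proof (cases "x \<in> {0..<1}")
    case True
    then have "indicator {real j / 2 ^ n..<(real j + 1) / 2 ^ n} x = (if j = didx n x then 1 else 0 :: real)" for j
      using didx_eq_iff[of x n j] by (cases "didx n x = j") (auto simp: indicator_def)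
    then have "(\<Sum>j<2 ^ n. F j * indicator {real j / 2 ^ n..<(real j + 1) / 2 ^ n} x) = (\<Sum>j<2 ^ n. if j = didx n x then F j else 0)"
      by (intro sum.cong) auto
    also have "\<dots> = F (didx n x)" using True didx_less[of x n] by simp
    finally show ?thesis using True by simp
  next
    case False
    have "indicator {real j / 2 ^ n..<(real j + 1) / 2 ^ n} x = (0::real)" if "j < 2 ^ n" for j
    proof -
      have "real j + 1 \<le> 2 ^ n" using that by (metis Suc_leI of_nat_Suc of_nat_le_iff of_nat_numeral of_nat_power add.commute)
      then have "(real j + 1) / 2 ^ n \<le> 1" by simp
      moreover have "0 \<le> real j / 2 ^ n" by simp
      ultimately have "x \<notin> {real j / 2 ^ n..<(real j + 1) / 2 ^ n}"
        using False unfolding atLeastLessThan_iff by linarith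
      then show ?thesis by simp
    qed
    then show ?thesis using False by simp
  qed
  have "has_bochner_integral lborel (\<lambda>x. \<Sum>j<2 ^ n. F j * indicator {real j / 2 ^ n..<(real j + 1) / 2 ^ n} x) (\<Sum>j<2 ^ n. F j * (1 / 2 ^ n))"
  proof (intro has_bochner_integral_sum has_bochner_integral_mult_right)
    fix j
    have "measure lborel {real j / 2 ^ n..<(real j + 1) / 2 ^ n} = 1 / 2 ^ n"
      by (simp add: divide_right_mono diff_divide_distrib[symmetric])
    then show "has_bochner_integral lborel (indicator {real j / 2 ^ n..<(real j + 1) / 2 ^ n}) (1 / 2 ^ n :: real)"
      using has_bochner_integral_real_indicator[of "{real j / 2 ^ n..<(real j + 1) / 2 ^ n}" lborel]
      by (simp add: divide_right_mono)
  qed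
  then show ?thesis unfolding eq[abs_def] by (simp add: sum_divide_distrib)
qed

lemma sum_pairs: "(\<Sum>i<2 * N. f i) = (\<Sum>j<N. f (2 * j) + f (2 * j + 1 :: nat))"
  for f :: "nat \<Rightarrow> real"
  by (induction N) auto

lemma dinc_split: "dinc u n j = dinc u (Suc n) (2 * j) + dinc u (Suc n) (2 * j + 1)"
proof -
  have e: "(2 * real j + 1 + 1) / (2 * 2 ^ n) = (real j + 1) / 2 ^ n" "(2 * real j) / (2 * 2 ^ n) = real j / 2 ^ n"
    by (auto simp: field_simps)
  show ?thesis unfolding dinc_def by (simp only: power_Suc of_nat_mult of_nat_add of_nat_numeral of_nat_1 e)
qed

text \<open>\<open>i div 2 ^ k\<close> is the ancestor of the fine interval i, k levels up. The
  increments over all descendants add up to that of the ancestor, so coefficients constant on coarse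
  intervals do not notice the refinement: this is the martingale property.\<close>

lemma dinc_sum_refine: "(\<Sum>i<2 ^ (n + k). dinc u (n + k) i * c (i div 2 ^ k)) = (\<Sum>j<2 ^ n. dinc u n j * c j)"
proof (induction k)
  case (Suc k)
  have "(\<Sum>i<2 ^ (n + Suc k). dinc u (n + Suc k) i * c (i div 2 ^ Suc k))
     = (\<Sum>i<2 * 2 ^ (n + k). dinc u (Suc (n + k)) i * c ((i div 2) div 2 ^ k))"
    by (simp add: div_mult2_eq)
  also have "\<dots> = (\<Sum>i<2 ^ (n + k). dinc u (n + k) i * c (i div 2 ^ k))"
    unfolding sum_pairs dinc_split[of u "n + k"] by (intro sum.cong refl) (simp add: distrib_right)
  finally show ?case using Suc by simp
qed simp

text \<open>Parallelogram law: for the increments A, B over the two halves of an interval, 2 * (A^2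
  + B^2) = (A + B)^2 + (B - A)^2. The sum is the increment over the whole interval and B - A the
  second difference with the midpoint in the middle.\<close>

lemma dvar_Suc: "dvar u (Suc n) = dvar u n + 2 ^ n * (\<Sum>j<2 ^ n. (d2 u (1 / 2 ^ Suc n) (real j / 2 ^ n))^2)"
proof -
  have "d2 u (1 / 2 ^ Suc n) (real j / 2 ^ n) = dinc u (Suc n) (2 * j + 1) - dinc u (Suc n) (2 * j)" for j
  proof -
    have e: "(real (2 * j + 1) + 1) / 2 ^ Suc n = real j / 2 ^ n + 2 * (1 / 2 ^ Suc n)"
      "real (2 * j + 1) / 2 ^ Suc n = real j / 2 ^ n + 1 / 2 ^ Suc n"
      "(real (2 * j) + 1) / 2 ^ Suc n = real j / 2 ^ n + 1 / 2 ^ Suc n"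
      "real (2 * j) / 2 ^ Suc n = real j / 2 ^ n"
      by (auto simp: field_simps)
    show ?thesis unfolding d2_def dinc_def e by simp
  qed
  then have "2 * ((dinc u (Suc n) (2 * j))^2 + (dinc u (Suc n) (2 * j + 1))^2) = (dinc u n j)^2 + (d2 u (1 / 2 ^ Suc n) (real j / 2 ^ n))^2" for j
    unfolding dinc_split[of u n j] by (simp only:) (simp add: power2_eq_square algebra_simps)
  then have "2 ^ n * (\<Sum>j<2 ^ n. 2 * ((dinc u (Suc n) (2 * j))^2 + (dinc u (Suc n) (2 * j + 1))^2)) = 2 ^ n * (\<Sum>j<2 ^ n. (dinc u n j)^2 + (d2 u (1 / 2 ^ Suc n) (real j / 2 ^ n))^2)"
    by simp
  then show ?thesis
    unfolding dvar_def power_Suc sum_pairs by (simp add: sum_distrib_left[symmetric] sum.distrib algebra_simps)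
qed

text \<open>The inner product in L^2 depends on the coarser level alone, hence increments of the
  martingale are orthogonal; n = m identifies \<open>dvar u n\<close> as a squared norm.\<close>

lemma dslope_mult:
  assumes "n \<le> m"
  shows "has_bochner_integral lborel (\<lambda>x. dslope u m x * dslope u n x) (dvar u n)"
proof -
  obtain k where m: "m = n + k" using assms le_Suc_ex by blast
  have "has_bochner_integral lborel (\<lambda>x. indicator {0..<1} x * (2 ^ m * dinc u m (didx m x) * (2 ^ n * dinc u n (didx m x div 2 ^ k))))
     ((\<Sum>i<2 ^ m. 2 ^ m * dinc u m i * (2 ^ n * dinc u n (i div 2 ^ k))) / 2 ^ m)"
    by (rule has_bochner_integral_didx)
  also have "(\<lambda>x. indicator {0..<1} x * (2 ^ m * dinc u m (didx m x) * (2 ^ n * dinc u n (didx m x div 2 ^ k)))) = (\<lambda>x. dslope u m x * dslope u n x)"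
    using didx_div[of n _ k] by (auto simp: dslope_def m indicator_def fun_eq_iff)
  also have "(\<Sum>i<2 ^ m. 2 ^ m * dinc u m i * (2 ^ n * dinc u n (i div 2 ^ k))) / 2 ^ m = 2 ^ n * (\<Sum>i<2 ^ m. dinc u m i * dinc u n (i div 2 ^ k))"
    by (simp add: sum_distrib_left sum_divide_distrib mult_ac)
  also have "\<dots> = dvar u n"
    unfolding m dinc_sum_refine by (simp add: dvar_def power2_eq_square)
  finally show ?thesis .
qed

lemma dslope_integrable: "integrable lborel (dslope u n)"
  using has_bochner_integral_didx[of "\<lambda>j. 2 ^ n * dinc u n j" n] unfolding dslope_def[abs_def]
  by (simp add: has_bochner_integral_iff)

text \<open>At dyadic points the slopes of this and every finer level reproduce \<open>u\<close>
  exactly, so their limit must have \<open>u\<close> as primitive at these points.\<close>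

lemma integral_dslope_dyadic:
  assumes "n \<le> m" "i \<le> 2 ^ n"
  shows "(\<integral>x. indicator {0..<real i / 2 ^ n} x * dslope u m x \<partial>lborel) = u (real i / 2 ^ n) - u 0"
proof -
  obtain k where m: "m = n + k" using assms le_Suc_ex by blast
  define K where "K = i * 2 ^ k"
  have x: "real i / 2 ^ n = real K / 2 ^ m" by (simp add: K_def m power_add)
  have Km: "K \<le> 2 ^ m" using assms(2) by (simp add: K_def m power_add)
  have "indicator {0..<real i / 2 ^ n} x * dslope u m x = indicator {0..<1} x * (if didx m x < K then 2 ^ m * dinc u m (didx m x) else 0)" for x
  proof (cases "0 \<le> x \<and> x < 1")
    case True
    have d: "real (didx m x) / 2 ^ m \<le> x" "x < (real (didx m x) + 1) / 2 ^ m"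
      using didx_eq_iff[of x m "didx m x"] True by auto
    have "didx m x < K \<longleftrightarrow> x < real K / 2 ^ m"
    proof
      assume "didx m x < K"
      then have "real (didx m x) + 1 \<le> real K" by linarith
      then have "(real (didx m x) + 1) / 2 ^ m \<le> real K / 2 ^ m" by (intro divide_right_mono) auto
      then show "x < real K / 2 ^ m" using d by linarith
    next
      assume "x < real K / 2 ^ m"
      then have "real (didx m x) / 2 ^ m < real K / 2 ^ m" using d by linarith
      then show "didx m x < K" by (simp add: divide_less_cancel)
    qed
    then show ?thesis using True by (simp add: dslope_def x)
  qed (auto simp: dslope_def)
  then have "(\<integral>x. indicator {0..<real i / 2 ^ n} x * dslope u m x \<partial>lborel) = (\<Sum>j<2 ^ m. if j < K then 2 ^ m * dinc u m j else 0) / 2 ^ m"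
    using has_bochner_integral_didx[of "\<lambda>j. if j < K then 2 ^ m * dinc u m j else 0" m] by (simp add: has_bochner_integral_iff)
  also have "\<dots> = (\<Sum>j<K. dinc u m j)"
  proof -
    have "(\<Sum>j<2 ^ m. if j < K then 2 ^ m * dinc u m j else 0) = (\<Sum>j<K. 2 ^ m * dinc u m j)"
      using Km by (intro sum.mono_neutral_cong_right) auto
    then show ?thesis by (simp add: sum_distrib_left[symmetric])
  qed
  also have "\<dots> = (\<Sum>j<K. u (real (Suc j) / 2 ^ m) - u (real j / 2 ^ m))"
    by (simp add: dinc_def add.commute)
  also have "\<dots> = u (real K / 2 ^ m) - u 0"
    by (subst sum_lessThan_telescope) simp
  finally show ?thesis by (simp add: x)
qed

text \<open>By \<open>dslope_mult\<close> the difference has squared L^2 norm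
  \<open>dvar u m - dvar u n\<close>; Cauchy-Schwarz on the unit interval, which has measure 1,
  passes to L^1.\<close>

lemma dslope_diff_L1:
  assumes "n \<le> m"
  shows "(\<integral>x. \<bar>dslope u m x - dslope u n x\<bar> \<partial>lborel) \<le> sqrt (dvar u m - dvar u n)"
proof -
  let ?d = "\<lambda>x. dslope u m x - dslope u n x"
  have hb: "has_bochner_integral lborel (\<lambda>x. dslope u m x * dslope u m x - 2 * (dslope u m x * dslope u n x) + dslope u n x * dslope u n x)
     (dvar u m - 2 * dvar u n + dvar u n)"
    by (intro has_bochner_integral_add has_bochner_integral_diff has_bochner_integral_mult_right dslope_mult assms order_refl)
  have eq: "(?d x)^2 = dslope u m x * dslope u m x - 2 * (dslope u m x * dslope u n x) + dslope u n x * dslope u n x" for x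
    by (simp add: power2_eq_square algebra_simps)
  have sq: "integrable lborel (\<lambda>x. (?d x)^2)" "(\<integral>x. (?d x)^2 \<partial>lborel) = dvar u m - dvar u n"
    unfolding eq using hb by (simp_all add: has_bochner_integral_iff)
  have int: "integrable lborel ?d" using dslope_integrable by auto
  have "(\<integral>\<^sup>+x. ennreal \<bar>?d x\<bar> \<partial>lborel)^2 = (\<integral>\<^sup>+x. ennreal \<bar>?d x\<bar> * ennreal (indicator {0..<1} x) \<partial>lborel)^2"
    by (intro arg_cong[where f="\<lambda>z. z^2"] nn_integral_cong) (auto simp: dslope_def indicator_def)
  also have "\<dots> \<le> (\<integral>\<^sup>+x. (ennreal \<bar>?d x\<bar>)^2 \<partial>lborel) * (\<integral>\<^sup>+x. (ennreal (indicator {0..<1::real} x))^2 \<partial>lborel)"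
    by (rule Cauchy_Schwarz_nn_integral) measurable
  also have "(\<integral>\<^sup>+x. (ennreal (indicator {0..<1::real} x))^2 \<partial>lborel) = (\<integral>\<^sup>+x. indicator {0..<1::real} x \<partial>lborel)"
    by (intro nn_integral_cong) (auto simp: indicator_def)
  also have "\<dots> = 1" by simp
  also have "(\<integral>\<^sup>+x. (ennreal \<bar>?d x\<bar>)^2 \<partial>lborel) = ennreal (dvar u m - dvar u n)"
    using nn_integral_eq_integral[OF sq(1)] sq(2) by (simp add: ennreal_power)
  also have "(\<integral>\<^sup>+x. ennreal \<bar>?d x\<bar> \<partial>lborel) = ennreal (\<integral>x. \<bar>?d x\<bar> \<partial>lborel)"
    using int by (intro nn_integral_eq_integral) auto
  finally have "ennreal ((\<integral>x. \<bar>?d x\<bar> \<partial>lborel)^2) \<le> ennreal (dvar u m - dvar u n)"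
    by (simp add: ennreal_power)
  moreover have "0 \<le> dvar u m - dvar u n"
    unfolding sq(2)[symmetric] by simp
  ultimately have "(\<integral>x. \<bar>?d x\<bar> \<partial>lborel)^2 \<le> dvar u m - dvar u n"
    by (simp add: ennreal_le_iff)
  then show ?thesis by (rule real_le_rsqrt)
qed

lemma AE_summable_L1:
  fixes f :: "nat \<Rightarrow> 'a \<Rightarrow> real"
  assumes [measurable]: "\<And>i. integrable M (f i)" and sm: "summable (\<lambda>i. \<integral>x. \<bar>f i x\<bar> \<partial>M)"
  shows "AE x in M. summable (\<lambda>i. \<bar>f i x\<bar>)"
proof -
  have "(\<integral>\<^sup>+x. (\<Sum>i. ennreal \<bar>f i x\<bar>) \<partial>M) = (\<Sum>i. \<integral>\<^sup>+x. ennreal \<bar>f i x\<bar> \<partial>M)"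
    by (rule nn_integral_suminf) auto
  also have "\<dots> = (\<Sum>i. ennreal (\<integral>x. \<bar>f i x\<bar> \<partial>M))"
    using assms by (intro arg_cong[where f=suminf] ext nn_integral_eq_integral) auto
  also have "\<dots> \<noteq> top"
    using sm by (intro ennreal_suminf_neq_top) auto
  finally have "AE x in M. (\<Sum>i. ennreal \<bar>f i x\<bar>) \<noteq> \<infinity>"
    by (intro nn_integral_PInf_AE) auto
  then show ?thesis
    by eventually_elim (auto intro: summable_suminf_not_top)
qed

lemma integral_indicator_LIMSEQ:
  fixes G :: "real \<Rightarrow> real"
  assumes G: "integrable lborel G" and X: "X \<longlonglongrightarrow> x"
  shows "(\<lambda>n. \<integral>t. indicator {c..<X n} t * G t \<partial>lborel) \<longlonglongrightarrow> (\<integral>t. indicator {c..<x} t * G t \<partial>lborel)"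
proof (rule integral_dominated_convergence)
  have [measurable]: "G \<in> borel_measurable borel" using G by auto
  show "(\<lambda>t. indicator {c..<x} t * G t) \<in> borel_measurable lborel" "\<And>n. (\<lambda>t. indicator {c..<X n} t * G t) \<in> borel_measurable lborel"
    by measurable
  show "integrable lborel (\<lambda>t. \<bar>G t\<bar>)" using G by auto
  show "AE t in lborel. norm (indicator {c..<X n} t * G t) \<le> \<bar>G t\<bar>" for n
    by (intro AE_I2) (auto simp: indicator_def)
  show "AE t in lborel. (\<lambda>n. indicator {c..<X n} t * G t) \<longlonglongrightarrow> indicator {c..<x} t * G t"
    using AE_lborel_singleton[of x]
  proof eventually_elim
    fix t assume t: "t \<noteq> x"
    have "\<forall>\<^sub>F n in sequentially. (t < X n \<longleftrightarrow> t < x)"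
    proof (cases "t < x")
      case True
      show ?thesis by (rule eventually_mono[OF order_tendstoD(1)[OF X True]]) (use True in auto)
    next
      case False
      then have "x < t" using t by auto
      show ?thesis by (rule eventually_mono[OF order_tendstoD(2)[OF X \<open>x < t\<close>]]) (use False in auto)
    qed
    then have "\<forall>\<^sub>F n in sequentially. indicator {c..<X n} t * G t = indicator {c..<x} t * G t"
      by eventually_elim (auto simp: indicator_def)
    then show "(\<lambda>n. indicator {c..<X n} t * G t) \<longlonglongrightarrow> indicator {c..<x} t * G t"
      by (rule tendsto_eventually)
  qed
qed

text \<open>The dyadic slopes of \<open>u\<close> are a martingale, and \<open>dvar u n\<close> is the square of their norm in
  \<open>L\<^sup>2\<close>: its boundedness makes them converge, and the limit is the derivative of \<open>u\<close>.\<close>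

lemma dvar_bounded_imp_primitive:
  assumes u: "continuous_on {0..1} u" and V: "\<And>n. dvar u n \<le> B" and B: "0 < B"
  obtains G where "integrable lborel G" "\<And>x. x \<in> {0..1} \<Longrightarrow> (\<integral>t. indicator {0..<x} t * G t \<partial>lborel) = u x - u 0"
    "(\<integral>t. \<bar>G t\<bar> \<partial>lborel) \<le> 3 * sqrt B"
proof -
  have V0: "0 \<le> dvar u n" for n unfolding dvar_def by (simp add: sum_nonneg)
  have inc: "incseq (dvar u)"
    by (rule incseq_SucI) (simp add: dvar_Suc sum_nonneg)
  obtain L where L: "dvar u \<longlonglongrightarrow> L" "\<And>n. dvar u n \<le> L"
    using incseq_convergent[OF inc, of B] V by blast
  have LB: "L \<le> B" using L(1) V by (intro LIMSEQ_le_const2) auto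
  have "\<exists>N. \<forall>n\<ge>N. L - dvar u n \<le> B / 4 ^ k" for k
  proof -
    have "L - B / 4 ^ k < L" using B by simp
    then have "\<forall>\<^sub>F n in sequentially. L - B / 4 ^ k < dvar u n" using L(1) by (rule order_tendstoD(1)[rotated])
    then have "\<forall>\<^sub>F n in sequentially. L - dvar u n \<le> B / 4 ^ k" by eventually_elim linarith
    then show ?thesis by (simp add: eventually_sequentially)
  qed
  then obtain N where N: "\<And>k n. N k \<le> n \<Longrightarrow> L - dvar u n \<le> B / 4 ^ k" by metis
  \<comment> \<open>Summing makes \<open>r\<close> increasing without assuming this of
    \<open>N\<close>, keeps N k \<le> r k for k > 0, and the summand k drives it to infinity. The
    start r 0 = 0 makes the series begin with the slope at level 0; there L \<le> B and
    \<open>dvar u 0\<close> \<ge> 0 replace the choice of N.\<close>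
  define r where "r k = (\<Sum>i<k. N (Suc i)) + k" for k
  have r0: "r 0 = 0" by (simp add: r_def)
  have rk: "k \<le> r k" for k by (simp add: r_def)
  have rS: "r k \<le> r (Suc k)" for k by (simp add: r_def)
  have Vr: "L - dvar u (r k) \<le> B / 4 ^ k" for k
  proof (cases k)
    case 0
    then show ?thesis using LB V0[of 0] by (simp add: r0)
  next
    case (Suc m)
    have "N k \<le> r k" by (simp add: Suc r_def)
    then show ?thesis by (rule N)
  qed
  define E where "E k x = dslope u (r (Suc k)) x - dslope u (r k) x" for k x
  have int_E: "integrable lborel (E k)" for k
    unfolding E_def[abs_def] using dslope_integrable by auto
  \<comment> \<open>The rate B / 4 ^ k was chosen so that its square root is geometric with ratio
    1/2. The limit can then be taken as an almost everywhere absolutely convergent series.\<close>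
  have E_le: "(\<integral>x. \<bar>E k x\<bar> \<partial>lborel) \<le> sqrt B * (1/2) ^ k" for k
  proof -
    have "(\<integral>x. \<bar>E k x\<bar> \<partial>lborel) \<le> sqrt (dvar u (r (Suc k)) - dvar u (r k))"
      unfolding E_def by (rule dslope_diff_L1[OF rS])
    also have "\<dots> \<le> sqrt (B / 4 ^ k)"
      using Vr[of k] L(2)[of "r (Suc k)"] by (intro real_sqrt_le_mono) linarith
    also have "sqrt (B / 4 ^ k) = sqrt B * (1/2) ^ k"
    proof -
      have "sqrt (4 ^ k) = 2 ^ k"
        by (rule real_sqrt_unique) (simp_all add: power2_eq_square power_mult_distrib[symmetric])
      then show ?thesis unfolding real_sqrt_divide by (simp only: power_one_over times_divide_eq_right mult_1_right)
    qed
    finally show ?thesis .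
  qed
  have sm: "summable (\<lambda>k. \<integral>x. \<bar>E k x\<bar> \<partial>lborel)"
    by (rule summable_comparison_test[where g="\<lambda>k. sqrt B * (1/2) ^ k"]) (use E_le in \<open>auto intro!: summable_mult summable_geometric\<close>)
  have ae: "AE x in lborel. summable (\<lambda>k. \<bar>E k x\<bar>)"
    by (rule AE_summable_L1[OF int_E sm])
  define G where "G x = dslope u 0 x + (\<Sum>k. E k x)" for x
  have int_S: "integrable lborel (\<lambda>x. \<Sum>k. E k x)"
    by (rule integrable_suminf) (use int_E ae sm in auto)
  have int_G: "integrable lborel G"
    unfolding G_def[abs_def] using int_S dslope_integrable by auto
  have lim: "(\<lambda>n. \<integral>t. indicator {0..<x} t * dslope u (r n) t \<partial>lborel) \<longlonglongrightarrow> (\<integral>t. indicator {0..<x} t * G t \<partial>lborel)" for x :: real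
  proof -
    have i: "integrable lborel (\<lambda>t. indicator {0..<x} t * F t)" if "integrable lborel F" for F :: "real \<Rightarrow> real"
      using integrable_mult_indicator[OF _ that, of "{0..<x}"] by simp
    have b: "(\<integral>t. norm (indicator {0..<x} t * E k t) \<partial>lborel) \<le> (\<integral>t. \<bar>E k t\<bar> \<partial>lborel)" for k
      by (intro integral_mono integrable_norm i int_E integrable_abs) (auto simp: indicator_def)
    have s: "(\<lambda>k. \<integral>t. indicator {0..<x} t * E k t \<partial>lborel) sums (\<integral>t. (\<Sum>k. indicator {0..<x} t * E k t) \<partial>lborel)"
    proof (rule sums_integral)
      show "AE t in lborel. summable (\<lambda>k. norm (indicator {0..<x} t * E k t))"
        using ae by eventually_elim (auto simp: indicator_def abs_mult)
      show "summable (\<lambda>k. \<integral>t. norm (indicator {0..<x} t * E k t) \<partial>lborel)"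
        by (rule summable_comparison_test[OF _ sm]) (use b in auto)
    qed (intro i int_E)
    have "(\<integral>t. (\<Sum>k. indicator {0..<x} t * E k t) \<partial>lborel) = (\<integral>t. indicator {0..<x} t * (\<Sum>k. E k t) \<partial>lborel)"
      by (intro Bochner_Integration.integral_cong refl) (auto simp: indicator_def)
    also have "\<dots> = (\<integral>t. indicator {0..<x} t * G t - indicator {0..<x} t * dslope u 0 t \<partial>lborel)"
      by (simp add: G_def algebra_simps)
    also have "\<dots> = (\<integral>t. indicator {0..<x} t * G t \<partial>lborel) - (\<integral>t. indicator {0..<x} t * dslope u 0 t \<partial>lborel)"
      by (intro Bochner_Integration.integral_diff i int_G dslope_integrable)
    finally have eq: "(\<integral>t. (\<Sum>k. indicator {0..<x} t * E k t) \<partial>lborel) = \<dots>" .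
    have "(\<Sum>k<n. \<integral>t. indicator {0..<x} t * E k t \<partial>lborel) = (\<integral>t. indicator {0..<x} t * dslope u (r n) t \<partial>lborel) - (\<integral>t. indicator {0..<x} t * dslope u 0 t \<partial>lborel)" for n
    proof (induction n)
      case (Suc n)
      have "(\<integral>t. indicator {0..<x} t * E n t \<partial>lborel) = (\<integral>t. indicator {0..<x} t * dslope u (r (Suc n)) t - indicator {0..<x} t * dslope u (r n) t \<partial>lborel)"
        by (simp add: E_def right_diff_distrib)
      also have "\<dots> = (\<integral>t. indicator {0..<x} t * dslope u (r (Suc n)) t \<partial>lborel) - (\<integral>t. indicator {0..<x} t * dslope u (r n) t \<partial>lborel)"
        by (intro Bochner_Integration.integral_diff i dslope_integrable)
      finally show ?case using Suc by simp
    qed (simp add: r0)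
    then have "(\<lambda>n. (\<integral>t. indicator {0..<x} t * dslope u (r n) t \<partial>lborel) - (\<integral>t. indicator {0..<x} t * dslope u 0 t \<partial>lborel)) \<longlonglongrightarrow>
       (\<integral>t. indicator {0..<x} t * G t \<partial>lborel) - (\<integral>t. indicator {0..<x} t * dslope u 0 t \<partial>lborel)"
      using s unfolding sums_def eq by simp
    from tendsto_add[OF this tendsto_const, of "\<integral>t. indicator {0..<x} t * dslope u 0 t \<partial>lborel"]
    show ?thesis by simp
  qed
  have dyadic: "(\<integral>t. indicator {0..<real i / 2 ^ n} t * G t \<partial>lborel) = u (real i / 2 ^ n) - u 0" if "i \<le> 2 ^ n" for i n
  proof (rule LIMSEQ_unique[OF lim tendsto_eventually])
    show "\<forall>\<^sub>F m in sequentially. (\<integral>t. indicator {0..<real i / 2 ^ n} t * dslope u (r m) t \<partial>lborel) = u (real i / 2 ^ n) - u 0"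
      using eventually_ge_at_top[of n]
    proof eventually_elim
      fix m assume "n \<le> m"
      then have "n \<le> r m" using rk[of m] by linarith
      then show "(\<integral>t. indicator {0..<real i / 2 ^ n} t * dslope u (r m) t \<partial>lborel) = u (real i / 2 ^ n) - u 0"
        using integral_dslope_dyadic that by blast
    qed
  qed
  show ?thesis
  proof (rule that[OF int_G])
    fix x :: real assume x: "x \<in> {0..1}"
    \<comment> \<open>Dyadic approximation from below: \<open>u\<close> is continuous and so is the
      integral of G in its end point, so the identity extends from dyadic points to all x.\<close>
    define X where "X n = real (nat \<lfloor>2 ^ n * x\<rfloor>) / 2 ^ n" for n :: nat
    have Xb: "X n \<le> x" "x < X n + 1 / 2 ^ n" for n
    proof -
      have "real (nat \<lfloor>2 ^ n * x\<rfloor>) = of_int \<lfloor>2 ^ n * x\<rfloor>" using x by simp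
      then have "real (nat \<lfloor>2 ^ n * x\<rfloor>) \<le> 2 ^ n * x" "2 ^ n * x < real (nat \<lfloor>2 ^ n * x\<rfloor>) + 1" by linarith+
      then show "X n \<le> x" "x < X n + 1 / 2 ^ n" by (auto simp: X_def field_simps)
    qed
    have nX: "nat \<lfloor>2 ^ n * x\<rfloor> \<le> 2 ^ n" for n
    proof -
      have "2 ^ n * x \<le> 2 ^ n" using x by simp
      then have "\<lfloor>2 ^ n * x\<rfloor> \<le> 2 ^ n" by (metis floor_mono floor_of_int of_int_numeral of_int_power)
      then show ?thesis by (simp add: nat_le_iff)
    qed
    have X01: "X n \<in> {0..1}" for n
    proof -
      have "0 \<le> X n" by (simp add: X_def)
      then show ?thesis using Xb(1)[of n] x unfolding atLeastAtMost_iff by linarith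
    qed
    have "(\<lambda>n. x - (1/2) ^ n) \<longlonglongrightarrow> x - 0"
      by (intro tendsto_intros LIMSEQ_power_zero) auto
    then have X: "X \<longlonglongrightarrow> x"
      by (intro tendsto_sandwich[of "\<lambda>n. x - (1/2) ^ n" X _ "\<lambda>n. x"])
         (use Xb in \<open>auto simp: power_one_over intro!: always_eventually less_imp_le\<close>, smt (verit))
    have "(\<lambda>n. u (X n) - u 0) \<longlonglongrightarrow> u x - u 0"
      by (intro tendsto_intros continuous_on_tendsto_compose[OF u X x]) (use X01 in auto)
    moreover have "(\<lambda>n. \<integral>t. indicator {0..<X n} t * G t \<partial>lborel) \<longlonglongrightarrow> (\<integral>t. indicator {0..<x} t * G t \<partial>lborel)"
      by (rule integral_indicator_LIMSEQ[OF int_G X])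
    moreover have "(\<integral>t. indicator {0..<X n} t * G t \<partial>lborel) = u (X n) - u 0" for n
      unfolding X_def by (rule dyadic[OF nX])
    ultimately show "(\<integral>t. indicator {0..<x} t * G t \<partial>lborel) = u x - u 0"
      using LIMSEQ_unique by simp
  next
    \<comment> \<open>The constant is 3 = 1 + 2: the slope at level 0 contributes one
      \<open>sqrt B\<close>, the geometric series with ratio 1/2 contributes two.\<close>
    have "(\<integral>t. \<bar>G t\<bar> \<partial>lborel) \<le> (\<integral>t. \<bar>dslope u 0 t\<bar> + \<bar>\<Sum>k. E k t\<bar> \<partial>lborel)"
      using int_G int_S dslope_integrable by (intro integral_mono) (auto simp: G_def)
    also have "\<dots> = (\<integral>t. \<bar>dslope u 0 t\<bar> \<partial>lborel) + (\<integral>t. \<bar>\<Sum>k. E k t\<bar> \<partial>lborel)"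
      using int_S dslope_integrable by simp
    also have "(\<integral>t. \<bar>dslope u 0 t\<bar> \<partial>lborel) \<le> sqrt B"
    proof -
      have "\<bar>dslope u 0 t\<bar> = \<bar>dinc u 0 0\<bar> * indicator {0..<1} t" for t
        using didx_less[of t 0] by (auto simp: dslope_def indicator_def)
      then have "(\<integral>t. \<bar>dslope u 0 t\<bar> \<partial>lborel) = \<bar>dinc u 0 0\<bar>" by simp
      also have "\<dots> = sqrt (dvar u 0)" by (simp add: dvar_def)
      finally show ?thesis using V[of 0] by simp
    qed
    also have "(\<integral>t. \<bar>\<Sum>k. E k t\<bar> \<partial>lborel) \<le> (\<integral>t. (\<Sum>k. \<bar>E k t\<bar>) \<partial>lborel)"
    proof (rule integral_mono_AE)
      show "integrable lborel (\<lambda>t. \<bar>\<Sum>k. E k t\<bar>)" using int_S by auto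
      show "integrable lborel (\<lambda>t. \<Sum>k. \<bar>E k t\<bar>)"
        by (rule integrable_suminf) (use int_E ae sm in auto)
      show "AE t in lborel. \<bar>\<Sum>k. E k t\<bar> \<le> (\<Sum>k. \<bar>E k t\<bar>)"
        using ae by eventually_elim (rule summable_rabs)
    qed
    also have "(\<integral>t. (\<Sum>k. \<bar>E k t\<bar>) \<partial>lborel) = (\<Sum>k. \<integral>t. \<bar>E k t\<bar> \<partial>lborel)"
      by (rule integral_suminf) (use int_E ae sm in auto)
    also have "\<dots> \<le> (\<Sum>k. sqrt B * (1/2) ^ k)"
      using E_le sm by (intro suminf_le summable_mult summable_geometric) auto
    also have "\<dots> = sqrt B * 2" by (subst suminf_mult) (auto simp: suminf_geometric)
    finally show "(\<integral>t. \<bar>G t\<bar> \<partial>lborel) \<le> 3 * sqrt B" by simp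
  qed
qed

text \<open>For \<open>u x = q (A + r * x)\<close> this is 1 / r times the total growth of
  \<open>dvar u\<close> over all levels, by \<open>dvar_Suc\<close>. The factor 1 / r makes it
  comparable with a double integral in position and scale.\<close>

definition grid_energy :: "(real \<Rightarrow> real) \<Rightarrow> real \<Rightarrow> real \<Rightarrow> ennreal" where
  "grid_energy q A r = (\<Sum>n. \<Sum>j<2 ^ n. ennreal (2 ^ n / r * (d2 q (r / 2 ^ Suc n) (A + real j * r / 2 ^ n))^2))"

text \<open>Rescaling to the unit interval turns the squared increment over the whole interval into
  \<open>dvar u 0\<close> and \<open>r * S\<close> into a bound for all later growth. The L^1 norm
  of the derivative is invariant under the rescaling.\<close>

lemma grid_energy_imp_primitive:
  assumes q: "continuous_on {A..A + r} q" and r: "0 < r"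
    and E: "grid_energy q A r \<le> ennreal S" and S: "0 < S"
  obtains G where "integrable lborel G" "\<And>x. x \<in> {A..A + r} \<Longrightarrow> (\<integral>t. indicator {A..<x} t * G t \<partial>lborel) = q x - q A"
    "(\<integral>t. \<bar>G t\<bar> \<partial>lborel) \<le> 3 * sqrt ((q (A + r) - q A)^2 + r * S)"
proof -
  define u where "u x = q (A + r * x)" for x
  have cu: "continuous_on {0..1} u"
    unfolding u_def by (intro continuous_on_compose2[OF q] continuous_intros) (use r in \<open>auto simp: mult_left_le\<close>)
  define B where "B = (q (A + r) - q A)^2 + r * S"
  have B: "0 < B" using r S by (auto simp: B_def intro!: add_nonneg_pos)
  have d2_u: "d2 u (1 / 2 ^ Suc n) (real j / 2 ^ n) = d2 q (r / 2 ^ Suc n) (A + real j * r / 2 ^ n)" for n j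
    unfolding d2_def u_def by (simp add: algebra_simps)
  define s where "s n = 2 ^ n * (\<Sum>j<2 ^ n. (d2 u (1 / 2 ^ Suc n) (real j / 2 ^ n))^2)" for n
  have s0: "0 \<le> s n" for n by (simp add: s_def sum_nonneg)
  have V: "dvar u n = dvar u 0 + (\<Sum>m<n. s m)" for n
    by (induction n) (simp_all add: dvar_Suc s_def)
  have V0: "dvar u 0 = (q (A + r) - q A)^2"
    by (simp add: dvar_def dinc_def u_def)
  have sum_le: "(\<Sum>m<n. s m) \<le> r * S" for n
  proof -
    have eq: "ennreal (s m / r) = (\<Sum>j<2 ^ m. ennreal (2 ^ m / r * (d2 q (r / 2 ^ Suc m) (A + real j * r / 2 ^ m))^2))" for m
      using r by (simp only: s_def d2_u, simp add: sum_ennreal sum_distrib_left sum_divide_distrib)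
    have "ennreal (\<Sum>m<n. s m / r) = (\<Sum>m<n. ennreal (s m / r))"
      using s0 r by (intro sum_ennreal[symmetric]) auto
    also have "\<dots> \<le> (\<Sum>m. ennreal (s m / r))"
      by (rule sum_le_suminf) auto
    also have "\<dots> = grid_energy q A r" by (simp only: grid_energy_def eq)
    also have "\<dots> \<le> ennreal S" by (rule E)
    finally have "ennreal (\<Sum>m<n. s m / r) \<le> ennreal S" .
    then have "(\<Sum>m<n. s m / r) \<le> S" using S by (simp add: ennreal_le_iff)
    then show ?thesis using r by (simp add: sum_divide_distrib[symmetric] field_simps)
  qed
  have "dvar u n \<le> B" for n using V[of n] V0 sum_le[of n] by (simp add: B_def)
  from dvar_bounded_imp_primitive[OF cu this B] obtain G where G: "integrable lborel G"
    "\<And>x. x \<in> {0..1} \<Longrightarrow> (\<integral>t. indicator {0..<x} t * G t \<partial>lborel) = u x - u 0" "(\<integral>t. \<bar>G t\<bar> \<partial>lborel) \<le> 3 * sqrt B"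
    by blast
  define H where "H y = G (-A / r + 1 / r * y) / r" for y
  have H: "H (A + r * t) = G t / r" for t
    using r by (simp add: H_def field_simps)
  show ?thesis
  proof (rule that[of H])
    show "integrable lborel H"
      unfolding H_def using lborel_integrable_real_affine[OF G(1), of "1/r" "-A/r"] r by simp
    fix x assume x: "x \<in> {A..A + r}"
    define z where "z = (x - A) / r"
    have z: "z \<in> {0..1}" "x = A + r * z" using x r by (auto simp: z_def field_simps)
    have "(\<integral>t. indicator {A..<x} t * H t \<partial>lborel) = r * (\<integral>t. indicator {A..<x} (A + r * t) * H (A + r * t) \<partial>lborel)"
      using r lborel_integral_real_affine[of r "\<lambda>t. indicator {A..<x} t * H t" A] by simp
    also have "\<dots> = (\<integral>t. r * (indicator {A..<x} (A + r * t) * (G t / r)) \<partial>lborel)" by (simp only: H integral_mult_right_zero)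
    also have "\<dots> = (\<integral>t. indicator {0..<z} t * G t \<partial>lborel)"
      using r by (intro Bochner_Integration.integral_cong refl) (auto simp: z(2) indicator_def zero_le_mult_iff)
    also have "\<dots> = q x - q A" using G(2)[OF z(1)] z(2) by (simp add: u_def)
    finally show "(\<integral>t. indicator {A..<x} t * H t \<partial>lborel) = q x - q A" .
  next
    have "(\<integral>t. \<bar>H t\<bar> \<partial>lborel) = r * (\<integral>t. \<bar>H (A + r * t)\<bar> \<partial>lborel)"
      using r lborel_integral_real_affine[of r "\<lambda>t. \<bar>H t\<bar>" A] by simp
    also have "\<dots> = (\<integral>t. \<bar>G t\<bar> \<partial>lborel)" using r by (simp add: H)
    finally show "(\<integral>t. \<bar>H t\<bar> \<partial>lborel) \<le> 3 * sqrt ((q (A + r) - q A)^2 + r * S)" using G(3) by (simp add: B_def)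
  qed
qed

text \<open>Averaging over the position and the mesh of the dyadic grid turns sums over grid points
  into integrals.\<close>

lemma exists_good_grid:
  assumes [measurable]: "q \<in> borel_measurable borel" and R: "0 < R" and E0: "0 < E0"
    and E: "(\<integral>\<^sup>+l. \<integral>\<^sup>+d. ennreal (indicator {x..x + 5/2 * R} l * indicator {0<..R} d * (d powr (-3) * (d2 q d l)^2)) \<partial>lborel \<partial>lborel) \<le> ennreal E0"
  shows "\<exists>r\<in>{R<..2*R}. \<exists>\<tau>\<in>{0..R/2}. grid_energy q (x + \<tau>) r \<le> ennreal (3 * E0)"
proof (rule ccontr)
  assume "\<not> ?thesis"
  \<comment> \<open>The set of admissible pairs (r, \<tau>) has area R^2 / 2, and the integral of
    \<open>grid_energy\<close> over it will be at most R^2 * E0. The mean is thus at most 2 * E0,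
    below the assumed lower bound 3 * E0.\<close>
  then have big: "ennreal (3 * E0) \<le> grid_energy q (x + \<tau>) r" if "r \<in> {R<..2*R}" "\<tau> \<in> {0..R/2}" for r \<tau>
    using that by (auto simp: not_le less_imp_le)
  define J where "J = {x..x + 5/2 * R}"
  have [measurable]: "J \<in> sets borel" by (simp add: J_def)
  define I1 where "I1 r = (indicator {R<..2*R} r :: ennreal)" for r :: real
  define I2 where "I2 t = (indicator {0..R/2} t :: ennreal)" for t :: real
  have [measurable]: "I1 \<in> borel_measurable borel" "I2 \<in> borel_measurable borel" unfolding I1_def[abs_def] I2_def[abs_def] by measurable
  define W where "W d = (\<integral>\<^sup>+l. ennreal (indicator J l * (d2 q d l)^2) \<partial>lborel)" for d
  have [measurable]: "W \<in> borel_measurable borel" unfolding W_def by measurable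
  \<comment> \<open>These are the ranges of the step d = r / 2 ^ Suc n as r runs over (R, 2 * R].
    They are disjoint and lie in (0, R], so the sum over levels n collapses into one integral over
    d.\<close>
  define A where "A n = {R / 2 ^ Suc n<..R / 2 ^ n}" for n :: nat
  let ?T = "\<lambda>n j r \<tau>. ennreal (2 ^ n / r * (d2 q (r / 2 ^ Suc n) (x + \<tau> + real j * r / 2 ^ n))^2)"
  \<comment> \<open>For fixed r, n and j the translation \<tau> carries the grid point through part
    of the window J, so each of the 2 ^ n points is charged at most the full window integral
    \<open>W\<close>.\<close>
  have Tj: "(\<integral>\<^sup>+r. \<integral>\<^sup>+\<tau>. I1 r * I2 \<tau> * ?T n j r \<tau> \<partial>lborel \<partial>lborel) \<le> (\<integral>\<^sup>+r. I1 r * (ennreal (2 ^ n / r) * W (r / 2 ^ Suc n)) \<partial>lborel)"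
    if j: "j < 2 ^ n" for n j
  proof (rule nn_integral_mono)
    fix r
    show "(\<integral>\<^sup>+\<tau>. I1 r * I2 \<tau> * ?T n j r \<tau> \<partial>lborel) \<le> I1 r * (ennreal (2 ^ n / r) * W (r / 2 ^ Suc n))"
    proof (cases "r \<in> {R<..2*R}")
      case True
      then have r: "0 < r" using R by auto
      have jr: "0 \<le> real j * r / 2 ^ n" "real j * r / 2 ^ n \<le> r"
      proof -
        have "real j \<le> 2 ^ n" using j by (metis less_imp_le of_nat_le_iff of_nat_numeral of_nat_power)
        then have "real j * r \<le> 2 ^ n * r" using r by (intro mult_right_mono) auto
        then show "real j * r / 2 ^ n \<le> r" by (simp add: field_simps)
      qed (use r in auto)
      have "(\<integral>\<^sup>+\<tau>. I1 r * I2 \<tau> * ?T n j r \<tau> \<partial>lborel) \<le> (\<integral>\<^sup>+\<tau>. ennreal (2 ^ n / r) * ennreal (indicator J ((x + real j * r / 2 ^ n) + 1 * \<tau>) * (d2 q (r / 2 ^ Suc n) ((x + real j * r / 2 ^ n) + 1 * \<tau>))^2) \<partial>lborel)"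
      proof (intro nn_integral_mono)
        fix \<tau> :: real
        show "I1 r * I2 \<tau> * ?T n j r \<tau> \<le> ennreal (2 ^ n / r) * ennreal (indicator J ((x + real j * r / 2 ^ n) + 1 * \<tau>) * (d2 q (r / 2 ^ Suc n) ((x + real j * r / 2 ^ n) + 1 * \<tau>))^2)"
        proof (cases "\<tau> \<in> {0..R/2}")
          case t: True
          have "x + real j * r / 2 ^ n + \<tau> \<in> J" using t jr True R unfolding J_def atLeastAtMost_iff greaterThanAtMost_iff by linarith
          then show ?thesis using t True r
            by (simp add: I1_def I2_def ennreal_mult'[symmetric] add_ac)
        qed (simp add: I2_def)
      qed
      also have "\<dots> = ennreal (2 ^ n / r) * (\<integral>\<^sup>+\<tau>. ennreal (indicator J ((x + real j * r / 2 ^ n) + 1 * \<tau>) * (d2 q (r / 2 ^ Suc n) ((x + real j * r / 2 ^ n) + 1 * \<tau>))^2) \<partial>lborel)"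
        by (rule nn_integral_cmult) measurable
      also have "(\<integral>\<^sup>+\<tau>. ennreal (indicator J ((x + real j * r / 2 ^ n) + 1 * \<tau>) * (d2 q (r / 2 ^ Suc n) ((x + real j * r / 2 ^ n) + 1 * \<tau>))^2) \<partial>lborel) = W (r / 2 ^ Suc n)"
        unfolding W_def by (subst nn_integral_real_affine[of _ 1 "x + real j * r / 2 ^ n"]) auto
      finally show ?thesis using True by (simp add: I1_def)
    qed (simp add: I1_def)
  qed
  have Tn: "(\<integral>\<^sup>+r. I1 r * (ennreal (2 ^ n * (2 ^ n / r)) * W (r / 2 ^ Suc n)) \<partial>lborel) \<le> (\<integral>\<^sup>+d. indicator (A n) d * (ennreal (R^2 * d powr (-3)) * W d) \<partial>lborel)" for n
  proof -
    have "(\<integral>\<^sup>+r. I1 r * (ennreal (2 ^ n * (2 ^ n / r)) * W (r / 2 ^ Suc n)) \<partial>lborel)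
       = ennreal \<bar>2 ^ Suc n\<bar> * (\<integral>\<^sup>+d. I1 (0 + 2 ^ Suc n * d) * (ennreal (2 ^ n * (2 ^ n / (0 + 2 ^ Suc n * d))) * W ((0 + 2 ^ Suc n * d) / 2 ^ Suc n)) \<partial>lborel)"
      by (rule nn_integral_real_affine) auto
    also have "\<dots> = (\<integral>\<^sup>+d. ennreal \<bar>2 ^ Suc n\<bar> * (I1 (0 + 2 ^ Suc n * d) * (ennreal (2 ^ n * (2 ^ n / (0 + 2 ^ Suc n * d))) * W ((0 + 2 ^ Suc n * d) / 2 ^ Suc n))) \<partial>lborel)"
      by (rule nn_integral_cmult[symmetric]) measurable
    also have "\<dots> \<le> (\<integral>\<^sup>+d. indicator (A n) d * (ennreal (R^2 * d powr (-3)) * W d) \<partial>lborel)"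
    proof (intro nn_integral_mono)
      fix d :: real
      show "ennreal \<bar>2 ^ Suc n\<bar> * (I1 (0 + 2 ^ Suc n * d) * (ennreal (2 ^ n * (2 ^ n / (0 + 2 ^ Suc n * d))) * W ((0 + 2 ^ Suc n * d) / 2 ^ Suc n)))
        \<le> indicator (A n) d * (ennreal (R^2 * d powr (-3)) * W d)"
      proof (cases "2 ^ Suc n * d \<in> {R<..2*R}")
        case True
        then have dA: "d \<in> A n" by (auto simp: A_def field_simps)
        have "0 < R / 2 ^ Suc n" using R by simp
        also have "\<dots> < d" using dA by (auto simp: A_def)
        finally have d: "0 < d" .
        have n: "2 ^ n * d \<le> R" using True by simp
        \<comment> \<open>The density left after substituting is 4^n / d: two factors 2 ^ n come
          from the number of grid points and the weight, while the Jacobian cancels the remaining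
          one. Since 2 ^ n * d \<le> R, it is at most R^2 / d^3, which produces the exponent
          -3.\<close>
        have "(2 ^ n * d)^2 \<le> R^2" using n d by (intro power_mono) auto
        then have "(2 ^ n)^2 * d^2 \<le> R^2" by (simp add: power_mult_distrib)
        then have "(2 ^ n)^2 / d \<le> R^2 / d^3"
          using d by (simp add: field_simps power2_eq_square power3_eq_cube)
        also have "R^2 / d^3 = R^2 * d powr (-3)"
          using d by (simp add: powr_minus divide_inverse flip: powr_numeral)
        finally have le: "2 ^ n * 2 ^ n / d \<le> R^2 * d powr (-3)" by (simp add: power2_eq_square)
        have "ennreal \<bar>2 ^ Suc n\<bar> * ennreal (2 ^ n * (2 ^ n / (2 ^ Suc n * d))) = ennreal (2 ^ n * 2 ^ n / d)"
          using d by (simp add: ennreal_mult'[symmetric])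
        also have "\<dots> \<le> ennreal (R^2 * d powr (-3))" using le by (rule ennreal_leI)
        finally have "ennreal \<bar>2 ^ Suc n\<bar> * ennreal (2 ^ n * (2 ^ n / (2 ^ Suc n * d))) * W d \<le> ennreal (R^2 * d powr (-3)) * W d"
          by (rule mult_right_mono) simp
        then show ?thesis using True dA by (simp add: I1_def mult.assoc)
      qed (simp add: I1_def)
    qed
    finally show ?thesis .
  qed
  have disj: "disjoint_family A"
    unfolding disjoint_family_on_def
  proof (intro ballI impI)
    have *: "A m \<inter> A n = {}" if "m < n" for m n
    proof -
      have "R / 2 ^ n \<le> R / 2 ^ Suc m"
        using that R by (intro divide_left_mono power_increasing) auto
      then show ?thesis by (auto simp: A_def)
    qed
    fix m n :: nat assume "m \<noteq> n"
    then show "A m \<inter> A n = {}" using *[of m n] *[of n m] by (cases "m < n") auto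
  qed
  have UA: "(\<Union>n. A n) \<subseteq> {0<..R}"
  proof -
    have "A n \<subseteq> {0<..R}" for n
    proof -
      have "0 < R / 2 ^ Suc n" "R / 2 ^ n \<le> R" using R by (auto simp: field_simps)
      then show ?thesis by (auto simp: A_def)
    qed
    then show ?thesis by blast
  qed
  have [measurable]: "A n \<in> sets borel" for n by (simp add: A_def)
  have "(\<integral>\<^sup>+r. \<integral>\<^sup>+\<tau>. I1 r * I2 \<tau> * ennreal (3 * E0) \<partial>lborel \<partial>lborel) \<le> (\<integral>\<^sup>+r. \<integral>\<^sup>+\<tau>. I1 r * I2 \<tau> * grid_energy q (x + \<tau>) r \<partial>lborel \<partial>lborel)"
    using big by (intro nn_integral_mono) (auto simp: I1_def I2_def indicator_def)
  also have "\<dots> = (\<integral>\<^sup>+r. \<integral>\<^sup>+\<tau>. (\<Sum>n. \<Sum>j<2 ^ n. I1 r * I2 \<tau> * ?T n j r \<tau>) \<partial>lborel \<partial>lborel)"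
    by (simp add: grid_energy_def sum_distrib_left[symmetric])
  also have "\<dots> = (\<Sum>n. \<Sum>j<2 ^ n. \<integral>\<^sup>+r. \<integral>\<^sup>+\<tau>. I1 r * I2 \<tau> * ?T n j r \<tau> \<partial>lborel \<partial>lborel)"
    by (simp add: nn_integral_suminf nn_integral_sum)
  also have "\<dots> \<le> (\<Sum>n. \<Sum>j<(2::nat) ^ n. \<integral>\<^sup>+r. I1 r * (ennreal (2 ^ n / r) * W (r / 2 ^ Suc n)) \<partial>lborel)"
    by (intro suminf_le sum_mono Tj) auto
  also have "\<dots> = (\<Sum>n. \<integral>\<^sup>+r. I1 r * (ennreal (2 ^ n * (2 ^ n / r)) * W (r / 2 ^ Suc n)) \<partial>lborel)"
  proof (intro arg_cong[where f=suminf] ext)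
    fix n :: nat
    have "(\<Sum>j<(2::nat) ^ n. \<integral>\<^sup>+r. I1 r * (ennreal (2 ^ n / r) * W (r / 2 ^ Suc n)) \<partial>lborel) = ennreal (2 ^ n) * (\<integral>\<^sup>+r. I1 r * (ennreal (2 ^ n / r) * W (r / 2 ^ Suc n)) \<partial>lborel)"
      by (simp add: ennreal_of_nat_eq_real_of_nat)
    also have "\<dots> = (\<integral>\<^sup>+r. ennreal (2 ^ n) * (I1 r * (ennreal (2 ^ n / r) * W (r / 2 ^ Suc n))) \<partial>lborel)"
      by (rule nn_integral_cmult[symmetric]) measurable
    also have "\<dots> = (\<integral>\<^sup>+r. I1 r * (ennreal (2 ^ n * (2 ^ n / r)) * W (r / 2 ^ Suc n)) \<partial>lborel)"
      by (intro nn_integral_cong) (simp only: ennreal_mult' zero_le_power zero_le_numeral mult_ac)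
    finally show "(\<Sum>j<(2::nat) ^ n. \<integral>\<^sup>+r. I1 r * (ennreal (2 ^ n / r) * W (r / 2 ^ Suc n)) \<partial>lborel) = \<dots>" .
  qed
  also have "\<dots> \<le> (\<Sum>n. \<integral>\<^sup>+d. indicator (A n) d * (ennreal (R^2 * d powr (-3)) * W d) \<partial>lborel)"
    by (intro suminf_le Tn) auto
  also have "\<dots> = (\<integral>\<^sup>+d. (\<Sum>n. indicator (A n) d * (ennreal (R^2 * d powr (-3)) * W d)) \<partial>lborel)"
    by (rule nn_integral_suminf[symmetric]) measurable
  also have "\<dots> \<le> (\<integral>\<^sup>+d. ennreal (R^2) * (ennreal (indicator {0<..R} d * d powr (-3)) * W d) \<partial>lborel)"
  proof (intro nn_integral_mono)
    fix d :: real
    have "(\<Sum>n. indicator (A n) d * (ennreal (R^2 * d powr (-3)) * W d)) = indicator (\<Union>n. A n) d * (ennreal (R^2 * d powr (-3)) * W d)"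
      using suminf_indicator[OF disj, of d] by (subst ennreal_suminf_multc) simp
    also have "\<dots> \<le> indicator {0<..R} d * (ennreal (R^2 * d powr (-3)) * W d)"
      by (rule mult_right_mono[OF indicator_leI]) (use UA in blast, simp)
    also have "\<dots> = ennreal (R^2) * (ennreal (indicator {0<..R} d * d powr (-3)) * W d)"
      by (auto simp: indicator_def ennreal_mult mult.assoc)
    finally show "(\<Sum>n. indicator (A n) d * (ennreal (R^2 * d powr (-3)) * W d)) \<le> ennreal (R^2) * (ennreal (indicator {0<..R} d * d powr (-3)) * W d)" .
  qed
  also have "\<dots> = ennreal (R^2) * (\<integral>\<^sup>+d. ennreal (indicator {0<..R} d * d powr (-3)) * W d \<partial>lborel)"
    by (rule nn_integral_cmult) measurable
  also have "(\<integral>\<^sup>+d. ennreal (indicator {0<..R} d * d powr (-3)) * W d \<partial>lborel) = (\<integral>\<^sup>+d. \<integral>\<^sup>+l. ennreal (indicator J l * indicator {0<..R} d * (d powr (-3) * (d2 q d l)^2)) \<partial>lborel \<partial>lborel)"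
  proof (intro nn_integral_cong)
    fix d :: real
    have "ennreal (indicator {0<..R} d * d powr (-3)) * W d = (\<integral>\<^sup>+l. ennreal (indicator {0<..R} d * d powr (-3)) * ennreal (indicator J l * (d2 q d l)^2) \<partial>lborel)"
      unfolding W_def by (rule nn_integral_cmult[symmetric]) measurable
    also have "\<dots> = (\<integral>\<^sup>+l. ennreal (indicator J l * indicator {0<..R} d * (d powr (-3) * (d2 q d l)^2)) \<partial>lborel)"
      by (intro nn_integral_cong) (simp add: ennreal_mult'[symmetric] mult_ac)
    finally show "ennreal (indicator {0<..R} d * d powr (-3)) * W d = \<dots>" .
  qed
  also have "\<dots> = (\<integral>\<^sup>+l. \<integral>\<^sup>+d. ennreal (indicator J l * indicator {0<..R} d * (d powr (-3) * (d2 q d l)^2)) \<partial>lborel \<partial>lborel)"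
    by (rule lborel_pair.Fubini') measurable
  also have "\<dots> \<le> ennreal E0" using E by (simp add: J_def)
  finally have "(\<integral>\<^sup>+r. \<integral>\<^sup>+\<tau>. I1 r * I2 \<tau> * ennreal (3 * E0) \<partial>lborel \<partial>lborel) \<le> ennreal (R^2) * ennreal E0"
    by (simp add: mult_left_mono)
  moreover have "(\<integral>\<^sup>+r. \<integral>\<^sup>+\<tau>. I1 r * I2 \<tau> * ennreal (3 * E0) \<partial>lborel \<partial>lborel) = ennreal (R * (R/2) * (3 * E0))"
  proof -
    have "(\<integral>\<^sup>+\<tau>. I1 r * I2 \<tau> * ennreal (3 * E0) \<partial>lborel) = I1 r * (ennreal (R/2) * ennreal (3 * E0))" for r
    proof -
      have "(\<integral>\<^sup>+\<tau>. I1 r * I2 \<tau> * ennreal (3 * E0) \<partial>lborel) = (\<integral>\<^sup>+\<tau>. (I1 r * ennreal (3 * E0)) * indicator {0..R/2} \<tau> \<partial>lborel)"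
        by (simp add: I2_def mult_ac)
      also have "\<dots> = (I1 r * ennreal (3 * E0)) * ennreal (R/2)"
        using R by (subst nn_integral_cmult_indicator) (auto simp: emeasure_lborel_Icc_eq)
      finally show ?thesis by (simp add: mult_ac)
    qed
    then have "(\<integral>\<^sup>+r. \<integral>\<^sup>+\<tau>. I1 r * I2 \<tau> * ennreal (3 * E0) \<partial>lborel \<partial>lborel) = (\<integral>\<^sup>+r. (ennreal (R/2) * ennreal (3 * E0)) * indicator {R<..2*R} r \<partial>lborel)"
      by (simp add: I1_def mult_ac)
    also have "\<dots> = (ennreal (R/2) * ennreal (3 * E0)) * ennreal R"
      using R by (subst nn_integral_cmult_indicator) auto
    also have "\<dots> = ennreal (R * (R/2) * (3 * E0))"
      using R E0 by (simp add: ennreal_mult'[symmetric] mult_ac)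
    finally show ?thesis .
  qed
  ultimately have "ennreal (R * (R/2) * (3 * E0)) \<le> ennreal (R^2 * E0)"
    by (simp add: ennreal_mult')
  then have "R * (R/2) * (3 * E0) \<le> R^2 * E0"
    using R E0 by (subst (asm) ennreal_le_iff) auto
  moreover have "0 < R^2 * E0" using R E0 by simp
  ultimately show False by (simp add: power2_eq_square mult_ac)
qed

lemma Holder_imp_continuous_on:
  fixes q :: "real \<Rightarrow> real"
  assumes H: "\<And>x h. \<lbrakk>c \<le> x; 0 \<le> h\<rbrakk> \<Longrightarrow> \<bar>q (x + h) - q x\<bar> \<le> C * h powr \<beta>" and \<beta>: "0 < \<beta>"
  shows "continuous_on {c..} q"
  unfolding continuous_on_def
proof
  fix x assume x: "x \<in> {c..}"
  have b: "\<bar>q y - q x\<bar> \<le> C * \<bar>y - x\<bar> powr \<beta>" if "y \<in> {c..}" for y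
    using H[of x "y - x"] H[of y "x - y"] x that by (cases "x \<le> y") (auto simp: abs_minus_commute)
  have "((\<lambda>y. C * \<bar>y - x\<bar> powr \<beta>) \<longlongrightarrow> C * \<bar>x - x\<bar> powr \<beta>) (at x within {c..})"
    using \<beta> by (intro tendsto_intros tendsto_powr') auto
  then have "((\<lambda>y. C * \<bar>y - x\<bar> powr \<beta>) \<longlongrightarrow> 0) (at x within {c..})" using \<beta> by simp
  then have "((\<lambda>y. q y - q x) \<longlongrightarrow> 0) (at x within {c..})"
    by (rule Lim_null_comparison[rotated]) (auto simp: eventually_at_filter b)
  then show "(q \<longlongrightarrow> q x) (at x within {c..})" by (rule LIM_zero_cancel)
qed

section \<open>Integrable derivatives of right fractional integrals\<close>

context bounded_left_support
begin

text \<open>The Hoelder exponent (1 - s) / 2 balances two contributions to the squared bound: the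
  squared increment over the grid, of order 2 * (s + (1 - s) / 2) = 1 + s in R, and length times
  energy, R * R^s. The square root gives the exponent (1 + s) / 2.\<close>

lemma RI_local_primitive:
  assumes s: "0 < s" "s < 1" and H: "\<And>x t. \<lbrakk>c \<le> x; 0 \<le> t\<rbrakk> \<Longrightarrow> \<bar>p (x + t) - p x\<bar> \<le> H * t powr ((1 - s) / 2)"
    and E: "\<And>R. \<lbrakk>0 < R; R \<le> T\<rbrakk> \<Longrightarrow>
      (\<integral>\<^sup>+l. \<integral>\<^sup>+t. ennreal (indicator {c..c + 5/2 * R} l * (indicator {0<..} t * sqinc p (1 - s) l t)) \<partial>lborel \<partial>lborel)
        \<le> ennreal (E * R powr s)" and E0: "0 \<le> E"
  obtains D where "0 < D" "\<And>R. \<lbrakk>0 < R; R \<le> T\<rbrakk> \<Longrightarrow> \<exists>G. integrable lborel G \<and>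
      (\<forall>x y. c + R / 2 \<le> x \<longrightarrow> x \<le> y \<longrightarrow> y \<le> c + R \<longrightarrow> (\<integral>t. indicator {x..<y} t * G t \<partial>lborel) = RI s p y - RI s p x) \<and>
      (\<integral>t. \<bar>G t\<bar> \<partial>lborel) \<le> D * R powr ((1 + s) / 2)"
proof -
  define K where "K = H * (\<integral>t. (1 + \<bar>t\<bar>) powr ((1 - s) / 2) * \<bar>rdiff s t\<bar> \<partial>lborel)"
  have RH: "\<bar>RI s p (x + h) - RI s p x\<bar> \<le> K * h powr ((1 + s) / 2)" if "c \<le> x" "0 \<le> h" for x h
  proof -
    have e: "s + (1 - s) / 2 = (1 + s) / 2" by (simp add: field_simps)
    have \<delta>: "0 \<le> (1 - s) / 2" "s + (1 - s) / 2 < 1" using s by (simp_all add: e)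
    show ?thesis
      using RI_Holder[OF s \<delta> H[OF that(1)] that(2)] unfolding K_def e by simp
  qed
  have cont: "continuous_on {c..} (RI s p)"
    by (rule Holder_imp_continuous_on[OF RH]) (use s in auto)
  \<comment> \<open>The summand 1 makes the bound strictly positive, as
    \<open>exists_good_grid\<close> and \<open>grid_energy_imp_primitive\<close> require.\<close>
  define E1 where "E1 = rdiff2_const s * E + 1"
  have E1: "0 < E1" using rdiff2_const_nonneg[of s] E0 by (simp add: E1_def add_nonneg_pos)
  define D2 where "D2 = K^2 * 2 powr (1 + s) + 6 * E1"
  have D2: "0 < D2" using E1 by (simp add: D2_def add_nonneg_pos)
  show ?thesis
  proof (rule that[of "3 * sqrt D2"])
    show "0 < 3 * sqrt D2" using D2 by simp
    fix R assume R: "0 < R" "R \<le> T"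
    define J where "J = {c..c + 5/2 * R}"
    have [measurable]: "J \<in> sets borel" by (simp add: J_def)
    have "(\<integral>\<^sup>+l. \<integral>\<^sup>+d. ennreal (indicator J l * indicator {0<..R} d * (d powr (-3) * (d2 (RI s p) d l)^2)) \<partial>lborel \<partial>lborel)
      \<le> (\<integral>\<^sup>+l. ennreal (rdiff2_const s) * (\<integral>\<^sup>+t. ennreal (indicator J l * (indicator {0<..} t * sqinc p (1 - s) l t)) \<partial>lborel) \<partial>lborel)"
    proof (intro nn_integral_mono)
      fix l :: real
      show "(\<integral>\<^sup>+d. ennreal (indicator J l * indicator {0<..R} d * (d powr (-3) * (d2 (RI s p) d l)^2)) \<partial>lborel) \<le> ennreal (rdiff2_const s) * (\<integral>\<^sup>+t. ennreal (indicator J l * (indicator {0<..} t * sqinc p (1 - s) l t)) \<partial>lborel)"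
      proof (cases "l \<in> J")
        case True
        have "(\<integral>\<^sup>+d. ennreal (indicator J l * indicator {0<..R} d * (d powr (-3) * (d2 (RI s p) d l)^2)) \<partial>lborel) \<le> (\<integral>\<^sup>+d. ennreal (indicator {0<..} d * d powr (-3) * (d2 (RI s p) d l)^2) \<partial>lborel)"
          by (intro nn_integral_mono ennreal_leI) (auto simp: indicator_def)
        also have "\<dots> \<le> ennreal (rdiff2_const s) * (\<integral>\<^sup>+t. ennreal (indicator {0<..} t * sqinc p (1 - s) l t) \<partial>lborel)"
          by (rule d2_energy_le[OF s])
        finally show ?thesis using True by simp
      qed simp
    qed
    also have "\<dots> = ennreal (rdiff2_const s) * (\<integral>\<^sup>+l. \<integral>\<^sup>+t. ennreal (indicator J l * (indicator {0<..} t * sqinc p (1 - s) l t)) \<partial>lborel \<partial>lborel)"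
      by (rule nn_integral_cmult) measurable
    also have "\<dots> \<le> ennreal (rdiff2_const s) * ennreal (E * R powr s)"
      using E[OF R] unfolding J_def by (intro mult_left_mono) auto
    also have "\<dots> = ennreal (rdiff2_const s * E * R powr s)"
      using rdiff2_const_nonneg by (simp add: ennreal_mult'[symmetric] mult.assoc)
    also have "\<dots> \<le> ennreal (E1 * R powr s)"
      by (intro ennreal_leI mult_right_mono) (auto simp: E1_def)
    finally have "(\<integral>\<^sup>+l. \<integral>\<^sup>+d. ennreal (indicator {c..c + 5/2 * R} l * indicator {0<..R} d * (d powr (-3) * (d2 (RI s p) d l)^2)) \<partial>lborel \<partial>lborel) \<le> ennreal (E1 * R powr s)"
      by (simp only: J_def)
    from exists_good_grid[OF _ R(1) _ this] obtain r \<tau> where r: "R < r" "r \<le> 2 * R" and \<tau>: "0 \<le> \<tau>" "\<tau> \<le> R / 2"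
      and g: "grid_energy (RI s p) (c + \<tau>) r \<le> ennreal (3 * (E1 * R powr s))"
      using E1 R by auto
    define A where "A = c + \<tau>"
    have "continuous_on {A..A + r} (RI s p)"
      by (rule continuous_on_subset[OF cont]) (use \<tau> in \<open>auto simp: A_def\<close>)
    then obtain G where G: "integrable lborel G"
      "\<And>x. x \<in> {A..A + r} \<Longrightarrow> (\<integral>t. indicator {A..<x} t * G t \<partial>lborel) = RI s p x - RI s p A"
      "(\<integral>t. \<bar>G t\<bar> \<partial>lborel) \<le> 3 * sqrt ((RI s p (A + r) - RI s p A)^2 + r * (3 * (E1 * R powr s)))"
      using grid_energy_imp_primitive[of A r "RI s p" "3 * (E1 * R powr s)"] g r R E1 unfolding A_def by auto
    show "\<exists>G. integrable lborel G \<and>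
      (\<forall>x y. c + R / 2 \<le> x \<longrightarrow> x \<le> y \<longrightarrow> y \<le> c + R \<longrightarrow> (\<integral>t. indicator {x..<y} t * G t \<partial>lborel) = RI s p y - RI s p x) \<and>
      (\<integral>t. \<bar>G t\<bar> \<partial>lborel) \<le> 3 * sqrt D2 * R powr ((1 + s) / 2)"
    proof (intro exI conjI allI impI)
      show "integrable lborel G" by fact
      fix x y assume xy: "c + R / 2 \<le> x" "x \<le> y" "y \<le> c + R"
      \<comment> \<open>Whatever grid was found, it begins at or before c + R/2, as \<tau> \<le>
        R/2, and ends beyond c + R, as r > R. This is why the conclusion is stated on
        [c + R/2, c + R].\<close>
      then have xA: "A \<le> x" "y \<le> A + r" using \<tau> r unfolding A_def by linarith+
      have i: "integrable lborel (\<lambda>t. indicator {A..<z} t * G t)" for z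
        using integrable_mult_indicator[OF _ G(1), of "{A..<z}"] by simp
      have "(\<integral>t. indicator {x..<y} t * G t \<partial>lborel) = (\<integral>t. indicator {A..<y} t * G t - indicator {A..<x} t * G t \<partial>lborel)"
        using xA xy by (intro Bochner_Integration.integral_cong refl) (auto simp: indicator_def)
      also have "\<dots> = (\<integral>t. indicator {A..<y} t * G t \<partial>lborel) - (\<integral>t. indicator {A..<x} t * G t \<partial>lborel)"
        by (intro Bochner_Integration.integral_diff i)
      also have "\<dots> = RI s p y - RI s p x" using G(2)[of x] G(2)[of y] xA xy by simp
      finally show "(\<integral>t. indicator {x..<y} t * G t \<partial>lborel) = RI s p y - RI s p x" .
    next
      have "\<bar>RI s p (A + r) - RI s p A\<bar> \<le> K * r powr ((1 + s) / 2)"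
        using RH[of A r] \<tau> r R by (simp add: A_def)
      then have "(RI s p (A + r) - RI s p A)^2 \<le> (K * r powr ((1 + s) / 2))^2"
        by (metis abs_ge_zero power2_abs power_mono)
      also have "\<dots> = K^2 * r powr (1 + s)"
        by (simp add: power_mult_distrib power2_eq_square powr_add[symmetric])
      also have "\<dots> \<le> K^2 * (2 * R) powr (1 + s)"
        using r R s by (intro mult_left_mono powr_mono2) auto
      also have "\<dots> = K^2 * 2 powr (1 + s) * R powr (1 + s)" using R by (simp add: powr_mult)
      finally have 1: "(RI s p (A + r) - RI s p A)^2 \<le> \<dots>" .
      have "r * (3 * (E1 * R powr s)) \<le> 2 * R * (3 * (E1 * R powr s))"
        using r E1 by (intro mult_right_mono) auto
      also have "\<dots> = 6 * E1 * R powr (1 + s)" using R by (simp add: powr_add)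
      finally have "(RI s p (A + r) - RI s p A)^2 + r * (3 * (E1 * R powr s)) \<le> D2 * R powr (1 + s)"
        using 1 by (simp add: D2_def algebra_simps)
      then have "sqrt ((RI s p (A + r) - RI s p A)^2 + r * (3 * (E1 * R powr s))) \<le> sqrt (D2 * R powr (1 + s))"
        by (rule real_sqrt_le_mono)
      also have "\<dots> = sqrt D2 * R powr ((1 + s) / 2)"
        using R by (simp add: real_sqrt_mult powr_half_sqrt[symmetric] powr_powr)
      finally show "(\<integral>t. \<bar>G t\<bar> \<partial>lborel) \<le> 3 * sqrt D2 * R powr ((1 + s) / 2)"
        using G(3) by simp
    qed
  qed
qed

text \<open>The windows [c + R/2, c + R] with R = (b - c) / 2^k fill (c, b] from the right. The
  derivatives found on them come from unrelated grids, so each is cut down to its own window before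
  they are summed.\<close>

lemma RI_weighted_primitive:
  assumes s: "0 < s" "s < 1" and c: "c < b"
    and H: "\<And>x t. \<lbrakk>c \<le> x; 0 \<le> t\<rbrakk> \<Longrightarrow> \<bar>p (x + t) - p x\<bar> \<le> H * t powr ((1 - s) / 2)"
    and E: "\<And>R. \<lbrakk>0 < R; R \<le> b - c\<rbrakk> \<Longrightarrow>
      (\<integral>\<^sup>+l. \<integral>\<^sup>+t. ennreal (indicator {c..c + 5/2 * R} l * (indicator {0<..} t * sqinc p (1 - s) l t)) \<partial>lborel \<partial>lborel)
        \<le> ennreal (E * R powr s)" and E0: "0 \<le> E"
  obtains G where "integrable lborel G" "integrable lborel (\<lambda>t. G t * rker (1 - s) (t - c))"
    "\<And>x. x \<in> {c..b} \<Longrightarrow> RI s p x = - (\<integral>t. indicator {x..<b} t * G t \<partial>lborel)"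
proof -
  define R where "R k = (b - c) / 2 ^ k" for k :: nat
  have R: "0 < R k" "R k \<le> b - c" "R (Suc k) = R k / 2" for k
  proof -
    have "(b - c) / 2 ^ k \<le> (b - c) / 1" using c by (intro divide_left_mono) auto
    then show "R k \<le> b - c" by (simp add: R_def)
  qed (use c in \<open>auto simp: R_def\<close>)
  obtain D where D: "0 < D" and DG: "\<And>R. \<lbrakk>0 < R; R \<le> b - c\<rbrakk> \<Longrightarrow> \<exists>G. integrable lborel G \<and>
      (\<forall>x y. c + R / 2 \<le> x \<longrightarrow> x \<le> y \<longrightarrow> y \<le> c + R \<longrightarrow> (\<integral>t. indicator {x..<y} t * G t \<partial>lborel) = RI s p y - RI s p x) \<and>
      (\<integral>t. \<bar>G t\<bar> \<partial>lborel) \<le> D * R powr ((1 + s) / 2)"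
    using RI_local_primitive[OF s H E E0] by blast
  have "\<forall>k. \<exists>G. integrable lborel G \<and>
      (\<forall>x y. c + R k / 2 \<le> x \<longrightarrow> x \<le> y \<longrightarrow> y \<le> c + R k \<longrightarrow> (\<integral>t. indicator {x..<y} t * G t \<partial>lborel) = RI s p y - RI s p x) \<and>
      (\<integral>t. \<bar>G t\<bar> \<partial>lborel) \<le> D * R k powr ((1 + s) / 2)"
    using DG R by blast
  then obtain g where g: "\<And>k. integrable lborel (g k)"
      "\<And>k x y. \<lbrakk>c + R k / 2 \<le> x; x \<le> y; y \<le> c + R k\<rbrakk> \<Longrightarrow> (\<integral>t. indicator {x..<y} t * g k t \<partial>lborel) = RI s p y - RI s p x"
      "\<And>k. (\<integral>t. \<bar>g k t\<bar> \<partial>lborel) \<le> D * R k powr ((1 + s) / 2)"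
    unfolding choice_iff by blast
  have [measurable]: "g k \<in> borel_measurable borel" for k using g(1)[of k] by auto
  define f where "f k t = indicator {c + R (Suc k)..<c + R k} t * g k t" for k t
  have f_abs: "\<bar>f k t\<bar> \<le> \<bar>g k t\<bar>" for k t by (auto simp: f_def indicator_def)
  have [measurable]: "f k \<in> borel_measurable borel" for k unfolding f_def[abs_def] by measurable
  have int_f: "integrable lborel (f k)" for k
    by (rule Bochner_Integration.integrable_bound[OF g(1)]) (use f_abs in auto)
  have f_le: "(\<integral>t. \<bar>f k t\<bar> \<partial>lborel) \<le> D * R k powr ((1 + s) / 2)" for k
    by (rule order_trans[OF integral_mono[OF integrable_abs[OF int_f] integrable_abs[OF g(1)] f_abs] g(3)])
  have geo: "summable (\<lambda>k. C * R k powr \<beta>)" if "0 < \<beta>" for C \<beta>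
  proof -
    have "R k powr \<beta> = (b - c) powr \<beta> * ((1/2) powr \<beta>) ^ k" for k
    proof -
      have "R k powr \<beta> = (b - c) powr \<beta> * ((1/2) ^ k) powr \<beta>"
      proof -
        have "R k = (b - c) * (1/2) ^ k" by (simp add: R_def power_one_over)
        then show ?thesis using c by (simp add: powr_mult)
      qed
      also have "((1/2::real) ^ k) powr \<beta> = ((1/2) powr real k) powr \<beta>" by (simp add: powr_realpow)
      also have "\<dots> = ((1/2) powr \<beta>) powr real k" by (simp only: powr_powr mult.commute)
      also have "\<dots> = ((1/2) powr \<beta>) ^ k" by (rule powr_realpow) simp
      finally show ?thesis .
    qed
    moreover have "norm ((1/2::real) powr \<beta>) < 1"
    proof -
      have "(1/2::real) powr \<beta> < (1/2) powr 0" using that by (intro powr_less_mono') auto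
      then show ?thesis by simp
    qed
    ultimately show ?thesis by (auto intro!: summable_mult summable_geometric)
  qed
  have sm: "summable (\<lambda>k. \<integral>t. \<bar>f k t\<bar> \<partial>lborel)"
    by (rule summable_comparison_test[OF _ geo[of "(1 + s) / 2" D]]) (use s f_le in auto)
  have ae: "AE t in lborel. summable (\<lambda>k. \<bar>f k t\<bar>)"
    by (rule AE_summable_L1[OF int_f sm])
  define w where "w k t = f k t * rker (1 - s) (t - c)" for k t
  have w_abs: "\<bar>w k t\<bar> \<le> 2 * (R k powr (- s) * \<bar>f k t\<bar>)" for k t
  proof (cases "t \<in> {c + R (Suc k)..<c + R k}")
    case True
    then have t: "R k / 2 \<le> t - c" using R(3) by simp
    have "rker (1 - s) (t - c) = (t - c) powr (- s)" using t R(1)[of k] by (simp add: rker_def)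
    also have "\<dots> \<le> (R k / 2) powr (- s)"
      using t s R(1)[of k] by (intro powr_mono2') auto
    also have "\<dots> = R k powr (- s) * 2 powr s"
      using R(1)[of k] by (simp add: powr_divide powr_minus field_simps)
    also have "\<dots> \<le> R k powr (- s) * 2 powr 1"
      using s by (intro mult_left_mono powr_mono) auto
    finally have "\<bar>f k t\<bar> * rker (1 - s) (t - c) \<le> \<bar>f k t\<bar> * (R k powr (- s) * 2)"
      by (intro mult_left_mono) auto
    then show ?thesis by (simp add: w_def abs_mult mult_ac)
  qed (simp add: w_def f_def)
  have [measurable]: "w k \<in> borel_measurable borel" for k unfolding w_def[abs_def] by measurable
  have int_w: "integrable lborel (w k)" for k
    by (rule Bochner_Integration.integrable_bound[where f="\<lambda>t. 2 * (R k powr (- s) * \<bar>f k t\<bar>)"]) (use int_f w_abs in auto)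
  \<comment> \<open>On window k the weight is at most 2 * R k powr (- s). Multiplied by the L^1
    bound of order (1 + s) / 2 it leaves the exponent (1 - s) / 2, positive because s < 1; hence the
    series converges.\<close>
  have w_le: "(\<integral>t. \<bar>w k t\<bar> \<partial>lborel) \<le> 2 * D * R k powr ((1 - s) / 2)" for k
  proof -
    have "(\<integral>t. \<bar>w k t\<bar> \<partial>lborel) \<le> (\<integral>t. 2 * (R k powr (- s) * \<bar>f k t\<bar>) \<partial>lborel)"
      using int_w int_f w_abs by (intro integral_mono) auto
    also have "\<dots> = 2 * (R k powr (- s) * (\<integral>t. \<bar>f k t\<bar> \<partial>lborel))" by simp
    also have "\<dots> \<le> 2 * (R k powr (- s) * (D * R k powr ((1 + s) / 2)))"
      using f_le by (intro mult_left_mono) auto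
    also have "\<dots> = 2 * D * (R k powr (- s) * R k powr ((1 + s) / 2))" by simp
    also have "R k powr (- s) * R k powr ((1 + s) / 2) = R k powr ((1 - s) / 2)"
      by (simp add: powr_add[symmetric] field_simps)
    finally show ?thesis .
  qed
  have smw: "summable (\<lambda>k. \<integral>t. \<bar>w k t\<bar> \<partial>lborel)"
    by (rule summable_comparison_test[OF _ geo[of "(1 - s) / 2" "2 * D"]]) (use s w_le in auto)
  have aew: "AE t in lborel. summable (\<lambda>k. \<bar>w k t\<bar>)"
    by (rule AE_summable_L1[OF int_w smw])
  define G where "G t = (\<Sum>k. f k t)" for t
  have [measurable]: "G \<in> borel_measurable borel" unfolding G_def[abs_def] by measurable
  show ?thesis
  proof (rule that[of G])
    show "integrable lborel G"
      unfolding G_def[abs_def] by (rule integrable_suminf) (use int_f ae sm in auto)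
    have iw: "integrable lborel (\<lambda>t. \<Sum>k. w k t)"
      by (rule integrable_suminf) (use int_w aew smw in auto)
    have "AE t in lborel. (\<Sum>k. w k t) = G t * rker (1 - s) (t - c)"
      using ae unfolding w_def G_def
      by eventually_elim (auto intro!: suminf_mult2[symmetric] summable_rabs_cancel)
    with iw show "integrable lborel (\<lambda>t. G t * rker (1 - s) (t - c))"
      by (subst (asm) integrable_cong_AE[where g="\<lambda>t. G t * rker (1 - s) (t - c)"]) auto
    fix x assume x: "x \<in> {c..b}"
    \<comment> \<open>The left window ends, cut off at x. Windows entirely to the left of x collapse
      to a point and the increments telescope from b down to x.\<close>
    define X where "X n = max x (c + R n)" for n
    have R0: "R \<longlonglongrightarrow> 0"
    proof -
      have "(\<lambda>n. (b - c) * (1/2) ^ n) \<longlonglongrightarrow> (b - c) * 0"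
        by (intro tendsto_intros LIMSEQ_power_zero) auto
      then show ?thesis by (simp add: R_def[abs_def] power_one_over)
    qed
    have X: "X \<longlonglongrightarrow> x"
    proof -
      have "(\<lambda>n. max x (c + R n)) \<longlonglongrightarrow> max x (c + 0)"
        by (intro tendsto_max tendsto_intros R0)
      then show ?thesis using x by (simp add: X_def[abs_def])
    qed
    have Xb: "X 0 = b" using x by (simp add: X_def R_def)
    have RH: "\<bar>RI s p (x + h) - RI s p x\<bar> \<le> H * (\<integral>t. (1 + \<bar>t\<bar>) powr ((1 - s) / 2) * \<bar>rdiff s t\<bar> \<partial>lborel) * h powr (s + (1 - s) / 2)"
      if "c \<le> x" "0 \<le> h" for x h
    proof (rule RI_Holder[OF s _ _ H[OF that(1)] that(2)])
      show "0 \<le> (1 - s) / 2" "s + (1 - s) / 2 < 1" using s by (simp_all add: field_simps)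
    qed
    have cont: "continuous_on {c..} (RI s p)"
      by (rule Holder_imp_continuous_on[OF RH]) (use s in \<open>auto simp: field_simps\<close>)
    have step: "(\<integral>t. indicator {x..<b} t * f k t \<partial>lborel) = RI s p (X k) - RI s p (X (Suc k))" for k
    proof -
      have kb: "c + R k \<le> b" using R(2)[of k] by simp
      have "indicator {x..<b} t * f k t = indicator {X (Suc k)..<X k} t * g k t" for t
        using R[of k] kb by (auto simp: f_def X_def indicator_def)
      then have e: "(\<integral>t. indicator {x..<b} t * f k t \<partial>lborel) = (\<integral>t. indicator {X (Suc k)..<X k} t * g k t \<partial>lborel)" by simp
      show ?thesis
      proof (cases "x \<le> c + R k")
        case True
        then show ?thesis unfolding e using R[of k] by (intro g(2)) (auto simp: X_def)
      next
        case False
        then have "X k = x" "X (Suc k) = x" using R[of k] by (auto simp: X_def)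
        then show ?thesis unfolding e by simp
      qed
    qed
    have "(\<lambda>k. \<integral>t. indicator {x..<b} t * f k t \<partial>lborel) sums (\<integral>t. (\<Sum>k. indicator {x..<b} t * f k t) \<partial>lborel)"
    proof (rule sums_integral)
      show i: "integrable lborel (\<lambda>t. indicator {x..<b} t * f k t)" for k
        using integrable_mult_indicator[OF _ int_f, of "{x..<b}" k] by simp
      show "AE t in lborel. summable (\<lambda>k. norm (indicator {x..<b} t * f k t))"
        using ae by eventually_elim (auto simp: indicator_def abs_mult)
      have "(\<integral>t. norm (indicator {x..<b} t * f k t) \<partial>lborel) \<le> (\<integral>t. \<bar>f k t\<bar> \<partial>lborel)" for k
        by (intro integral_mono integrable_norm i int_f integrable_abs) (auto simp: indicator_def)
      then show "summable (\<lambda>k. \<integral>t. norm (indicator {x..<b} t * f k t) \<partial>lborel)"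
        by (intro summable_comparison_test[OF _ sm]) auto
    qed
    also have "(\<lambda>t. \<Sum>k. indicator {x..<b} t * f k t) = (\<lambda>t. indicator {x..<b} t * G t)"
      by (auto simp: G_def indicator_def fun_eq_iff)
    finally have "(\<lambda>n. \<Sum>k<n. RI s p (X k) - RI s p (X (Suc k))) \<longlonglongrightarrow> (\<integral>t. indicator {x..<b} t * G t \<partial>lborel)"
      by (simp only: sums_def step)
    moreover have "(\<Sum>k<n. RI s p (X k) - RI s p (X (Suc k))) = RI s p b - RI s p (X n)" for n
      by (induction n) (simp_all add: Xb del: sum_subtractf)
    ultimately have "(\<lambda>n. RI s p b - RI s p (X n)) \<longlonglongrightarrow> (\<integral>t. indicator {x..<b} t * G t \<partial>lborel)"
      by (simp only:)
    moreover have "(\<lambda>n. RI s p b - RI s p (X n)) \<longlonglongrightarrow> RI s p b - RI s p x"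
      by (intro tendsto_intros continuous_on_tendsto_compose[OF cont X]) (use x in \<open>auto simp: X_def le_max_iff_disj\<close>)
    ultimately have "(\<integral>t. indicator {x..<b} t * G t \<partial>lborel) = RI s p b - RI s p x"
      by (rule LIMSEQ_unique)
    then show "RI s p x = - (\<integral>t. indicator {x..<b} t * G t \<partial>lborel)"
      using RI_zero[of b s] by simp
  qed
qed

end

section \<open>Differentiation of indefinite integrals\<close>

lemma cball_midpoint_eq:
  "cball (x + h / 2) (\<bar>h\<bar> / 2) = cbox (min x (x + h)) (max x (x + h :: real))"
  by (auto simp: dist_real_def abs_if min_def max_def field_simps split: if_splits)

text \<open>Lebesgue differentiation: where the derivative fails by a definite amount, there are arbitrarily
  short intervals violating the estimate of Henstock's lemma, and a disjoint subfamily of these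
  covers the bad set up to a factor 5.\<close>

theorem negligible_indefinite_integral_not_differentiable:
  fixes f :: "real \<Rightarrow> real"
  assumes f: "f integrable_on {a..b}"
  defines "F \<equiv> \<lambda>x. integral {a..x} f"
  shows "negligible {x \<in> {a<..<b}. \<not> (F has_real_derivative f x) (at x)}"
proof -
  \<comment> \<open>\<open>h\<close> may have either sign, so two-sided differentiability is
    tested.\<close>
  define Bad where "Bad \<eta> x h \<longleftrightarrow> h \<noteq> 0 \<and> \<eta> * \<bar>h\<bar> < \<bar>F (x + h) - F x - h * f x\<bar>" for \<eta> x h
  define E where "E n = {x \<in> {a<..<b}. \<forall>\<delta>>0. \<exists>h. \<bar>h\<bar> < \<delta> \<and> Bad (1 / real (Suc n)) x h}" for n
  have sub: "{x \<in> {a<..<b}. \<not> (F has_real_derivative f x) (at x)} \<subseteq> (\<Union>n. E n)"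
  proof (rule subsetI, rule ccontr)
    fix x assume x: "x \<in> {x \<in> {a<..<b}. \<not> (F has_real_derivative f x) (at x)}" and nE: "x \<notin> (\<Union>n. E n)"
    have "(F has_real_derivative f x) (at x)"
      unfolding DERIV_def LIM_def
    proof (intro allI impI)
      fix e :: real assume "0 < e"
      then obtain n where n: "inverse (real (Suc n)) < e" using reals_Archimedean by blast
      from nE x obtain \<delta> where \<delta>: "0 < \<delta>" "\<And>h. \<bar>h\<bar> < \<delta> \<Longrightarrow> \<not> Bad (1 / real (Suc n)) x h"
        by (auto simp: E_def)
      show "\<exists>s>0. \<forall>h. h \<noteq> 0 \<and> dist h 0 < s \<longrightarrow> dist ((F (x + h) - F x) / h) (f x) < e"
      proof (intro exI[of _ \<delta>] conjI allI impI)
        fix h :: real assume h: "h \<noteq> 0 \<and> dist h 0 < \<delta>"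
        then have "\<bar>F (x + h) - F x - h * f x\<bar> \<le> 1 / real (Suc n) * \<bar>h\<bar>"
          using \<delta>(2)[of h] by (auto simp: Bad_def not_less)
        moreover have "(F (x + h) - F x) / h - f x = (F (x + h) - F x - h * f x) / h" using h by (simp add: field_simps)
        ultimately have "dist ((F (x + h) - F x) / h) (f x) \<le> 1 / real (Suc n)"
          using h by (simp add: dist_real_def abs_divide pos_divide_le_eq)
        then show "dist ((F (x + h) - F x) / h) (f x) < e" using n by (simp add: inverse_eq_divide)
      qed (rule \<delta>)
    qed
    then show False using x by simp
  qed
  have "negligible (E n)" for n
    unfolding negligible_outer_le
  proof (intro allI impI)
    fix e :: real assume e: "0 < e"
    define \<eta> where "\<eta> = 1 / real (Suc n)"
    have \<eta>: "0 < \<eta>" by (simp add: \<eta>_def)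
    have fi: "f integrable_on cbox a b" using f by simp
    \<comment> \<open>Henstock's lemma will bound the total length of the selected intervals by e /
      5 after division by \<eta>; the enlargement by 5 in the covering lemma restores e.\<close>
    have e5: "0 < e * \<eta> / 5" using e \<eta> by simp
    obtain \<gamma> where \<gamma>: "gauge \<gamma>"
      and hen: "\<And>p. \<lbrakk>p tagged_partial_division_of (cbox a b); \<gamma> fine p\<rbrakk> \<Longrightarrow>
             (\<Sum>(x,k)\<in>p. norm(measure lborel k *\<^sub>R f x - integral k f)) < e * \<eta> / 5"
      by (rule Henstock_lemma[OF fi e5], rule that)
    \<comment> \<open>The pair (x, h) encodes the closed interval with end points x and x + h. It
      contains its tag x, as Henstock's lemma demands, and it is a closed ball, as the covering
      lemma demands.\<close>
    define ctr where "ctr i = fst i + snd i / 2" for i :: "real \<times> real"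
    define rad where "rad i = \<bar>snd i\<bar> / 2" for i :: "real \<times> real"
    define seg where "seg i = cball (ctr i) (rad i)" for i
    have seg: "seg (x, h) = cbox (min x (x + h)) (max x (x + h))" for x h
      by (simp only: seg_def ctr_def rad_def fst_conv snd_conv cball_midpoint_eq)
    define K where "K = {i. Bad \<eta> (fst i) (snd i) \<and> seg i \<subseteq> \<gamma> (fst i) \<and> seg i \<subseteq> {a<..<b} \<and> \<bar>snd i\<bar> \<le> 1}"
    have radK: "\<And>i. i \<in> K \<Longrightarrow> 0 < rad i \<and> rad i \<le> 1" by (auto simp: K_def rad_def Bad_def)
    obtain C where C: "countable C" "C \<subseteq> K"
      and disj: "pairwise (\<lambda>i j. disjnt (cball (ctr i) (rad i)) (cball (ctr j) (rad j))) C"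
      and cover: "\<And>i. i \<in> K \<Longrightarrow> \<exists>j. j \<in> C \<and> \<not> disjnt (cball (ctr i) (rad i)) (cball (ctr j) (rad j)) \<and>
                        cball (ctr i) (rad i) \<subseteq> ball (ctr j) (5 * rad j)"
      by (rule Vitali_covering_lemma_cballs_balls[where a = ctr and r = rad and K = K and B = 1], erule radK, rule that)
    have xs: "fst i \<in> seg i" for i by (cases i) (auto simp: seg)
    have cov: "E n \<subseteq> (\<Union>j\<in>C. ball (ctr j) (5 * rad j))"
    proof
      fix x assume x: "x \<in> E n"
      have "open (\<gamma> x \<inter> {a<..<b})" "x \<in> \<gamma> x \<inter> {a<..<b}"
        using \<gamma> x by (auto simp: gauge_def E_def)
      then obtain d where d: "0 < d" "ball x d \<subseteq> \<gamma> x \<inter> {a<..<b}"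
        unfolding open_contains_ball by blast
      from x have "\<forall>\<delta>>0. \<exists>h. \<bar>h\<bar> < \<delta> \<and> Bad \<eta> x h" by (simp add: E_def \<eta>_def)
      moreover have "0 < min d 1" using d by simp
      ultimately obtain h where h: "\<bar>h\<bar> < min d 1" "Bad \<eta> x h" by blast
      have "seg (x, h) \<subseteq> ball x d" using h by (auto simp: seg dist_real_def)
      then have "(x, h) \<in> K" using h d by (auto simp: K_def)
      then obtain j where "j \<in> C" "seg (x, h) \<subseteq> ball (ctr j) (5 * rad j)"
        using cover unfolding seg_def by blast
      then show "x \<in> (\<Union>j\<in>C. ball (ctr j) (5 * rad j))" using xs[of "(x, h)"] unfolding fst_conv by blast
    qed
    \<comment> \<open>Tagged partial divisions are finite, so the estimate is made for finite
      subfamilies with a common bound; the countable union inherits it.\<close>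
    have mb: "measure lebesgue (\<Union>j\<in>C'. ball (ctr j) (5 * rad j)) \<le> e" if C': "C' \<subseteq> C" "finite C'" for C'
    proof -
      define p where "p = (\<lambda>i. (fst i, seg i)) ` C'"
      have dj: "seg i \<inter> seg j = {}" if "i \<in> C'" "j \<in> C'" "i \<noteq> j" for i j
        using disj C' that unfolding pairwise_def disjnt_def seg_def by blast
      have inj: "inj_on (\<lambda>i. (fst i, seg i)) C'"
        using dj xs by (fastforce simp: inj_on_def)
      have CK: "i \<in> K" if "i \<in> C'" for i using that C C' by blast
      have t1: "x \<in> k \<and> k \<subseteq> cbox a b \<and> (\<exists>a b. k = cbox a b)" if xk: "(x, k) \<in> p" for x k
      proof -
        from xk obtain i where i: "i \<in> C'" "x = fst i" "k = seg i" by (auto simp: p_def)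
        have "seg i \<subseteq> {a<..<b}" using CK[OF i(1)] by (simp add: K_def)
        then have "k \<subseteq> cbox a b" using i by auto
        moreover have "\<exists>a b. k = cbox a b" unfolding i by (cases i) (auto simp: seg)
        ultimately show ?thesis using xs i by simp
      qed
      have t2: "interior k \<inter> interior k' = {}" if "(x, k) \<in> p" "(x', k') \<in> p" and ne: "(x, k) \<noteq> (x', k')" for x k x' k'
      proof -
        from that obtain i i' where i: "i \<in> C'" "x = fst i" "k = seg i" and i': "i' \<in> C'" "x' = fst i'" "k' = seg i'"
          by (auto simp: p_def)
        have "k \<inter> k' = {}" unfolding i i' by (rule dj) (use ne i i' in auto)
        then show ?thesis using interior_subset by blast
      qed
      have "finite p" using C' by (simp add: p_def)
      then have "p tagged_partial_division_of (cbox a b)"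
        unfolding tagged_partial_division_of_def using t1 t2 by blast
      moreover have "\<gamma> fine p"
        using CK unfolding fine_def p_def by (auto simp: K_def)
      ultimately have "(\<Sum>(x,k)\<in>p. norm(measure lborel k *\<^sub>R f x - integral k f)) < e * \<eta> / 5" by (rule hen)
      also have "(\<Sum>(x,k)\<in>p. norm(measure lborel k *\<^sub>R f x - integral k f)) = (\<Sum>i\<in>C'. \<bar>measure lborel (seg i) * f (fst i) - integral (seg i) f\<bar>)"
        unfolding p_def by (subst sum.reindex[OF inj]) simp
      finally have S: "(\<Sum>i\<in>C'. \<bar>measure lborel (seg i) * f (fst i) - integral (seg i) f\<bar>) < e * \<eta> / 5" .
      have bad_le: "\<eta> * \<bar>snd i\<bar> \<le> \<bar>measure lborel (seg i) * f (fst i) - integral (seg i) f\<bar>" if i: "i \<in> C'" for i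
      proof -
        obtain x h where xh: "i = (x, h)" by (cases i)
        have bad: "Bad \<eta> x h" and ab: "seg i \<subseteq> {a<..<b}" using CK[OF i] by (auto simp: K_def xh)
        have m: "a < min x (x + h)" "max x (x + h) < b" 
        proof -
          have "min x (x + h) \<in> seg i" "max x (x + h) \<in> seg i" by (auto simp: xh seg)
          then show "a < min x (x + h)" "max x (x + h) < b"
            using ab by (meson greaterThanLessThan_iff subsetD)+
        qed
        have c: "F (max x (x + h)) = F (min x (x + h)) + integral (seg i) f"
        proof -
          have "f integrable_on {a..max x (x + h)}"
            using f by (rule integrable_on_subinterval) (use m in auto)
          then have "integral {a..min x (x + h)} f + integral {min x (x + h)..max x (x + h)} f = integral {a..max x (x + h)} f"
            using m by (intro Henstock_Kurzweil_Integration.integral_combine) auto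
          then show ?thesis by (simp add: F_def xh seg)
        qed
        have "\<bar>measure lborel (seg i) * f x - integral (seg i) f\<bar> = \<bar>F (x + h) - F x - h * f x\<bar>"
        proof (cases "0 \<le> h")
          case True
          then show ?thesis using c by (simp add: xh seg abs_minus_commute)
        next
          case False
          then show ?thesis using c by (simp add: xh seg)
        qed
        then show ?thesis using bad by (simp add: Bad_def xh)
      qed
      have "\<eta> * (\<Sum>i\<in>C'. \<bar>snd i\<bar>) \<le> (\<Sum>i\<in>C'. \<bar>measure lborel (seg i) * f (fst i) - integral (seg i) f\<bar>)"
        unfolding sum_distrib_left by (rule sum_mono) (rule bad_le)
      then have "\<eta> * (\<Sum>i\<in>C'. \<bar>snd i\<bar>) \<le> \<eta> * (e / 5)" using S by (simp add: mult.commute)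
      then have h: "(\<Sum>i\<in>C'. \<bar>snd i\<bar>) \<le> e / 5" using \<eta> by simp
      have "measure lebesgue (\<Union>j\<in>C'. ball (ctr j) (5 * rad j)) \<le> (\<Sum>j\<in>C'. measure lebesgue (ball (ctr j) (5 * rad j)))"
        using C' by (intro measure_UNION_le) auto
      also have "\<dots> = (\<Sum>j\<in>C'. 5 * \<bar>snd j\<bar>)"
        by (intro sum.cong refl) (simp add: rad_def ball_eq_greaterThanLessThan)
      also have "\<dots> \<le> e" using h by (simp add: sum_distrib_left[symmetric])
      finally show ?thesis .
    qed
    have lm: "ball (ctr j) (5 * rad j) \<in> lmeasurable" for j by (rule lmeasurable_ball)
    show "\<exists>T. E n \<subseteq> T \<and> T \<in> lmeasurable \<and> measure lebesgue T \<le> e"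
      using cov fmeasurable_UN_bound[OF C(1) lm mb] measure_UN_bound[OF C(1) lm mb] by blast
  qed
  then have "negligible (\<Union>n. E n)" by (intro negligible_countable_Union) auto
  then show ?thesis using sub by (rule negligible_subset)
qed

section \<open>Abel inversion\<close>

text \<open>The problem is stated with \<open>lebesgue\<close>, the estimates are made with
  \<open>lborel\<close>. Integrands containing \<open>deriv\<close> are known only almost everywhere
  and need not be Borel; completeness of \<open>lebesgue\<close> makes them measurable all the
  same.\<close>

lemma
  fixes g h :: "real \<Rightarrow> real"
  assumes g [measurable]: "g \<in> borel_measurable borel" and ae: "AE x in lborel. h x = g x"
  shows lebesgue_measurable_AE_borel: "h \<in> borel_measurable lebesgue"
    and lebesgue_integral_AE_borel: "integral\<^sup>L lebesgue h = integral\<^sup>L lborel g"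
    and lebesgue_integrable_AE_borel: "integrable lebesgue h \<longleftrightarrow> integrable lborel g"
proof -
  have ae': "AE x in lebesgue. h x = g x" using ae by (rule AE_completion)
  have gl: "g \<in> borel_measurable lebesgue" by (rule measurable_completion) simp
  show m: "h \<in> borel_measurable lebesgue"
  proof (rule measurableI)
    fix A :: "real set" assume A: "A \<in> sets borel"
    have "g -` A \<in> sets lebesgue" using measurable_sets[OF gl A] by simp
    then have "h -` A \<in> sets lebesgue"
      by (rule completion.in_sets_AE[rotated]) (use ae' in \<open>auto elim: eventually_mono\<close>)
    then show "h -` A \<inter> space lebesgue \<in> sets lebesgue" by simp
  qed simp
  show "integral\<^sup>L lebesgue h = integral\<^sup>L lborel g"
    using integral_cong_AE[OF m gl ae'] by (simp add: integral_completion)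
  show "integrable lebesgue h \<longleftrightarrow> integrable lborel g"
    using integrable_cong_AE[OF m gl ae'] by (simp add: integrable_completion)
qed

text \<open>The exponents -\<alpha> and \<alpha> - 1 add up to -1, so reducing to the unit interval
  leaves no power of t - x. The constant value is what makes the composition of the two fractional
  integrals an ordinary integral.\<close>

lemma has_bochner_integral_rker_Beta:
  assumes "0 < \<alpha>" "\<alpha> < 1" "x < t"
  shows "has_bochner_integral lborel (\<lambda>u. rker (1 - \<alpha>) (t - u) * rker \<alpha> (u - x)) (Beta \<alpha> (1 - \<alpha>))"
proof -
  define l where "l = t - x"
  have l: "0 < l" using assms by (simp add: l_def)
  have eq: "indicator {0..1} \<tau> * (\<tau> powr (\<alpha> - 1) * (1 - \<tau>) powr (1 - \<alpha> - 1)) = rker (1 - \<alpha>) (1 - \<tau>) * rker \<alpha> \<tau>" for \<tau> :: real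
    by (auto simp: rker_def indicator_def)
  have "(\<integral>\<^sup>+\<tau>. ennreal (indicator {0..1} \<tau> * (\<tau> powr (\<alpha> - 1) * (1 - \<tau>) powr (1 - \<alpha> - 1))) \<partial>lborel) = ennreal (Beta \<alpha> (1 - \<alpha>))"
    using assms by (intro nn_integral_has_integral_lebesgue has_integral_Beta_real) auto
  then have "(\<integral>\<^sup>+\<tau>. ennreal (rker (1 - \<alpha>) (1 - \<tau>) * rker \<alpha> \<tau>) \<partial>lborel) = ennreal (Beta \<alpha> (1 - \<alpha>))"
    unfolding eq .
  moreover have "0 \<le> Beta \<alpha> (1 - \<alpha>)" using assms by (simp add: Beta_def Gamma_real_pos less_imp_le)
  ultimately have hb: "has_bochner_integral lborel (\<lambda>\<tau>. rker (1 - \<alpha>) (1 - \<tau>) * rker \<alpha> \<tau>) (Beta \<alpha> (1 - \<alpha>))"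
    by (intro has_bochner_integral_nn_integral) auto
  have pt: "l * (rker (1 - \<alpha>) (t - (x + l * \<tau>)) * rker \<alpha> (x + l * \<tau> - x)) = rker (1 - \<alpha>) (1 - \<tau>) * rker \<alpha> \<tau>" for \<tau>
  proof -
    have a: "t - (x + l * \<tau>) = l * (1 - \<tau>)" by (simp add: l_def algebra_simps)
    have "l * (l * (rker (1 - \<alpha>) (l * (1 - \<tau>)) * rker \<alpha> (l * \<tau>))) = (l * rker (1 - \<alpha>) (l * (1 - \<tau>))) * (l * rker \<alpha> (l * \<tau>))"
      by simp
    also have "\<dots> = (l powr (1 - \<alpha>) * l powr \<alpha>) * (rker (1 - \<alpha>) (1 - \<tau>) * rker \<alpha> \<tau>)"
      unfolding rker_scale[OF l] by (simp only: mult_ac)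
    also have "l powr (1 - \<alpha>) * l powr \<alpha> = l" using l by (simp add: powr_add[symmetric])
    finally show ?thesis using l by (simp add: a)
  qed
  let ?f = "\<lambda>u. rker (1 - \<alpha>) (t - u) * rker \<alpha> (u - x)"
  have 1: "integrable lborel (\<lambda>\<tau>. l * ?f (x + l * \<tau>))" "(\<integral>\<tau>. l * ?f (x + l * \<tau>) \<partial>lborel) = Beta \<alpha> (1 - \<alpha>)"
    unfolding pt using hb by (simp_all add: has_bochner_integral_iff)
  have "integrable lborel (\<lambda>\<tau>. ?f (x + l * \<tau>))" using 1(1) l by simp
  then have "integrable lborel ?f" using lborel_integrable_real_affine_iff[of l ?f x] l by simp
  moreover have "(\<integral>u. ?f u \<partial>lborel) = Beta \<alpha> (1 - \<alpha>)"
    using lborel_integral_real_affine[of l ?f x] l 1(2) by simp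
  ultimately show ?thesis by (simp add: has_bochner_integral_iff)
qed

lemma rker_Beta_zero: "t \<le> x \<Longrightarrow> rker \<beta> (t - u) * rker \<alpha> (u - x) = 0"
  using rker_nonpos[of "t - u" \<beta>] rker_nonpos[of "u - x" \<alpha>] by (cases "t \<le> u") auto

lemma (in bounded_left_support) RI_RI:
  assumes \<alpha>: "0 < \<alpha>" "\<alpha> < 1"
  shows "RI \<alpha> (RI (1 - \<alpha>) p) x = Beta \<alpha> (1 - \<alpha>) * (\<integral>t. indicator {x<..} t * p t \<partial>lborel)"
proof -
  let ?F = "\<lambda>t u. p t * (rker (1 - \<alpha>) (t - u) * rker \<alpha> (u - x))"
  have B: "0 \<le> Beta \<alpha> (1 - \<alpha>)" using \<alpha> by (simp add: Beta_def Gamma_real_pos less_imp_le)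
  have hb: "has_bochner_integral lborel (?F t) (Beta \<alpha> (1 - \<alpha>) * (indicator {x<..} t * p t))" for t
  proof (cases "x < t")
    case True
    then show ?thesis
      using has_bochner_integral_mult_right[OF has_bochner_integral_rker_Beta[OF \<alpha> True], of "p t"] by (simp add: mult.commute)
  next
    case False
    then have "?F t = (\<lambda>u. 0)" by (intro ext) (simp add: rker_Beta_zero)
    then show ?thesis using False by (simp add: has_bochner_integral_zero)
  qed
  have int: "integrable (lborel \<Otimes>\<^sub>M lborel) (\<lambda>(t, u). ?F t u)"
  proof (rule lborel_pair.Fubini_integrable)
    show "integrable lborel (\<lambda>t. \<integral>u. norm (case (t, u) of (t, u) \<Rightarrow> ?F t u) \<partial>lborel)"
    proof (rule Bochner_Integration.integrable_bound[where f="\<lambda>t. P * Beta \<alpha> (1 - \<alpha>) * indicator {x..b} t"])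
      show "integrable lborel (\<lambda>t. P * Beta \<alpha> (1 - \<alpha>) * indicator {x..b} t)"
        by (intro integrable_mult_right integrable_real_indicator) (auto simp: emeasure_lborel_Icc_eq)
      show "AE t in lborel. norm (\<integral>u. norm (case (t, u) of (t, u) \<Rightarrow> ?F t u) \<partial>lborel) \<le> norm (P * Beta \<alpha> (1 - \<alpha>) * indicator {x..b} t)"
      proof (rule AE_I2)
        fix t
        have "(\<integral>u. norm (?F t u) \<partial>lborel) = \<bar>p t\<bar> * (\<integral>u. rker (1 - \<alpha>) (t - u) * rker \<alpha> (u - x) \<partial>lborel)"
          by (simp add: abs_mult)
        also have "\<dots> = \<bar>p t\<bar> * (if x < t then Beta \<alpha> (1 - \<alpha>) else 0)"
          using has_bochner_integral_rker_Beta[OF \<alpha>, of x t] by (auto simp: has_bochner_integral_iff rker_Beta_zero)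
        also have "\<bar>\<dots>\<bar> \<le> P * Beta \<alpha> (1 - \<alpha>) * indicator {x..b} t"
          using p_bound[of t] p_zero[of t] B by (auto simp: indicator_def abs_mult intro!: mult_right_mono)
        finally have "\<bar>\<integral>u. norm (?F t u) \<partial>lborel\<bar> \<le> P * Beta \<alpha> (1 - \<alpha>) * indicator {x..b} t" .
        also have "\<dots> \<le> \<bar>P * Beta \<alpha> (1 - \<alpha>) * indicator {x..b} t\<bar>" by (rule abs_ge_self)
        finally show "norm (\<integral>u. norm (case (t, u) of (t, u) \<Rightarrow> ?F t u) \<partial>lborel) \<le> norm (P * Beta \<alpha> (1 - \<alpha>) * indicator {x..b} t)"
          by (simp only: real_norm_def prod.case)
      qed
    qed measurable
    show "AE t in lborel. integrable lborel (\<lambda>u. case (t, u) of (t, u) \<Rightarrow> ?F t u)"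
      using hb by (auto simp: has_bochner_integral_iff)
  qed measurable
  have "RI \<alpha> (RI (1 - \<alpha>) p) x = (\<integral>u. (\<integral>t. ?F t u \<partial>lborel) \<partial>lborel)"
    unfolding RI_def by (simp add: mult.assoc flip: integral_mult_left_zero)
  also have "\<dots> = (\<integral>t. (\<integral>u. ?F t u \<partial>lborel) \<partial>lborel)"
    by (rule lborel_pair.Fubini_integral[OF int])
  also have "\<dots> = (\<integral>t. Beta \<alpha> (1 - \<alpha>) * (indicator {x<..} t * p t) \<partial>lborel)"
    by (simp only: has_bochner_integral_integral_eq[OF hb])
  also have "\<dots> = Beta \<alpha> (1 - \<alpha>) * (\<integral>t. indicator {x<..} t * p t \<partial>lborel)"
    by (rule integral_mult_right_zero)
  finally show ?thesis .
qed

section \<open>Primitives of the kernel and one-sided derivatives of fractional integrals\<close>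

definition frac_pow :: "real \<Rightarrow> real \<Rightarrow> real" where
  "frac_pow s t = (if 0 < t then t powr s / s else 0)"

lemma frac_pow_measurable [measurable]: "frac_pow s \<in> borel_measurable borel"
  unfolding frac_pow_def[abs_def] by measurable

lemma has_bochner_integral_rker_Icc:
  assumes s: "0 < s"
  shows "has_bochner_integral lborel (\<lambda>u. indicator {..t} u * rker s (u - x)) (frac_pow s (t - x))"
proof -
  have eq: "indicator {..t} u * rker s (u - x) = indicator {0<..t - x} (- x + 1 * u) * (- x + 1 * u) powr (s - 1)" for u
    by (auto simp: rker_def indicator_def)
  show ?thesis
  proof (cases "x < t")
    case True
    have hb: "has_bochner_integral lborel (\<lambda>u. indicator {0<..t - x} u * u powr (s - 1)) ((t - x) powr s / s)"
      using has_bochner_integral_powr_from_0[of "s - 1" "t - x"] s True by simp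
    then show ?thesis
      unfolding eq using True lborel_integrable_real_affine[of "\<lambda>u. indicator {0<..t - x} u * u powr (s - 1)" 1 "-x"]
        lborel_integral_real_affine[of 1 "\<lambda>u. indicator {0<..t - x} u * u powr (s - 1)" "-x"]
      by (simp add: has_bochner_integral_iff frac_pow_def)
  next
    case False
    then have "(\<lambda>u. indicator {..t} u * rker s (u - x)) = (\<lambda>u. 0)"
      by (auto simp: rker_def indicator_def fun_eq_iff)
    then show ?thesis using False by (simp add: frac_pow_def has_bochner_integral_zero)
  qed
qed

text \<open>Concavity of the power function is what makes the difference quotients of \<open>frac_pow\<close>
  dominated by the kernel itself.\<close>

lemma frac_pow_quotient:
  assumes s: "0 < s" "s < 1" and h: "0 < h"
  shows "0 \<le> (frac_pow s t - frac_pow s (t - h)) / h" "(frac_pow s t - frac_pow s (t - h)) / h \<le> rker s t / s"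
proof -
  have "0 \<le> frac_pow s t - frac_pow s (t - h) \<and> frac_pow s t - frac_pow s (t - h) \<le> h * (rker s t / s)"
  proof -
    consider "t \<le> 0" | "0 < t" "t \<le> h" | "h < t" by linarith
    then show ?thesis
    proof cases
      case 2
      have "t powr s = t * t powr (s - 1)" using 2 by (simp add: powr_diff)
      also have "\<dots> \<le> h * t powr (s - 1)" using 2 by (intro mult_right_mono) auto
      finally show ?thesis using 2 s by (simp add: frac_pow_def rker_def divide_right_mono)
    next
      case 3
      have "t powr s = t * t powr (s - 1)" using 3 h by (simp add: powr_diff)
      moreover have "(t - h) * t powr (s - 1) \<le> (t - h) * (t - h) powr (s - 1)"
        using 3 h s by (intro mult_left_mono powr_mono2') auto
      moreover have "(t - h) * (t - h) powr (s - 1) = (t - h) powr s" using 3 by (simp add: powr_diff)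
      ultimately have "t powr s - (t - h) powr s \<le> h * t powr (s - 1)" by (simp add: algebra_simps)
      then have "(t powr s - (t - h) powr s) / s \<le> h * t powr (s - 1) / s"
        using s by (intro divide_right_mono) auto
      moreover have "(t - h) powr s \<le> t powr s" using 3 h s by (intro powr_mono2) auto
      ultimately show ?thesis using 3 h s by (simp add: frac_pow_def rker_def diff_divide_distrib divide_right_mono)
    qed (use h in \<open>simp add: frac_pow_def rker_def\<close>)
  qed
  then show "0 \<le> (frac_pow s t - frac_pow s (t - h)) / h" "(frac_pow s t - frac_pow s (t - h)) / h \<le> rker s t / s"
    using h by (auto simp: field_simps)
qed

lemma frac_pow_quotient_tendsto:
  assumes s: "0 < s" and X: "X \<longlonglongrightarrow> 0" "\<And>n. 0 < X n"
  shows "(\<lambda>n. (frac_pow s t - frac_pow s (t - X n)) / X n) \<longlonglongrightarrow> rker s t"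
proof (cases "0 < t")
  case True
  have "(frac_pow s has_real_derivative rker s t) (at t)"
  proof -
    have "((\<lambda>t. t powr s / s) has_real_derivative t powr (s - 1)) (at t)"
      using True s by (auto intro!: derivative_eq_intros)
    then have "(frac_pow s has_real_derivative t powr (s - 1)) (at t)"
      by (rule has_field_derivative_transform_within_open[where S="{0<..}"]) (use True in \<open>auto simp: frac_pow_def\<close>)
    then show ?thesis using True by (simp add: rker_def)
  qed
  then have d: "((\<lambda>h. (frac_pow s (t + h) - frac_pow s t) / h) \<longlongrightarrow> rker s t) (at 0)"
    by (simp add: DERIV_def)
  have "filterlim (\<lambda>n. - X n) (at 0) sequentially"
    unfolding filterlim_at using X tendsto_minus[OF X(1)] by (auto simp: less_imp_neq[symmetric] intro!: always_eventually)
  from filterlim_compose[OF d this]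
  show ?thesis by (rule Lim_transform_eventually) (auto intro!: always_eventually simp: minus_divide_left)
next
  case False
  have "frac_pow s (t - X n) = 0" for n using X(2)[of n] False by (simp add: frac_pow_def)
  moreover have "frac_pow s t = 0" "rker s t = 0" using False by (simp_all add: frac_pow_def rker_def)
  ultimately show ?thesis by simp
qed

text \<open>The weighted integrability of \<open>G\<close> is what allows dominated convergence at the singular point \<open>c\<close>.\<close>

lemma RI_primitive_derivative:
  fixes g G :: "real \<Rightarrow> real"
  assumes s: "0 < s" "s < 1" and c: "c < b"
    and G: "integrable lborel G" "integrable lborel (\<lambda>t. G t * rker s (t - c))"
    and G0: "\<And>t. b \<le> t \<Longrightarrow> G t = 0"
    and g: "\<And>x. c \<le> x \<Longrightarrow> g x = (\<integral>t. indicator {x..} t * G t \<partial>lborel)"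
    and lim: "((\<lambda>h. (RI s g (c + h) - RI s g c) / h) \<longlongrightarrow> D) (at_right 0)"
  shows "D = - (\<integral>t. G t * rker s (t - c) \<partial>lborel)"
proof -
  have [measurable]: "G \<in> borel_measurable borel" using G(1) by auto
  \<comment> \<open>Writing \<open>g\<close> as a tail integral of \<open>G\<close> and exchanging
    the order of integration replaces the singular kernel by its primitive \<open>frac_pow\<close>,
    so the difference quotients fall on an explicit function.\<close>
  have fub: "integrable lborel (\<lambda>t. G t * frac_pow s (t - x))" "RI s g x = (\<integral>t. G t * frac_pow s (t - x) \<partial>lborel)" if x: "c \<le> x" for x
  proof -
    let ?F = "\<lambda>t u. G t * (indicator {..t} u * rker s (u - x))"
    have hb: "has_bochner_integral lborel (?F t) (G t * frac_pow s (t - x))" for t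
      by (intro has_bochner_integral_mult_right has_bochner_integral_rker_Icc s)
    show intG: "integrable lborel (\<lambda>t. G t * frac_pow s (t - x))"
    proof (rule Bochner_Integration.integrable_bound[where f="\<lambda>t. G t * ((b - x) powr s / s)"])
      show "AE t in lborel. norm (G t * frac_pow s (t - x)) \<le> norm (G t * ((b - x) powr s / s))"
      proof (rule AE_I2)
        fix t
        have "frac_pow s (t - x) \<le> (b - x) powr s / s \<and> 0 \<le> frac_pow s (t - x)" if "t < b"
          using that s by (auto simp: frac_pow_def intro!: divide_right_mono powr_mono2)
        then have "\<bar>G t\<bar> * \<bar>frac_pow s (t - x)\<bar> \<le> \<bar>G t\<bar> * \<bar>(b - x) powr s / s\<bar>"
        proof (cases "t < b")
          case True
          then have "\<bar>frac_pow s (t - x)\<bar> \<le> \<bar>(b - x) powr s / s\<bar>"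
            using \<open>t < b \<Longrightarrow> _\<close> s by simp
          then show ?thesis by (rule mult_left_mono) simp
        qed (simp add: G0)
        then show "norm (G t * frac_pow s (t - x)) \<le> norm (G t * ((b - x) powr s / s))"
          by (simp only: real_norm_def abs_mult)
      qed
    qed (use G in auto)
    have int: "integrable (lborel \<Otimes>\<^sub>M lborel) (\<lambda>(t, u). ?F t u)"
    proof (rule lborel_pair.Fubini_integrable)
      have "(\<integral>u. norm (?F t u) \<partial>lborel) = \<bar>G t * frac_pow s (t - x)\<bar>" for t
      proof -
        have "(\<integral>u. norm (?F t u) \<partial>lborel) = \<bar>G t\<bar> * (\<integral>u. indicator {..t} u * rker s (u - x) \<partial>lborel)"
          by (simp add: abs_mult)
        also have "\<dots> = \<bar>G t\<bar> * frac_pow s (t - x)"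
          using has_bochner_integral_rker_Icc[OF s(1), of t x] by (simp add: has_bochner_integral_iff)
        also have "\<dots> = \<bar>G t * frac_pow s (t - x)\<bar>" using s by (simp add: abs_mult frac_pow_def)
        finally show ?thesis .
      qed
      then show "integrable lborel (\<lambda>t. \<integral>u. norm (case (t, u) of (t, u) \<Rightarrow> ?F t u) \<partial>lborel)"
        using integrable_abs[OF intG] by simp
      show "AE t in lborel. integrable lborel (\<lambda>u. case (t, u) of (t, u) \<Rightarrow> ?F t u)"
        using hb by (auto simp: has_bochner_integral_iff)
      \<comment> \<open>The indicator of the moving interval {..t} is rewritten as a condition on
        the pair (t, u), from which joint measurability is read off.\<close>
      have "(\<lambda>(t, u). ?F t u) = (\<lambda>(t, u). G t * ((if u \<le> t then 1 else 0) * rker s (u - x)))"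
        by (auto simp: indicator_def)
      then show "(\<lambda>(t, u). ?F t u) \<in> borel_measurable (lborel \<Otimes>\<^sub>M lborel)" by simp
    qed
    have "RI s g x = (\<integral>u. (\<integral>t. ?F t u \<partial>lborel) \<partial>lborel)"
      unfolding RI_def
    proof (intro Bochner_Integration.integral_cong refl)
      fix u
      show "g u * rker s (u - x) = (\<integral>t. ?F t u \<partial>lborel)"
      proof (cases "x < u")
        case True
        have "(\<integral>t. ?F t u \<partial>lborel) = (\<integral>t. (indicator {u..} t * G t) * rker s (u - x) \<partial>lborel)"
          by (intro Bochner_Integration.integral_cong refl) (auto simp: indicator_def)
        then show ?thesis using g[of u] True x by simp
      qed (simp add: rker_def)
    qed
    also have "\<dots> = (\<integral>t. (\<integral>u. ?F t u \<partial>lborel) \<partial>lborel)"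
      by (rule lborel_pair.Fubini_integral[OF int])
    also have "\<dots> = (\<integral>t. G t * frac_pow s (t - x) \<partial>lborel)"
      by (simp only: has_bochner_integral_integral_eq[OF hb])
    finally show "RI s g x = (\<integral>t. G t * frac_pow s (t - x) \<partial>lborel)" .
  qed
  define X where "X n = inverse (real (Suc n))" for n
  have X: "X \<longlonglongrightarrow> 0" "\<And>n. 0 < X n"
    using LIMSEQ_inverse_real_of_nat by (auto simp: X_def[abs_def])
  have 1: "(\<lambda>n. (RI s g (c + X n) - RI s g c) / X n) \<longlonglongrightarrow> D"
  proof (rule filterlim_compose[OF lim])
    show "filterlim X (at_right 0) sequentially"
      using X by (auto simp: filterlim_at less_imp_neq[OF X(2), THEN not_sym] intro!: always_eventually)
  qed
  have eq: "(RI s g (c + X n) - RI s g c) / X n = - (\<integral>t. G t * ((frac_pow s (t - c) - frac_pow s (t - c - X n)) / X n) \<partial>lborel)" for n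
  proof -
    have c': "c \<le> c + X n" using X(2)[of n] by simp
    have "(\<integral>t. G t * ((frac_pow s (t - c) - frac_pow s (t - c - X n)) / X n) \<partial>lborel) =
      (\<integral>t. (G t * frac_pow s (t - c) - G t * frac_pow s (t - (c + X n))) / X n \<partial>lborel)"
      by (simp add: right_diff_distrib diff_diff_eq)
    also have "\<dots> = ((\<integral>t. G t * frac_pow s (t - c) \<partial>lborel) - (\<integral>t. G t * frac_pow s (t - (c + X n)) \<partial>lborel)) / X n"
      by (subst integral_divide_zero, subst Bochner_Integration.integral_diff) (use fub(1) c' in auto)
    finally have E: "(\<integral>t. G t * ((frac_pow s (t - c) - frac_pow s (t - c - X n)) / X n) \<partial>lborel) = \<dots>" .
    show ?thesis
      unfolding E fub(2)[OF order_refl] fub(2)[OF c'] by (simp only: minus_divide_left minus_diff_eq)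
  qed
  have 2: "(\<lambda>n. \<integral>t. G t * ((frac_pow s (t - c) - frac_pow s (t - c - X n)) / X n) \<partial>lborel) \<longlonglongrightarrow> (\<integral>t. G t * rker s (t - c) \<partial>lborel)"
  proof (rule integral_dominated_convergence[where w="\<lambda>t. \<bar>G t * rker s (t - c)\<bar> / s"])
    show "integrable lborel (\<lambda>t. \<bar>G t * rker s (t - c)\<bar> / s)" using G(2) by auto
    show "AE t in lborel. (\<lambda>n. G t * ((frac_pow s (t - c) - frac_pow s (t - c - X n)) / X n)) \<longlonglongrightarrow> G t * rker s (t - c)"
      by (intro AE_I2 tendsto_mult tendsto_const frac_pow_quotient_tendsto s X)
    show "AE t in lborel. norm (G t * ((frac_pow s (t - c) - frac_pow s (t - c - X n)) / X n)) \<le> \<bar>G t * rker s (t - c)\<bar> / s" for n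
    proof (rule AE_I2)
      fix t
      have "norm (G t * ((frac_pow s (t - c) - frac_pow s (t - c - X n)) / X n)) = \<bar>G t\<bar> * ((frac_pow s (t - c) - frac_pow s (t - c - X n)) / X n)"
        using frac_pow_quotient(1)[OF s X(2), of "t - c" n] by (simp only: real_norm_def abs_mult abs_of_nonneg)
      also have "\<dots> \<le> \<bar>G t\<bar> * (rker s (t - c) / s)"
        by (intro mult_left_mono frac_pow_quotient s X) auto
      finally show "norm (G t * ((frac_pow s (t - c) - frac_pow s (t - c - X n)) / X n)) \<le> \<bar>G t * rker s (t - c)\<bar> / s"
        by (simp add: abs_mult)
    qed
  qed measurable
  have "(\<lambda>n. (RI s g (c + X n) - RI s g c) / X n) \<longlonglongrightarrow> - (\<integral>t. G t * rker s (t - c) \<partial>lborel)"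
    unfolding eq by (intro tendsto_minus 2)
  with 1 show ?thesis by (rule LIMSEQ_unique)
qed

section \<open>The variational problem\<close>

lemma C1_on_IccE:
  fixes y :: "real \<Rightarrow> real"
  assumes "C1_on {a..b} y"
  obtains f where "continuous_on {a..b} f" "\<And>x. x \<in> {a..b} \<Longrightarrow> (y has_real_derivative f x) (at x within {a..b})"
proof -
  obtain f' :: "real \<Rightarrow> real \<Rightarrow>\<^sub>L real" where f': "\<And>x. x \<in> {a..b} \<Longrightarrow> (y has_derivative blinfun_apply (f' x)) (at x within {a..b})"
    "continuous_on {a..b} f'"
    using assms unfolding C1_on_def by blast
  show ?thesis
  proof (rule that[of "\<lambda>x. blinfun_apply (f' x) 1"])
    show "continuous_on {a..b} (\<lambda>x. blinfun_apply (f' x) 1)"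
      using f'(2) by (intro continuous_intros)
    fix x assume "x \<in> {a..b}"
    moreover have "blinfun_apply (f' x) = (*) (blinfun_apply (f' x) 1)"
    proof
      fix h
      show "blinfun_apply (f' x) h = blinfun_apply (f' x) 1 * h"
        using blinfun.scaleR_right[of "f' x" h 1] by (simp add: mult.commute)
    qed
    ultimately show "(y has_real_derivative blinfun_apply (f' x) 1) (at x within {a..b})"
      using f'(1)[of x] by (simp add: has_field_derivative_def)
  qed
qed

lemma C1_on_IccI:
  fixes y :: "real \<Rightarrow> real"
  assumes "continuous_on {a..b} f" "\<And>x. x \<in> {a..b} \<Longrightarrow> (y has_real_derivative f x) (at x within {a..b})"
  shows "C1_on {a..b} y"
  unfolding C1_on_def
proof (intro exI[of _ "\<lambda>x. f x *\<^sub>R id_blinfun"] conjI ballI)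
  show "continuous_on {a..b} (\<lambda>x. f x *\<^sub>R (id_blinfun :: real \<Rightarrow>\<^sub>L real))"
    using assms(1) by (intro continuous_intros)
  fix x assume "x \<in> {a..b}"
  moreover have "blinfun_apply (f x *\<^sub>R (id_blinfun :: real \<Rightarrow>\<^sub>L real)) = (*) (f x)"
    by (auto simp: blinfun.scaleR_left)
  ultimately show "(y has_derivative blinfun_apply (f x *\<^sub>R id_blinfun)) (at x within {a..b})"
    using assms(2)[of x] by (simp add: has_field_derivative_def)
qed

lemma has_field_derivative_interior:
  assumes "(y has_real_derivative D) (at x within {a..b})" "a < x" "x < b"
  shows "(y has_real_derivative D) (at x)"
  using assms by (subst (asm) at_within_interior) auto

lemma continuous_on_indicator_bounded:
  fixes f :: "real \<Rightarrow> real"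
  assumes f: "continuous_on {a..b} f" and ab: "a \<le> b"
  obtains M where "bounded_support (\<lambda>t. indicator {a..b} t * f t) M a b"
proof -
  have "bounded (f ` {a..b})"
    by (intro compact_imp_bounded compact_continuous_image f compact_Icc)
  then obtain M where M: "\<forall>x\<in>{a..b}. \<bar>f x\<bar> \<le> M"
    unfolding bounded_iff by auto
  have "0 \<le> M" using M[rule_format, of a] ab by auto
  have "(\<lambda>t. indicator {a..b} t *\<^sub>R f t) \<in> borel_measurable borel"
    using f by (intro borel_measurable_continuous_on_indicator) auto
  then have "bounded_support (\<lambda>t. indicator {a..b} t * f t) M a b"
    using M ab \<open>0 \<le> M\<close> by unfold_locales (auto simp: indicator_def)
  then show ?thesis by (rule that)
qed

text \<open>\<open>deriv y\<close> is two-sided and agrees with \<open>f\<close> only in the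
  interior, which is enough: the end points a and x form a null set.\<close>

lemma left_caputo_eq_LI:
  assumes y: "\<And>x. x \<in> {a..b} \<Longrightarrow> (y has_real_derivative f x) (at x within {a..b})"
    and f: "continuous_on {a..b} f" and x: "x \<in> {a..b}"
  shows "left_caputo \<alpha> a y x = LI (1 - \<alpha>) (\<lambda>t. indicator {a..b} t * f t) x / Gamma (1 - \<alpha>)"
proof -
  have ab: "a \<le> b" using x by auto
  obtain M where "bounded_support (\<lambda>t. indicator {a..b} t * f t) M a b"
    using continuous_on_indicator_bounded[OF f ab] by blast
  then have [measurable]: "(\<lambda>t. indicator {a..b} t * f t) \<in> borel_measurable borel"
    by (simp add: bounded_support_def)
  let ?g = "\<lambda>t. indicator {a..b} t * f t * rker (1 - \<alpha>) (x - t)"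
  have "AE t in lborel. indicator {a..x} t *\<^sub>R (deriv y t / (x - t) powr (1 - (1 - \<alpha>))) = ?g t"
    using AE_lborel_singleton[of a] AE_lborel_singleton[of x]
  proof eventually_elim
    fix t assume t: "t \<noteq> a" "t \<noteq> x"
    show "indicator {a..x} t *\<^sub>R (deriv y t / (x - t) powr (1 - (1 - \<alpha>))) = ?g t"
    proof (cases "a < t \<and> t < x")
      case True
      then have "(y has_real_derivative f t) (at t)"
        using x by (intro has_field_derivative_interior[OF y]) auto
      then have "deriv y t = f t" by (rule DERIV_imp_deriv)
      then show ?thesis using True x by (simp add: rker_def powr_minus divide_inverse)
    next
      case False
      then show ?thesis using t by (auto simp: indicator_def rker_def)
    qed
  qed
  from lebesgue_integral_AE_borel[OF _ this]
  show ?thesis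
    unfolding left_caputo_def left_RL_integral_def set_lebesgue_integral_def LI_def by simp
qed

section \<open>Lagrangians that are twice continuously differentiable on a strip\<close>

context
  fixes a b :: real and L :: "real \<times> real \<times> real \<Rightarrow> real"
begin

abbreviation (input) "strip \<equiv> {a..b} \<times> (UNIV :: (real \<times> real) set)"
abbreviation (input) "slab N \<equiv> {a..b} \<times> {-N..N} \<times> {-N..N :: real}"

text \<open>A slab is compact and convex, so one bound \<open>B\<close> for the second derivative
  gives both the Lipschitz constant of the first derivative and the quadratic Taylor remainder along
  segments. The former serves the energy of \<open>p\<close>, the latter the first
  variation.\<close>

lemma C2_onE:
  assumes "C2_on strip L"
  obtains L' :: "real \<times> real \<times> real \<Rightarrow> (real \<times> real \<times> real) \<Rightarrow>\<^sub>L real" where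
    "\<And>z. z \<in> strip \<Longrightarrow> (L has_derivative blinfun_apply (L' z)) (at z within strip)"
    "continuous_on strip L'"
    "\<And>N. \<exists>B\<ge>0. \<forall>z\<in>slab N. \<forall>z'\<in>slab N. norm (L' z - L' z') \<le> B * norm (z - z') \<and>
       \<bar>L z' - L z - L' z (z' - z)\<bar> \<le> B * (norm (z' - z))^2"
proof -
  obtain L' :: "real \<times> real \<times> real \<Rightarrow> (real \<times> real \<times> real) \<Rightarrow>\<^sub>L real" where
    L': "\<And>z. z \<in> strip \<Longrightarrow> (L has_derivative blinfun_apply (L' z)) (at z within strip)" and C1: "C1_on strip L'"
    using assms unfolding C2_on_def by blast
  obtain L'' :: "real \<times> real \<times> real \<Rightarrow> (real \<times> real \<times> real) \<Rightarrow>\<^sub>L (real \<times> real \<times> real) \<Rightarrow>\<^sub>L real" where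
    L'': "\<And>z. z \<in> strip \<Longrightarrow> (L' has_derivative blinfun_apply (L'' z)) (at z within strip)" and cL'': "continuous_on strip L''"
    using C1 unfolding C1_on_def by blast
  show ?thesis
  proof (rule that)
    show "(L has_derivative blinfun_apply (L' z)) (at z within strip)" if "z \<in> strip" for z
      using L' that by blast
    show "continuous_on strip L'"
      using L'' by (rule has_derivative_continuous_on)
    fix N :: real
    have sub: "slab N \<subseteq> strip" by auto
    have "bounded (L'' ` slab N)"
      by (intro compact_imp_bounded compact_continuous_image continuous_on_subset[OF cL''] sub compact_Times compact_Icc)
    then obtain B where B: "\<And>z. z \<in> slab N \<Longrightarrow> norm (L'' z) \<le> B" "0 < B"
      unfolding bounded_pos by auto
    have cvx: "convex (slab N)" by (intro convex_Times convex_real_interval)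
    have lip: "norm (L' z - L' z') \<le> B * norm (z - z')" if "z \<in> slab N" "z' \<in> slab N" for z z'
    proof (rule differentiable_bound[OF cvx _ _ that])
      fix w assume w: "w \<in> slab N"
      then show "(L' has_derivative blinfun_apply (L'' w)) (at w within slab N)"
        using has_derivative_subset[OF L'' sub] sub by blast
      show "onorm (blinfun_apply (L'' w)) \<le> B"
        using B(1)[OF w] by (simp add: norm_blinfun.rep_eq)
    qed
    have taylor: "\<bar>L z' - L z - L' z (z' - z)\<bar> \<le> B * (norm (z' - z))^2" if z: "z \<in> slab N" "z' \<in> slab N" for z z'
    proof -
      have seg: "closed_segment z z' \<subseteq> slab N"
        by (rule closed_segment_subset) (use z cvx in auto)
      have "norm (L z' - L z - L' z (z' - z)) \<le> norm (z' - z) * (B * norm (z' - z))"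
      proof (rule differentiable_bound_linearization[where S = "closed_segment z z'"])
        show "z + t *\<^sub>R (z' - z) \<in> closed_segment z z'" if "t \<in> {0..1}" for t
          using that by (auto simp: in_segment algebra_simps intro!: exI[of _ t])
        show "z \<in> closed_segment z z'" by simp
        fix w assume w: "w \<in> closed_segment z z'"
        then show "(L has_derivative blinfun_apply (L' w)) (at w within closed_segment z z')"
          using has_derivative_subset[OF L', of w "closed_segment z z'"] seg sub by blast
        have "onorm (blinfun_apply (L' w) - blinfun_apply (L' z)) = norm (L' w - L' z)"
          by (simp add: norm_blinfun.rep_eq minus_blinfun.rep_eq fun_diff_def)
        also have "\<dots> \<le> B * norm (w - z)" using w seg z by (intro lip) auto
        also have "\<dots> \<le> B * norm (z' - z)"
          using segment_bound(1)[OF w] B(2) by (intro mult_left_mono) auto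
        finally show "onorm (blinfun_apply (L' w) - blinfun_apply (L' z)) \<le> B * norm (z' - z)" .
      qed
      then show ?thesis by (simp add: power2_eq_square mult_ac)
    qed
    show "\<exists>B\<ge>0. \<forall>z\<in>slab N. \<forall>z'\<in>slab N. norm (L' z - L' z') \<le> B * norm (z - z') \<and>
       \<bar>L z' - L z - L' z (z' - z)\<bar> \<le> B * (norm (z' - z))^2"
      using lip taylor B(2) by (intro exI[of _ B]) auto
  qed
qed

text \<open>The lines in the second and third coordinate stay inside the strip even for x = a and x
  = b, so the derivative relative to the strip yields genuine partial derivatives.\<close>

lemma
  fixes L' :: "real \<times> real \<times> real \<Rightarrow> (real \<times> real \<times> real) \<Rightarrow>\<^sub>L real"
  assumes L': "\<And>z. z \<in> strip \<Longrightarrow> (L has_derivative blinfun_apply (L' z)) (at z within strip)" and x: "x \<in> {a..b}"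
  shows partial2_eq: "partial2 L x y v = L' (x, y, v) (0, 1, 0)"
    and partial3_eq: "partial3 L x y v = L' (x, y, v) (0, 0, 1)"
proof -
  have chain: "((\<lambda>s. L (\<phi> s)) has_real_derivative L' (\<phi> s) e) (at s)"
    if \<phi>: "(\<phi> has_derivative (\<lambda>h. h *\<^sub>R e)) (at s)" and r: "range \<phi> \<subseteq> strip" for \<phi> e s
  proof -
    have "(L has_derivative blinfun_apply (L' (\<phi> s))) (at (\<phi> s) within range \<phi>)"
      using has_derivative_subset[OF L' r] r by blast
    from diff_chain_within[OF \<phi> this]
    have "((\<lambda>s. L (\<phi> s)) has_derivative (\<lambda>h. L' (\<phi> s) (h *\<^sub>R e))) (at s)"
      by (simp add: o_def)
    then show ?thesis by (simp add: has_field_derivative_def blinfun.scaleR_right mult_commute_abs)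
  qed
  have "((\<lambda>s. L (x, s, v)) has_real_derivative L' (x, y, v) (0, 1, 0)) (at y)"
    by (rule chain) (use x in \<open>auto intro!: derivative_eq_intros\<close>)
  then show "partial2 L x y v = L' (x, y, v) (0, 1, 0)"
    unfolding partial2_def by (rule DERIV_imp_deriv)
  have "((\<lambda>s. L (x, y, s)) has_real_derivative L' (x, y, v) (0, 0, 1)) (at v)"
    by (rule chain) (use x in \<open>auto intro!: derivative_eq_intros\<close>)
  then show "partial3 L x y v = L' (x, y, v) (0, 0, 1)"
    unfolding partial3_def by (rule DERIV_imp_deriv)
qed

end

section \<open>Integrals of order one, adjointness and uniqueness for the Abel equation\<close>

lemma continuous_on_integrable_indicator:
  fixes h :: "real \<Rightarrow> real"
  assumes "continuous_on {a..b} h"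
  shows "integrable lborel (\<lambda>x. indicator {a..b} x * h x)"
    and "(\<integral>x. indicator {a..b} x * h x \<partial>lborel) = integral {a..b} h"
proof -
  have s: "set_integrable lborel {a..b} h"
    by (rule borel_integrable_atLeastAtMost') fact
  then show "integrable lborel (\<lambda>x. indicator {a..b} x * h x)"
    by (simp add: set_integrable_def)
  show "(\<integral>x. indicator {a..b} x * h x \<partial>lborel) = integral {a..b} h"
    using set_borel_integral_eq_integral(2)[OF s] by (simp add: set_lebesgue_integral_def)
qed

text \<open>At order 1 \<open>LI\<close> and \<open>RI\<close> are ordinary integrals, so both terms
  of the first variation can be moved by the same adjointness lemma.\<close>

lemma rker_1: "rker 1 t = indicator {0<..} t"
  by (simp add: rker_def indicator_def)

lemma LI_1_eq_integral:
  assumes f: "continuous_on {a..b} f" and x: "x \<in> {a..b}"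
  shows "LI 1 (\<lambda>t. indicator {a..b} t * f t) x = integral {a..x} f"
proof -
  have c: "continuous_on {a..x} f" using f by (rule continuous_on_subset) (use x in auto)
  have m: "(\<lambda>t. indicator {a..b} t * f t) \<in> borel_measurable borel" "(\<lambda>t. indicator {a..x} t * f t) \<in> borel_measurable borel"
    using continuous_on_integrable_indicator(1)[OF f] continuous_on_integrable_indicator(1)[OF c] by auto
  have "LI 1 (\<lambda>t. indicator {a..b} t * f t) x = (\<integral>t. indicator {a..x} t * f t \<partial>lborel)"
    unfolding LI_def
  proof (rule integral_cong_AE)
    show "AE t in lborel. indicator {a..b} t * f t * rker 1 (x - t) = indicator {a..x} t * f t"
      using AE_lborel_singleton[of x]
      by eventually_elim (use x in \<open>auto simp: rker_1 indicator_def\<close>)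
  qed (use m in measurable)
  then show ?thesis using continuous_on_integrable_indicator(2)[OF c] by simp
qed

lemma RI_1_eq_integral:
  assumes f: "continuous_on {a..b} f" and x: "x \<in> {a..b}"
  shows "RI 1 (\<lambda>t. indicator {a..<b} t * f t) x = integral {x..b} f"
proof -
  have c: "continuous_on {x..b} f" using f by (rule continuous_on_subset) (use x in auto)
  have m: "(\<lambda>t. indicator {a..b} t * f t) \<in> borel_measurable borel" "(\<lambda>t. indicator {x..b} t * f t) \<in> borel_measurable borel"
    using continuous_on_integrable_indicator(1)[OF f] continuous_on_integrable_indicator(1)[OF c] by auto
  have eq: "indicator {a..<b} t * f t = indicator {a..<b} t * (indicator {a..b} t * f t)" for t
    by (auto simp: indicator_def)
  have m': "(\<lambda>t. indicator {a..<b} t * f t) \<in> borel_measurable borel"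
    unfolding eq using m(1) by measurable
  have "RI 1 (\<lambda>t. indicator {a..<b} t * f t) x = (\<integral>t. indicator {x..b} t * f t \<partial>lborel)"
    unfolding RI_def
  proof (rule integral_cong_AE)
    show "AE t in lborel. indicator {a..<b} t * f t * rker 1 (t - x) = indicator {x..b} t * f t"
      using AE_lborel_singleton[of x] AE_lborel_singleton[of b]
      by eventually_elim (use x in \<open>auto simp: rker_1 indicator_def\<close>)
  qed (use m m' in measurable)
  then show ?thesis using continuous_on_integrable_indicator(2)[OF c] by simp
qed

lemma RI_1_has_derivative:
  assumes f: "continuous_on {a..b} f" and x: "x \<in> {a..b}"
  shows "(RI 1 (\<lambda>t. indicator {a..<b} t * f t) has_real_derivative - f x) (at x within {a..b})"
proof -
  show ?thesis
    by (rule has_field_derivative_transform_within[OF integral_has_real_derivative'[OF f x] zero_less_one x])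
       (simp add: RI_1_eq_integral[OF f])
qed

lemma continuous_on_RI_1:
  assumes f: "continuous_on {a..b} f"
  shows "continuous_on {a..b} (RI 1 (\<lambda>t. indicator {a..<b} t * f t))"
  using RI_1_has_derivative[OF f] by (rule DERIV_continuous_on)

lemma integral_tails_zero_imp_zero:
  fixes w :: "real \<Rightarrow> real"
  assumes ab: "a < b" and w: "continuous_on {a..b} w" and z: "\<And>x. x \<in> {a..b} \<Longrightarrow> RI 1 (\<lambda>t. indicator {a..<b} t * w t) x = 0"
    and x: "x \<in> {a..b}"
  shows "w x = 0"
proof -
  have "((\<lambda>x. 0) has_real_derivative - w x) (at x within {a..b})"
    by (rule has_field_derivative_transform_within[OF RI_1_has_derivative[OF w x] zero_less_one x]) (rule z)
  moreover have "((\<lambda>x. 0) has_real_derivative 0) (at x within {a..b})" by simp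
  ultimately have "- w x = 0"
    unfolding has_real_derivative_iff_has_vector_derivative
    using vector_derivative_unique_within_closed_interval[of a b x "\<lambda>x. 0" "- w x" 0] ab x by simp
  then show ?thesis by simp
qed

text \<open>Fractional integration by parts: the same double integral with kernel
  \<open>rker s (x - u)\<close>, read in the two orders.\<close>

lemma LI_RI_adjoint:
  assumes s: "0 < s" and \<psi>: "bounded_support \<psi> M a b" and g: "bounded_left_support g P b"
    and g0: "\<And>x. x < a \<Longrightarrow> g x = 0"
  shows "(\<integral>x. g x * LI s \<psi> x \<partial>lborel) = (\<integral>u. \<psi> u * RI s g u \<partial>lborel)"
proof -
  interpret psi: bounded_support \<psi> M a b by fact
  interpret g: bounded_left_support g P b by fact
  let ?F = "\<lambda>u x. \<psi> u * (g x * rker s (x - u))"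
  have ii: "integrable lborel (?F u)" for u
    by (intro integrable_mult_right g.RI_integrable s)
  have int: "integrable (lborel \<Otimes>\<^sub>M lborel) (\<lambda>(u, x). ?F u x)"
  proof (rule lborel_pair.Fubini_integrable)
    show "integrable lborel (\<lambda>u. \<integral>x. norm (case (u, x) of (u, x) \<Rightarrow> ?F u x) \<partial>lborel)"
    proof (rule Bochner_Integration.integrable_bound[where f="\<lambda>u. indicator {a..b} u * (M * (P * ((b - a) powr s / s)))"])
      show "integrable lborel (\<lambda>u. indicator {a..b} u * (M * (P * ((b - a) powr s / s))))"
        by (intro integrable_mult_left integrable_real_indicator) (auto simp: emeasure_lborel_Icc_eq)
      show "AE u in lborel. norm (\<integral>x. norm (case (u, x) of (u, x) \<Rightarrow> ?F u x) \<partial>lborel) \<le> norm (indicator {a..b} u * (M * (P * ((b - a) powr s / s))))"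
      proof (rule AE_I2)
        fix u
        have hb: "has_bochner_integral lborel (\<lambda>x. P * (indicator {..b} x * rker s (x - u))) (P * frac_pow s (b - u))"
          by (intro has_bochner_integral_mult_right has_bochner_integral_rker_Icc s)
        have "(\<integral>x. \<bar>g x * rker s (x - u)\<bar> \<partial>lborel) \<le> (\<integral>x. P * (indicator {..b} x * rker s (x - u)) \<partial>lborel)"
        proof (rule integral_mono)
          show "integrable lborel (\<lambda>x. \<bar>g x * rker s (x - u)\<bar>)" by (intro integrable_abs g.RI_integrable s)
          show "integrable lborel (\<lambda>x. P * (indicator {..b} x * rker s (x - u)))" using hb by (simp add: has_bochner_integral_iff)
          fix x
          have "\<bar>g x\<bar> * rker s (x - u) \<le> P * indicator {..b} x * rker s (x - u)"
            using g.p_bound[of x] g.p_zero[of x] g.P_nonneg by (intro mult_right_mono) (auto simp: indicator_def)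
          then show "\<bar>g x * rker s (x - u)\<bar> \<le> P * (indicator {..b} x * rker s (x - u))" by (simp add: abs_mult mult.assoc)
        qed
        also have "\<dots> = P * frac_pow s (b - u)" using hb by (rule has_bochner_integral_integral_eq)
        finally have I: "(\<integral>x. \<bar>g x * rker s (x - u)\<bar> \<partial>lborel) \<le> P * frac_pow s (b - u)" .
        have "\<bar>\<psi> u\<bar> * (\<integral>x. \<bar>g x * rker s (x - u)\<bar> \<partial>lborel) \<le> indicator {a..b} u * (M * (P * ((b - a) powr s / s)))"
        proof (cases "u \<in> {a..b}")
          case True
          have "frac_pow s (b - u) \<le> (b - a) powr s / s"
            using True s by (auto simp: frac_pow_def intro!: divide_right_mono powr_mono2)
          then have "P * frac_pow s (b - u) \<le> P * ((b - a) powr s / s)" using g.P_nonneg by (rule mult_left_mono)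
          then have "\<bar>\<psi> u\<bar> * (\<integral>x. \<bar>g x * rker s (x - u)\<bar> \<partial>lborel) \<le> M * (P * ((b - a) powr s / s))"
            using I psi.M_nonneg by (intro mult_mono psi.f_bound) auto
          then show ?thesis using True by simp
        qed (use psi.f_supp in simp)
        moreover have "(\<integral>x. norm (?F u x) \<partial>lborel) = \<bar>\<psi> u\<bar> * (\<integral>x. \<bar>g x * rker s (x - u)\<bar> \<partial>lborel)"
          unfolding real_norm_def abs_mult[of "\<psi> u"] by simp
        moreover have "0 \<le> (\<integral>x. norm (?F u x) \<partial>lborel)" by simp
        ultimately show "norm (\<integral>x. norm (case (u, x) of (u, x) \<Rightarrow> ?F u x) \<partial>lborel) \<le> norm (indicator {a..b} u * (M * (P * ((b - a) powr s / s))))"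
          unfolding prod.case real_norm_def[of "integral\<^sup>L _ _"] real_norm_def[of "_ * _"] by linarith
      qed
    qed measurable
  qed (use ii in auto)
  have "(\<integral>x. g x * LI s \<psi> x \<partial>lborel) = (\<integral>x. (\<integral>u. ?F u x \<partial>lborel) \<partial>lborel)"
    unfolding LI_def by (simp add: mult_ac flip: integral_mult_right_zero)
  also have "\<dots> = (\<integral>u. (\<integral>x. ?F u x \<partial>lborel) \<partial>lborel)"
    by (rule lborel_pair.Fubini_integral[OF int])
  also have "\<dots> = (\<integral>u. \<psi> u * RI s g u \<partial>lborel)"
    unfolding RI_def by simp
  finally show ?thesis .
qed

text \<open>The cut is half-open because \<open>bounded_left_support\<close> demands the value 0 at
  \<open>b\<close> itself.\<close>

lemma continuous_on_bounded_left_support: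
  fixes h :: "real \<Rightarrow> real"
  assumes h: "continuous_on {a..b} h" and ab: "a \<le> b"
  obtains M where "bounded_left_support (\<lambda>t. indicator {a..<b} t * h t) M b"
proof -
  obtain M where "bounded_support (\<lambda>t. indicator {a..b} t * h t) M a b"
    using continuous_on_indicator_bounded[OF h ab] by blast
  then interpret bounded_support "\<lambda>t. indicator {a..b} t * h t" M a b .
  have e: "indicator {a..<b} t * h t = indicator {a..<b} t * (indicator {a..b} t * h t)" for t by (auto simp: indicator_def)
  have "(\<lambda>t. indicator {a..<b} t * h t) \<in> borel_measurable borel" unfolding e using f_meas by measurable
  moreover have "\<bar>indicator {a..<b} t * h t\<bar> \<le> M" for t using f_bound[of t] M_nonneg by (auto simp: indicator_def split: if_splits)
  ultimately show ?thesis by (intro that[of M]) (unfold_locales, auto)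
qed

lemma (in bounded_left_support) continuous_on_RI:
  assumes s: "0 < s" "s < 1"
  shows "continuous_on A (RI s p)"
proof -
  have "continuous_on {c..} (RI s p)" for c
  proof (rule Holder_imp_continuous_on)
    fix x h :: real assume h: "0 \<le> h"
    \<comment> \<open>Boundedness enters as Hoelder continuity of exponent 0. Here
      \<open>t powr 0\<close> is 1 for t > 0 but 0 for t = 0, where the increment vanishes as
      well.\<close>
    show "\<bar>RI s p (x + h) - RI s p x\<bar> \<le> 2 * P * (\<integral>t. (1 + \<bar>t\<bar>) powr 0 * \<bar>rdiff s t\<bar> \<partial>lborel) * h powr (s + 0)"
    proof (rule RI_Holder[OF s _ _ _ h])
      fix t :: real assume "0 \<le> t"
      then show "\<bar>p (x + t) - p x\<bar> \<le> 2 * P * t powr 0"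
        using p_bound[of "x + t"] p_bound[of x] by (cases "t = 0") auto
    qed (use s in auto)
  qed (use s in auto)
  then have "continuous (at x) (RI s p)" for x
    using continuous_on_interior[of "{x - 1..}" "RI s p" x] by (simp add: interior_Ici[of "x - 1" "x - 2"])
  then show ?thesis by (simp add: continuous_at_imp_continuous_on)
qed

text \<open>Abel inversion, by composing twice with the semigroup law.\<close>

lemma RI_inversion:
  assumes ab: "a < b" and \<alpha>: "0 < \<alpha>" "\<alpha> < 1"
    and p: "continuous_on {a..b} p" and g: "continuous_on {a..b} g"
    and eq: "\<And>x. x \<in> {a..b} \<Longrightarrow> RI (1 - \<alpha>) (\<lambda>t. indicator {a..<b} t * g t) x = - Gamma (1 - \<alpha>) * RI 1 (\<lambda>t. indicator {a..<b} t * p t) x"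
    and x: "x \<in> {a..b}"
  shows "g x = - RI \<alpha> (\<lambda>t. indicator {a..<b} t * p t) x / Gamma \<alpha>"
proof -
  define s where "s = 1 - \<alpha>"
  have s: "0 < s" "s < 1" "1 - s = \<alpha>" using \<alpha> by (auto simp: s_def)
  define k where "k = 1 / Gamma \<alpha>"
  have Gp: "0 < Gamma \<alpha>" "0 < Gamma s" using \<alpha> s by (auto intro: Gamma_real_pos)
  have Beta: "Beta s \<alpha> = Gamma \<alpha> * Gamma s" "Beta \<alpha> s = Gamma \<alpha> * Gamma s"
    by (auto simp: Beta_def s_def)
  define p0 where "p0 t = indicator {a..<b} t * p t" for t
  define g0 where "g0 t = indicator {a..<b} t * g t" for t
  have bls: "\<exists>M. bounded_left_support (\<lambda>t. indicator {a..<b} t * h t) M b" if "continuous_on {a..b} h" for h :: "real \<Rightarrow> real"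
    using continuous_on_bounded_left_support[OF that] ab by (metis less_imp_le)
  obtain Mp where "bounded_left_support p0 Mp b" using bls[OF p] unfolding p0_def[abs_def] by blast
  then interpret p0: bounded_left_support p0 Mp b .
  obtain Mg where "bounded_left_support g0 Mg b" using bls[OF g] unfolding g0_def[abs_def] by blast
  then interpret g0: bounded_left_support g0 Mg b .
  have cRI: "continuous_on {a..b} (RI \<alpha> p0)" by (rule p0.continuous_on_RI[OF \<alpha>])
  \<comment> \<open>The defect of the claimed formula. Its integral of order s = 1 - \<alpha>
    vanishes by hypothesis and the semigroup law; one more integration, of order \<alpha>, makes the
    plain integral of \<open>w\<close> vanish, and differentiating gives w = 0.\<close>
  define w where "w t = g t + k * RI \<alpha> p0 t" for t
  have cw: "continuous_on {a..b} w" unfolding w_def by (intro continuous_intros g cRI)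
  define w0 where "w0 t = indicator {a..<b} t * w t" for t
  obtain Mw where "bounded_left_support w0 Mw b" using bls[OF cw] unfolding w0_def[abs_def] by blast
  then interpret w0: bounded_left_support w0 Mw b .
  obtain Mr where "bounded_left_support (\<lambda>t. indicator {a..<b} t * RI \<alpha> p0 t) Mr b" using bls[OF cRI] by blast
  then interpret r0: bounded_left_support "\<lambda>t. indicator {a..<b} t * RI \<alpha> p0 t" Mr b .
  have z: "RI s w0 x = 0" if x: "a \<le> x" for x
  proof (cases "x \<le> b")
    case True
    have "RI s w0 x = (\<integral>t. g0 t * rker s (t - x) + k * (indicator {a..<b} t * RI \<alpha> p0 t * rker s (t - x)) \<partial>lborel)"
      unfolding RI_def[of s] w0_def w_def g0_def by (simp add: algebra_simps)
    also have "\<dots> = RI s g0 x + k * RI s (\<lambda>t. indicator {a..<b} t * RI \<alpha> p0 t) x"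
      unfolding RI_def[of s] using g0.RI_integrable[OF s(1), of x] r0.RI_integrable[OF s(1), of x] by simp
    \<comment> \<open>The cut may be dropped: only t > x \<ge> a is seen, and
      \<open>RI \<alpha> p0\<close> vanishes from b on.\<close>
    also have "RI s (\<lambda>t. indicator {a..<b} t * RI \<alpha> p0 t) x = RI s (RI \<alpha> p0) x"
      unfolding RI_def[of s] using x p0.RI_zero
      by (intro Bochner_Integration.integral_cong refl) (auto simp: indicator_def rker_def)
    also have "\<dots> = Gamma \<alpha> * Gamma s * RI 1 p0 x"
      using p0.RI_RI[OF s(1,2), of x] s(3) unfolding Beta RI_def[of 1] rker_1
      by (simp add: Beta indicator_def mult.commute)
    also have "k * (Gamma \<alpha> * Gamma s * RI 1 p0 x) = Gamma s * RI 1 p0 x"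
      using Gp by (simp add: k_def)
    also have "RI s g0 x + Gamma s * RI 1 p0 x = 0"
      using eq[of x] x True by (simp add: s_def g0_def[abs_def] p0_def[abs_def])
    finally show ?thesis .
  qed (use w0.RI_zero in simp)
  have "RI 1 w0 x = 0" if x: "x \<in> {a..b}" for x
  proof -
    have "RI s w0 t * rker \<alpha> (t - x) = 0" for t
      using z[of t] x by (cases "x < t") (auto simp: rker_def)
    then have "RI \<alpha> (RI s w0) x = 0"
      unfolding RI_def[of \<alpha>] by (simp only: Bochner_Integration.integral_zero)
    then have "Beta \<alpha> s * RI 1 w0 x = 0"
      using w0.RI_RI[OF \<alpha>, of x] unfolding RI_def[of 1] rker_1
      by (simp add: s_def indicator_def mult.commute)
    then show ?thesis using Gp by (simp add: Beta)
  qed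
  then have "w x = 0"
    using integral_tails_zero_imp_zero[OF ab cw _ x] unfolding w0_def[abs_def] by blast
  then show ?thesis by (simp add: w_def k_def p0_def[abs_def])
qed

section \<open>The first variation and the integrated equation\<close>

lemma zero_if_linear_le_quadratic:
  fixes D C :: real
  assumes C: "0 \<le> C" and le: "\<And>\<epsilon>. \<bar>\<epsilon>\<bar> \<le> 1 \<Longrightarrow> 0 \<le> \<epsilon> * D + C * \<epsilon>^2"
  shows "D = 0"
proof (rule ccontr)
  assume D: "D \<noteq> 0"
  \<comment> \<open>At this step size, in the direction against D, the quadratic term is at most |D|
    / 2 per unit of t, half of the linear one. Writing C + 1 keeps the denominator positive when C =
    0.\<close>
  define t where "t = min 1 (\<bar>D\<bar> / (2 * (C + 1)))"
  have t: "0 < t" "t \<le> 1" "t \<le> \<bar>D\<bar> / (2 * (C + 1))" using D C by (auto simp: t_def)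
  have "0 \<le> (- sgn D * t) * D + C * (- sgn D * t)^2"
    using t by (intro le) (auto simp: abs_mult abs_sgn_eq)
  also have "\<dots> = t * (C * t - \<bar>D\<bar>)"
    using D by (auto simp: sgn_if power2_eq_square algebra_simps abs_if)
  finally have "0 \<le> C * t - \<bar>D\<bar>" using t by (simp add: zero_le_mult_iff)
  moreover have "C * t \<le> (C + 1) * (\<bar>D\<bar> / (2 * (C + 1)))" using t C by (intro mult_mono) auto
  moreover have "(C + 1) * (\<bar>D\<bar> / (2 * (C + 1))) = \<bar>D\<bar> / 2" using C by (simp add: field_simps)
  ultimately show False using D by simp
qed

lemma du_Bois_Reymond:
  fixes W :: "real \<Rightarrow> real"
  assumes ab: "a < b" and W: "continuous_on {a..b} W"
    and orth: "\<And>\<psi>. \<lbrakk>continuous_on {a..b} \<psi>; integral {a..b} \<psi> = 0\<rbrakk> \<Longrightarrow> integral {a..b} (\<lambda>x. \<psi> x * W x) = 0"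
    and x: "x \<in> {a..b}"
  shows "W x = W b"
proof -
  define m where "m = integral {a..b} W / (b - a)"
  \<comment> \<open>The deviation of \<open>W\<close> from its mean is itself an admissible test
    function, and it is orthogonal to \<open>W\<close> only if it is zero.\<close>
  define \<psi> where "\<psi> x = W x - m" for x
  have c: "continuous_on {a..b} \<psi>" unfolding \<psi>_def by (intro continuous_intros W)
  have int: "h integrable_on {a..b}" if "continuous_on {a..b} h" for h :: "real \<Rightarrow> real"
    using that by (rule integrable_continuous_interval)
  have i0: "integral {a..b} \<psi> = 0"
    unfolding \<psi>_def using ab by (subst Henstock_Kurzweil_Integration.integral_diff) (auto simp: m_def int W)
  have "integral {a..b} (\<lambda>x. (\<psi> x)^2) = integral {a..b} (\<lambda>x. \<psi> x * W x - m * \<psi> x)"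
    by (simp add: \<psi>_def power2_eq_square algebra_simps)
  also have "\<dots> = integral {a..b} (\<lambda>x. \<psi> x * W x) - integral {a..b} (\<lambda>x. m * \<psi> x)"
    by (intro Henstock_Kurzweil_Integration.integral_diff int continuous_intros c W)
  also have "\<dots> = 0" using orth[OF c i0] i0 by simp
  finally have "\<forall>x\<in>{a..b}. (\<psi> x)^2 = 0"
    using integral_eq_0_iff[of a b "\<lambda>x. (\<psi> x)^2"] ab c by (auto intro!: continuous_intros)
  then show ?thesis using x ab by (auto simp: \<psi>_def)
qed

text \<open>The derivatives \<open>L'\<close> of the Lagrangian and \<open>f\<close> of the extremal
  are parameters, so the analysis needs neither \<open>deriv\<close> nor one-sided conventions at
  the end points.\<close>

locale extremal_setting =
  fixes a b \<alpha> :: real and L :: "real \<times> real \<times> real \<Rightarrow> real"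
    and L' :: "real \<times> real \<times> real \<Rightarrow> (real \<times> real \<times> real) \<Rightarrow>\<^sub>L real"
    and y f :: "real \<Rightarrow> real"
  assumes ab: "a < b" and \<alpha>: "0 < \<alpha>" "\<alpha> < 1"
    and L': "\<And>z. z \<in> strip a b \<Longrightarrow> (L has_derivative blinfun_apply (L' z)) (at z within strip a b)"
    and L'_cont: "continuous_on (strip a b) L'"
    and L'_Lipschitz: "\<And>N. \<exists>B\<ge>0. \<forall>z\<in>slab a b N. \<forall>z'\<in>slab a b N. norm (L' z - L' z') \<le> B * norm (z - z') \<and>
       \<bar>L z' - L z - L' z (z' - z)\<bar> \<le> B * (norm (z' - z))^2"
    and y: "\<And>x. x \<in> {a..b} \<Longrightarrow> (y has_real_derivative f x) (at x within {a..b})"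
    and f: "continuous_on {a..b} f"
begin

text \<open>The Caputo derivative of any primitive of \<open>h\<close> on [a, b]; as a left
  fractional integral of a function cut off to [a, b] it is defined on the whole line.\<close>

definition capu :: "(real \<Rightarrow> real) \<Rightarrow> real \<Rightarrow> real" where
  "capu h x = LI (1 - \<alpha>) (\<lambda>t. indicator {a..b} t * h t) x / Gamma (1 - \<alpha>)"

definition p :: "real \<Rightarrow> real" where "p x = L' (x, y x, capu f x) (0, 1, 0)"

definition g :: "real \<Rightarrow> real" where "g x = L' (x, y x, capu f x) (0, 0, 1)"

lemma Gamma_pos: "0 < Gamma (1 - \<alpha>)"
  using \<alpha> by (intro Gamma_real_pos) auto

lemma capu_Holder:
  assumes "continuous_on {a..b} h"
  obtains C where "\<And>x t. 0 \<le> t \<Longrightarrow> \<bar>capu h (x + t) - capu h x\<bar> \<le> C * t powr (1 - \<alpha>)"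
proof -
  obtain M where "bounded_support (\<lambda>t. indicator {a..b} t * h t) M a b"
    using continuous_on_indicator_bounded[OF assms] ab by auto
  then interpret h: bounded_support "\<lambda>t. indicator {a..b} t * h t" M a b .
  show ?thesis
  proof (rule that[of "M * (\<integral>t. \<bar>rdiff (1 - \<alpha>) t\<bar> \<partial>lborel) / Gamma (1 - \<alpha>)"])
    fix x t :: real assume t: "0 \<le> t"
    have "\<bar>LI (1 - \<alpha>) (\<lambda>t. indicator {a..b} t * h t) (x + t) - LI (1 - \<alpha>) (\<lambda>t. indicator {a..b} t * h t) x\<bar> / Gamma (1 - \<alpha>)
       \<le> M * (\<integral>t. \<bar>rdiff (1 - \<alpha>) t\<bar> \<partial>lborel) * t powr (1 - \<alpha>) / Gamma (1 - \<alpha>)"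
      using \<alpha> Gamma_pos t by (intro divide_right_mono h.LI_Holder) auto
    then show "\<bar>capu h (x + t) - capu h x\<bar> \<le> M * (\<integral>t. \<bar>rdiff (1 - \<alpha>) t\<bar> \<partial>lborel) / Gamma (1 - \<alpha>) * t powr (1 - \<alpha>)"
      using Gamma_pos unfolding capu_def diff_divide_distrib[symmetric] by simp
  qed
qed

lemma continuous_on_capu:
  assumes "continuous_on {a..b} h"
  shows "continuous_on {a..b} (capu h)"
proof -
  obtain C where C: "\<And>x t. 0 \<le> t \<Longrightarrow> \<bar>capu h (x + t) - capu h x\<bar> \<le> C * t powr (1 - \<alpha>)"
    using capu_Holder[OF assms] by blast
  have "continuous_on {a..} (capu h)"
    by (rule Holder_imp_continuous_on[OF C]) (use \<alpha> in auto)
  then show ?thesis by (rule continuous_on_subset) auto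
qed

lemma continuous_on_y: "continuous_on {a..b} y"
  using y by (rule DERIV_continuous_on)

lemma continuous_on_p: "continuous_on {a..b} p" and continuous_on_g: "continuous_on {a..b} g"
proof -
  have c: "continuous_on {a..b} (\<lambda>x. L' (x, y x, capu f x))"
    by (rule continuous_on_compose2[OF L'_cont]) (auto intro!: continuous_intros continuous_on_y continuous_on_capu f)
  then show "continuous_on {a..b} p" "continuous_on {a..b} g"
    unfolding p_def g_def by (intro continuous_intros c)+
qed

lemma action_eq:
  assumes z: "\<And>x. x \<in> {a..b} \<Longrightarrow> (z has_real_derivative h x) (at x within {a..b})" and h: "continuous_on {a..b} h"
  shows "action \<alpha> a b L z = integral {a..b} (\<lambda>x. L (x, z x, capu h x))"
    and "continuous_on {a..b} (\<lambda>x. L (x, z x, capu h x))"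
proof -
  have L: "continuous_on (strip a b) L" using L' by (rule has_derivative_continuous_on)
  have cz: "continuous_on {a..b} z" using z by (rule DERIV_continuous_on)
  show c: "continuous_on {a..b} (\<lambda>x. L (x, z x, capu h x))"
    by (rule continuous_on_compose2[OF L]) (auto intro!: continuous_intros cz continuous_on_capu h)
  have "indicator {a..b} x *\<^sub>R L (x, z x, left_caputo \<alpha> a z x) = indicator {a..b} x * L (x, z x, capu h x)" for x
    using left_caputo_eq_LI[OF z h, of x \<alpha>] by (simp add: capu_def indicator_def)
  then have "action \<alpha> a b L z = integral\<^sup>L lebesgue (\<lambda>x. indicator {a..b} x * L (x, z x, capu h x))"
    unfolding action_def set_lebesgue_integral_def by (simp only:)
  also have "\<dots> = (\<integral>x. indicator {a..b} x * L (x, z x, capu h x) \<partial>lborel)"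
    by (rule lebesgue_integral_AE_borel) (use continuous_on_integrable_indicator(1)[OF c] in auto)
  also have "\<dots> = integral {a..b} (\<lambda>x. L (x, z x, capu h x))"
    by (rule continuous_on_integrable_indicator(2)[OF c])
  finally show "action \<alpha> a b L z = integral {a..b} (\<lambda>x. L (x, z x, capu h x))" .
qed

lemma capu_linear:
  assumes h: "continuous_on {a..b} h" and k: "continuous_on {a..b} k"
  shows "capu (\<lambda>x. h x + \<epsilon> * k x) x = capu h x + \<epsilon> * capu k x"
proof -
  obtain M N where "bounded_support (\<lambda>t. indicator {a..b} t * h t) M a b" "bounded_support (\<lambda>t. indicator {a..b} t * k t) N a b"
    using continuous_on_indicator_bounded[OF h] continuous_on_indicator_bounded[OF k] ab by (metis less_imp_le)
  then interpret h: bounded_support "\<lambda>t. indicator {a..b} t * h t" M a b + k: bounded_support "\<lambda>t. indicator {a..b} t * k t" N a b .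
  have "LI (1 - \<alpha>) (\<lambda>t. indicator {a..b} t * (h t + \<epsilon> * k t)) x
    = (\<integral>t. indicator {a..b} t * h t * rker (1 - \<alpha>) (x - t) + \<epsilon> * (indicator {a..b} t * k t * rker (1 - \<alpha>) (x - t)) \<partial>lborel)"
    unfolding LI_def by (simp add: algebra_simps)
  also have "\<dots> = LI (1 - \<alpha>) (\<lambda>t. indicator {a..b} t * h t) x + \<epsilon> * LI (1 - \<alpha>) (\<lambda>t. indicator {a..b} t * k t) x"
    unfolding LI_def using h.LI_integrable[of "1 - \<alpha>" x] k.LI_integrable[of "1 - \<alpha>" x] \<alpha> by simp
  finally show ?thesis by (simp add: capu_def add_divide_distrib)
qed

text \<open>The variation is parametrised by its derivative \<psi>: the primitive from a is C1, and
  zero mean of \<psi> makes it vanish at b. Nothing is differentiated under the integral sign; a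
  uniform Taylor remainder quadratic in \<epsilon> suffices, for minima and maxima alike.\<close>

lemma first_variation:
  assumes ext: "is_extremizer \<alpha> a b L ya yb y"
    and \<psi>: "continuous_on {a..b} \<psi>" "integral {a..b} \<psi> = 0"
  shows "integral {a..b} (\<lambda>x. p x * integral {a..x} \<psi> + g x * capu \<psi> x) = 0"
proof -
  define \<eta> where "\<eta> x = integral {a..x} \<psi>" for x
  have d\<eta>: "(\<eta> has_real_derivative \<psi> x) (at x within {a..b})" if "x \<in> {a..b}" for x
    unfolding \<eta>_def using integral_has_real_derivative[OF \<psi>(1) that] .
  have c\<eta>: "continuous_on {a..b} \<eta>" using d\<eta> by (rule DERIV_continuous_on)
  have \<eta>_ends: "\<eta> a = 0" "\<eta> b = 0" using \<psi>(2) by (auto simp: \<eta>_def)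
  define Y where "Y \<epsilon> x = y x + \<epsilon> * \<eta> x" for \<epsilon> x
  have dY: "(Y \<epsilon> has_real_derivative f x + \<epsilon> * \<psi> x) (at x within {a..b})" if "x \<in> {a..b}" for \<epsilon> x
    unfolding Y_def using y[OF that] d\<eta>[OF that] by (auto intro!: derivative_eq_intros)
  have cf: "continuous_on {a..b} (\<lambda>x. f x + \<epsilon> * \<psi> x)" for \<epsilon> by (intro continuous_intros f \<psi>)
  define I where "I \<epsilon> = integral {a..b} (\<lambda>x. L (x, Y \<epsilon> x, capu f x + \<epsilon> * capu \<psi> x))" for \<epsilon>
  have act: "action \<alpha> a b L (Y \<epsilon>) = I \<epsilon>" and cI: "continuous_on {a..b} (\<lambda>x. L (x, Y \<epsilon> x, capu f x + \<epsilon> * capu \<psi> x))" for \<epsilon>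
    using action_eq[OF dY cf, of \<epsilon>] by (simp_all add: I_def capu_linear[OF f \<psi>(1)])
  have adm: "Y \<epsilon> \<in> admissible a b ya yb" for \<epsilon>
  proof -
    have "y a = ya" "y b = yb" using ext by (auto simp: is_extremizer_def admissible_def)
    then show ?thesis
      using C1_on_IccI[OF cf dY, of \<epsilon>] by (auto simp: admissible_def Y_def \<eta>_ends)
  qed
  have act0: "action \<alpha> a b L y = I 0"
    using action_eq(1)[OF y f] by (simp add: I_def Y_def)
  have bnd: "\<exists>N\<ge>0. \<forall>x\<in>{a..b}. \<bar>h x\<bar> \<le> N" if "continuous_on {a..b} h" for h :: "real \<Rightarrow> real"
  proof -
    have "bounded (h ` {a..b})" by (intro compact_imp_bounded compact_continuous_image that compact_Icc)
    then show ?thesis unfolding bounded_pos by (auto intro: less_imp_le)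
  qed
  obtain N1 N2 N3 N4 where N: "0 \<le> N1" "0 \<le> N2" "0 \<le> N3" "0 \<le> N4" "\<forall>x\<in>{a..b}. \<bar>y x\<bar> \<le> N1" "\<forall>x\<in>{a..b}. \<bar>\<eta> x\<bar> \<le> N2"
    "\<forall>x\<in>{a..b}. \<bar>capu f x\<bar> \<le> N3" "\<forall>x\<in>{a..b}. \<bar>capu \<psi> x\<bar> \<le> N4"
    using bnd[OF continuous_on_y] bnd[OF c\<eta>] bnd[OF continuous_on_capu[OF f]] bnd[OF continuous_on_capu[OF \<psi>(1)]] by metis
  \<comment> \<open>Large enough that for |\<epsilon>| \<le> 1 the perturbed arguments of
    \<open>L\<close> remain in the same slab, so that one constant \<open>B\<close> serves all
    \<epsilon>.\<close>
  define N where "N = N1 + N2 + N3 + N4"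
  obtain B where B: "0 \<le> B" "\<And>z z'. \<lbrakk>z \<in> slab a b N; z' \<in> slab a b N\<rbrakk> \<Longrightarrow> \<bar>L z' - L z - L' z (z' - z)\<bar> \<le> B * (norm (z' - z))^2"
    using L'_Lipschitz[of N] by blast
  define D where "D = integral {a..b} (\<lambda>x. p x * \<eta> x + g x * capu \<psi> x)"
  have cD: "continuous_on {a..b} (\<lambda>x. p x * \<eta> x + g x * capu \<psi> x)"
    by (intro continuous_intros continuous_on_p continuous_on_g c\<eta> continuous_on_capu \<psi>)
  define C where "C = B * N^2 * (b - a)"
  have C: "0 \<le> C" using B ab by (simp add: C_def)
  have est: "\<bar>I \<epsilon> - I 0 - \<epsilon> * D\<bar> \<le> C * \<epsilon>^2" if \<epsilon>: "\<bar>\<epsilon>\<bar> \<le> 1" for \<epsilon>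
  proof -
    have pw: "\<bar>L (x, Y \<epsilon> x, capu f x + \<epsilon> * capu \<psi> x) - L (x, Y 0 x, capu f x + 0 * capu \<psi> x) - \<epsilon> * (p x * \<eta> x + g x * capu \<psi> x)\<bar> \<le> B * N^2 * \<epsilon>^2"
      if x: "x \<in> {a..b}" for x
    proof -
      let ?z = "(x, y x, capu f x)" and ?z' = "(x, Y \<epsilon> x, capu f x + \<epsilon> * capu \<psi> x)"
      have m: "\<bar>\<epsilon> * \<eta> x\<bar> \<le> \<bar>\<epsilon>\<bar> * N2" "\<bar>\<epsilon> * capu \<psi> x\<bar> \<le> \<bar>\<epsilon>\<bar> * N4"
        using N x by (auto simp: abs_mult intro!: mult_left_mono)
      have m1: "\<bar>\<epsilon>\<bar> * N2 \<le> N2" "\<bar>\<epsilon>\<bar> * N4 \<le> N4" using \<epsilon> N by (auto simp: mult_left_le_one_le)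
      have b1: "\<bar>y x\<bar> \<le> N1" "\<bar>capu f x\<bar> \<le> N3" using N x by auto
      have zz: "?z \<in> slab a b N" "?z' \<in> slab a b N"
        using x b1 m m1 N(1-4) by (auto simp: N_def Y_def)
      have dz: "?z' - ?z = (\<epsilon> * \<eta> x) *\<^sub>R (0, 1, 0) + (\<epsilon> * capu \<psi> x) *\<^sub>R (0, 0, 1)"
        by (simp add: Y_def)
      have "L' ?z (?z' - ?z) = \<epsilon> * (p x * \<eta> x + g x * capu \<psi> x)"
        unfolding dz blinfun.add_right blinfun.scaleR_right by (simp add: p_def g_def algebra_simps)
      moreover have "norm (?z' - ?z) \<le> \<bar>\<epsilon>\<bar> * N"
      proof -
        have "norm (?z' - ?z) \<le> norm ((\<epsilon> * \<eta> x) *\<^sub>R (0::real, 1::real, 0::real)) + norm ((\<epsilon> * capu \<psi> x) *\<^sub>R (0::real, 0::real, 1::real))"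
          unfolding dz by (rule norm_triangle_ineq)
        also have "\<dots> = \<bar>\<epsilon> * \<eta> x\<bar> + \<bar>\<epsilon> * capu \<psi> x\<bar>" by (simp add: norm_Pair)
        also have "\<dots> \<le> \<bar>\<epsilon>\<bar> * N2 + \<bar>\<epsilon>\<bar> * N4" using m by linarith
        also have "\<dots> \<le> \<bar>\<epsilon>\<bar> * N" using N unfolding distrib_left[symmetric] by (intro mult_left_mono) (auto simp: N_def)
        finally show ?thesis .
      qed
      then have "B * (norm (?z' - ?z))^2 \<le> B * (\<bar>\<epsilon>\<bar> * N)^2"
        using B by (intro mult_left_mono power_mono) auto
      ultimately show ?thesis
        using B(2)[OF zz] by (simp add: Y_def power_mult_distrib mult_ac)
    qed
    have int: "h integrable_on {a..b}" if "continuous_on {a..b} h" for h :: "real \<Rightarrow> real"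
      using that by (rule integrable_continuous_interval)
    have "I \<epsilon> - I 0 - \<epsilon> * D = integral {a..b} (\<lambda>x. L (x, Y \<epsilon> x, capu f x + \<epsilon> * capu \<psi> x) - L (x, Y 0 x, capu f x + 0 * capu \<psi> x) - \<epsilon> * (p x * \<eta> x + g x * capu \<psi> x))"
      unfolding I_def D_def
      by (subst Henstock_Kurzweil_Integration.integral_diff, intro int continuous_intros cI cD, intro int continuous_intros cD,
          subst Henstock_Kurzweil_Integration.integral_diff, intro int cI, intro int cI) simp
    also have "norm \<dots> \<le> B * N^2 * \<epsilon>^2 * (b - a)"
      using ab pw by (intro integral_bound continuous_intros cI cD) auto
    finally show ?thesis by (simp add: C_def mult_ac)
  qed
  have "D = 0"
  proof (cases "\<forall>z\<in>admissible a b ya yb. action \<alpha> a b L y \<le> action \<alpha> a b L z")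
    case True
    show ?thesis
    proof (rule zero_if_linear_le_quadratic[OF C])
      fix \<epsilon> :: real assume "\<bar>\<epsilon>\<bar> \<le> 1"
      moreover have "I 0 \<le> I \<epsilon>" using True adm[of \<epsilon>] act act0 by metis
      ultimately show "0 \<le> \<epsilon> * D + C * \<epsilon>^2" using est[of \<epsilon>] by linarith
    qed
  next
    case False
    then have max: "\<forall>z\<in>admissible a b ya yb. action \<alpha> a b L z \<le> action \<alpha> a b L y"
      using ext by (auto simp: is_extremizer_def)
    have "- D = 0"
    proof (rule zero_if_linear_le_quadratic[OF C])
      fix \<epsilon> :: real assume "\<bar>\<epsilon>\<bar> \<le> 1"
      moreover have "I \<epsilon> \<le> I 0" using max adm[of \<epsilon>] act act0 by metis
      ultimately show "0 \<le> \<epsilon> * - D + C * \<epsilon>^2" using est[of \<epsilon>] by simp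
    qed
    then show ?thesis by simp
  qed
  then show ?thesis by (simp add: D_def \<eta>_def)
qed

abbreviation "p0 \<equiv> \<lambda>t. indicator {a..<b} t * p t"
abbreviation "g0 \<equiv> \<lambda>t. indicator {a..<b} t * g t"

lemma integrated_euler_lagrange:
  assumes ext: "is_extremizer \<alpha> a b L ya yb y" and x: "x \<in> {a..b}"
  shows "RI (1 - \<alpha>) g0 x = - Gamma (1 - \<alpha>) * RI 1 p0 x"
proof -
  define \<Gamma> where "\<Gamma> = Gamma (1 - \<alpha>)"
  have G: "0 < \<Gamma>" using Gamma_pos by (simp add: \<Gamma>_def)
  obtain Mp where "bounded_left_support p0 Mp b"
    using continuous_on_bounded_left_support[OF continuous_on_p] ab by auto
  then interpret p0: bounded_left_support p0 Mp b .
  obtain Mg where "bounded_left_support g0 Mg b"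
    using continuous_on_bounded_left_support[OF continuous_on_g] ab by auto
  then interpret g0: bounded_left_support g0 Mg b .
  \<comment> \<open>The factor multiplying \<psi> once both integral operators in the first
    variation have been moved off \<psi> by adjointness.\<close>
  define W where "W x = RI 1 p0 x + RI (1 - \<alpha>) g0 x / \<Gamma>" for x
  have c1: "continuous_on {a..b} (RI 1 p0)" by (rule continuous_on_RI_1[OF continuous_on_p])
  have c2: "continuous_on {a..b} (RI (1 - \<alpha>) g0)" using \<alpha> by (intro g0.continuous_on_RI) auto
  have cW: "continuous_on {a..b} W"
    unfolding W_def using G by (intro continuous_intros c1 c2) auto
  have "W x = W b"
  proof (rule du_Bois_Reymond[OF ab cW _ x])
    fix \<psi> :: "real \<Rightarrow> real" assume \<psi>: "continuous_on {a..b} \<psi>" "integral {a..b} \<psi> = 0"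
    define \<psi>0 where "\<psi>0 t = indicator {a..b} t * \<psi> t" for t
    obtain M where "bounded_support \<psi>0 M a b"
      using continuous_on_indicator_bounded[OF \<psi>(1)] ab unfolding \<psi>0_def[abs_def] by auto
    then interpret psi: bounded_support \<psi>0 M a b .
    have adj: "(\<integral>x. indicator {a..b} x * (h x * LI s \<psi>0 x) \<partial>lborel) = (\<integral>x. indicator {a..b} x * (\<psi> x * RI s (\<lambda>t. indicator {a..<b} t * h t) x) \<partial>lborel)"
      if h: "continuous_on {a..b} h" and s: "0 < s" for h s
    proof -
      obtain Mh where "bounded_left_support (\<lambda>t. indicator {a..<b} t * h t) Mh b"
        using continuous_on_bounded_left_support[OF h] ab by auto
      then interpret h0: bounded_left_support "\<lambda>t. indicator {a..<b} t * h t" Mh b .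
      have [measurable]: "(\<lambda>t. indicator {a..b} t * h t) \<in> borel_measurable borel"
        using continuous_on_integrable_indicator(1)[OF h] by auto
      have "(\<integral>x. indicator {a..b} x * (h x * LI s \<psi>0 x) \<partial>lborel) = (\<integral>x. (indicator {a..<b} x * h x) * LI s \<psi>0 x \<partial>lborel)"
      proof (rule integral_cong_AE)
        have "(\<lambda>x. indicator {a..b} x * (h x * LI s \<psi>0 x)) = (\<lambda>x. (indicator {a..b} x * h x) * LI s \<psi>0 x)"
          by (simp add: mult.assoc)
        then show "(\<lambda>x. indicator {a..b} x * (h x * LI s \<psi>0 x)) \<in> borel_measurable lborel" by simp
        show "(\<lambda>x. indicator {a..<b} x * h x * LI s \<psi>0 x) \<in> borel_measurable lborel"
          using h0.p_meas by measurable
        show "AE x in lborel. indicator {a..b} x * (h x * LI s \<psi>0 x) = indicator {a..<b} x * h x * LI s \<psi>0 x"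
          using AE_lborel_singleton[of b] by eventually_elim (auto simp: indicator_def)
      qed
      also have "\<dots> = (\<integral>u. \<psi>0 u * RI s (\<lambda>t. indicator {a..<b} t * h t) u \<partial>lborel)"
        by (rule LI_RI_adjoint[OF s psi.bounded_support_axioms h0.bounded_left_support_axioms]) auto
      finally show ?thesis by (simp add: \<psi>0_def mult.assoc)
    qed
    have int: "h integrable_on {a..b}" if "continuous_on {a..b} h" for h :: "real \<Rightarrow> real"
      using that by (rule integrable_continuous_interval)
    have c\<eta>: "continuous_on {a..b} (LI 1 \<psi>0)"
    proof -
      have "continuous_on {a..b} (\<lambda>x. integral {a..x} \<psi>)"
        by (rule indefinite_integral_continuous_1[OF int[OF \<psi>(1)]])
      moreover have "continuous_on {a..b} (LI 1 \<psi>0) \<longleftrightarrow> continuous_on {a..b} (\<lambda>x. integral {a..x} \<psi>)"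
        unfolding \<psi>0_def[abs_def] by (rule continuous_on_cong[OF refl]) (rule LI_1_eq_integral[OF \<psi>(1)])
      ultimately show ?thesis by simp
    qed
    have cV: "continuous_on {a..b} (LI (1 - \<alpha>) \<psi>0)"
    proof -
      have "continuous_on {a..b} (\<lambda>x. \<Gamma> * capu \<psi> x)" by (intro continuous_intros continuous_on_capu \<psi>)
      then show ?thesis using G by (simp add: capu_def \<psi>0_def[abs_def] \<Gamma>_def)
    qed
    have "integral {a..b} (\<lambda>x. \<psi> x * W x) = integral {a..b} (\<lambda>x. \<psi> x * RI 1 p0 x + \<psi> x * RI (1 - \<alpha>) g0 x / \<Gamma>)"
      by (simp add: W_def distrib_left)
    also have "\<dots> = integral {a..b} (\<lambda>x. \<psi> x * RI 1 p0 x) + integral {a..b} (\<lambda>x. \<psi> x * RI (1 - \<alpha>) g0 x) / \<Gamma>"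
      using G by (subst Henstock_Kurzweil_Integration.integral_add) (auto intro!: int continuous_intros \<psi> c1 c2)
    also have "integral {a..b} (\<lambda>x. \<psi> x * RI 1 p0 x) = integral {a..b} (\<lambda>x. p x * LI 1 \<psi>0 x)"
      using adj[OF continuous_on_p, of 1] continuous_on_integrable_indicator(2)[of a b "\<lambda>x. p x * LI 1 \<psi>0 x"]
        continuous_on_integrable_indicator(2)[of a b "\<lambda>x. \<psi> x * RI 1 p0 x"]
      by (simp add: continuous_on_mult continuous_on_p c\<eta> \<psi> c1)
    also have "integral {a..b} (\<lambda>x. \<psi> x * RI (1 - \<alpha>) g0 x) = integral {a..b} (\<lambda>x. g x * LI (1 - \<alpha>) \<psi>0 x)"
      using adj[OF continuous_on_g, of "1 - \<alpha>"] \<alpha> continuous_on_integrable_indicator(2)[of a b "\<lambda>x. g x * LI (1 - \<alpha>) \<psi>0 x"]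
        continuous_on_integrable_indicator(2)[of a b "\<lambda>x. \<psi> x * RI (1 - \<alpha>) g0 x"]
      by (simp add: continuous_on_mult continuous_on_g cV \<psi> c2)
    also have "integral {a..b} (\<lambda>x. p x * LI 1 \<psi>0 x) + integral {a..b} (\<lambda>x. g x * LI (1 - \<alpha>) \<psi>0 x) / \<Gamma>
      = integral {a..b} (\<lambda>x. p x * LI 1 \<psi>0 x + g x * LI (1 - \<alpha>) \<psi>0 x / \<Gamma>)"
      using G by (subst Henstock_Kurzweil_Integration.integral_add) (auto intro!: int continuous_intros continuous_on_p continuous_on_g c\<eta> cV)
    also have "\<dots> = integral {a..b} (\<lambda>x. p x * integral {a..x} \<psi> + g x * capu \<psi> x)"
      unfolding \<psi>0_def[abs_def]
      by (intro Henstock_Kurzweil_Integration.integral_cong) (simp add: LI_1_eq_integral[OF \<psi>(1)] capu_def \<Gamma>_def)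
    also have "\<dots> = 0" by (rule first_variation[OF ext \<psi>])
    finally show "integral {a..b} (\<lambda>x. \<psi> x * W x) = 0" .
  qed
  \<comment> \<open>Right fractional integrals vanish at b, which fixes the constant left open by
    the du Bois-Reymond lemma.\<close>
  also have "W b = 0" by (simp add: W_def p0.RI_zero g0.RI_zero)
  finally have "W x = 0" .
  then have "RI (1 - \<alpha>) g0 x / \<Gamma> = - RI 1 p0 x" unfolding W_def by linarith
  then show ?thesis using G by (simp add: field_simps \<Gamma>_def)
qed

end

lemma has_bochner_integral_rker_Ici:
  assumes "0 < s"
  shows "has_bochner_integral lborel (\<lambda>t. indicator {x..} t * rker s (b - t)) (frac_pow s (b - x))"
proof -
  let ?F = "\<lambda>u. indicator {..-x} u * rker s (u - (-b))"
  have hb: "has_bochner_integral lborel ?F (frac_pow s (-x - (-b)))"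
    by (rule has_bochner_integral_rker_Icc[OF assms])
  have eq: "indicator {x..} t * rker s (b - t) = ?F (0 + (-1) * t)" for t
    by (auto simp: indicator_def)
  show ?thesis
    unfolding eq using hb lborel_integrable_real_affine[of ?F "-1" 0] lborel_integral_real_affine[of "-1" ?F 0]
    by (simp add: has_bochner_integral_iff)
qed

section \<open>Regularity and energy of p along the extremal\<close>

context extremal_setting
begin

text \<open>\<open>y\<close> is Lipschitz, its derivative being bounded, so its increments merge
  with those of x. Only the Caputo derivative contributes increments of lower regularity.\<close>

lemma p_Lipschitz:
  obtains \<Lambda> where "0 \<le> \<Lambda>" "\<And>x u. \<lbrakk>x \<in> {a..b}; u \<in> {a..b}\<rbrakk> \<Longrightarrow> \<bar>p x - p u\<bar> \<le> \<Lambda> * (\<bar>x - u\<bar> + \<bar>capu f x - capu f u\<bar>)"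
proof -
  have bnd: "\<exists>N\<ge>0. \<forall>x\<in>{a..b}. \<bar>h x\<bar> \<le> N" if "continuous_on {a..b} h" for h :: "real \<Rightarrow> real"
  proof -
    have "bounded (h ` {a..b})" by (intro compact_imp_bounded compact_continuous_image that compact_Icc)
    then show ?thesis unfolding bounded_pos by (auto intro: less_imp_le)
  qed
  obtain N1 N2 M where N: "0 \<le> N1" "0 \<le> N2" "0 \<le> M" "\<forall>x\<in>{a..b}. \<bar>y x\<bar> \<le> N1" "\<forall>x\<in>{a..b}. \<bar>capu f x\<bar> \<le> N2" "\<forall>x\<in>{a..b}. \<bar>f x\<bar> \<le> M"
    using bnd[OF continuous_on_y] bnd[OF continuous_on_capu[OF f]] bnd[OF f] by metis
  define N where "N = N1 + N2"
  obtain B where B: "0 \<le> B" "\<And>z z'. \<lbrakk>z \<in> slab a b N; z' \<in> slab a b N\<rbrakk> \<Longrightarrow> norm (L' z - L' z') \<le> B * norm (z - z')"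
    using L'_Lipschitz[of N] by blast
  have yL: "\<bar>y x - y u\<bar> \<le> M * \<bar>x - u\<bar>" if "x \<in> {a..b}" "u \<in> {a..b}" for x u
    using field_differentiable_bound[of "{a..b}" y f M x u] y N(6) that by (auto simp: convex_real_interval)
  show ?thesis
  proof (rule that[of "B * (1 + M)"])
    show "0 \<le> B * (1 + M)" using B N by simp
    fix x u assume xu: "x \<in> {a..b}" "u \<in> {a..b}"
    let ?z = "(x, y x, capu f x)" and ?z' = "(u, y u, capu f u)"
    have b: "\<bar>y x\<bar> \<le> N1" "\<bar>y u\<bar> \<le> N1" "\<bar>capu f x\<bar> \<le> N2" "\<bar>capu f u\<bar> \<le> N2" using N xu by blast+
    have sl: "?z \<in> slab a b N" "?z' \<in> slab a b N" using xu b N(1,2) by (auto simp: N_def)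
    have "\<bar>p x - p u\<bar> = norm ((L' ?z - L' ?z') (0, 1, 0))" by (simp add: p_def blinfun.diff_left)
    also have "\<dots> \<le> norm (L' ?z - L' ?z') * norm (0::real, 1::real, 0::real)" by (rule norm_blinfun)
    also have "\<dots> = norm (L' ?z - L' ?z')" by (simp add: norm_Pair)
    also have "\<dots> \<le> B * norm (?z - ?z')" by (rule B(2)[OF sl])
    also have "norm (?z - ?z') \<le> \<bar>x - u\<bar> + (\<bar>y x - y u\<bar> + \<bar>capu f x - capu f u\<bar>)"
      using norm_Pair_le[of "x - u" "(y x - y u, capu f x - capu f u)"] norm_Pair_le[of "y x - y u" "capu f x - capu f u"]
      by simp
    also have "\<dots> \<le> (1 + M) * (\<bar>x - u\<bar> + \<bar>capu f x - capu f u\<bar>)"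
    proof -
      have "0 \<le> M * \<bar>capu f x - capu f u\<bar>" using N by simp
      then show ?thesis using yL[OF xu] by (simp add: algebra_simps)
    qed
    finally show "\<bar>p x - p u\<bar> \<le> B * (1 + M) * (\<bar>x - u\<bar> + \<bar>capu f x - capu f u\<bar>)"
      using B by (simp add: mult_left_mono mult.assoc)
  qed
qed

lemma p_Holder:
  obtains H where "0 \<le> H" "\<And>x u. \<lbrakk>x \<in> {a..b}; u \<in> {a..b}\<rbrakk> \<Longrightarrow> \<bar>p x - p u\<bar> \<le> H * \<bar>x - u\<bar> powr (1 - \<alpha>)"
proof -
  obtain \<Lambda> where \<Lambda>: "0 \<le> \<Lambda>" "\<And>x u. \<lbrakk>x \<in> {a..b}; u \<in> {a..b}\<rbrakk> \<Longrightarrow> \<bar>p x - p u\<bar> \<le> \<Lambda> * (\<bar>x - u\<bar> + \<bar>capu f x - capu f u\<bar>)"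
    using p_Lipschitz by blast
  obtain C where C: "\<And>x t. 0 \<le> t \<Longrightarrow> \<bar>capu f (x + t) - capu f x\<bar> \<le> C * t powr (1 - \<alpha>)"
    using capu_Holder[OF f] by blast
  have C0: "0 \<le> C" using C[of 1 0] by simp
  show ?thesis
  proof (rule that[of "\<Lambda> * ((b - a) powr \<alpha> + C)"])
    show "0 \<le> \<Lambda> * ((b - a) powr \<alpha> + C)" using \<Lambda> C0 by simp
    fix x u assume xu: "x \<in> {a..b}" "u \<in> {a..b}"
    have c: "\<bar>capu f x - capu f u\<bar> \<le> C * \<bar>x - u\<bar> powr (1 - \<alpha>)"
      using C[of "x - u" u] C[of "u - x" x] by (cases "u \<le> x") (auto simp: abs_minus_commute)
    have "\<bar>x - u\<bar> = \<bar>x - u\<bar> powr \<alpha> * \<bar>x - u\<bar> powr (1 - \<alpha>)"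
      by (cases "x = u") (auto simp: powr_add[symmetric])
    also have "\<dots> \<le> (b - a) powr \<alpha> * \<bar>x - u\<bar> powr (1 - \<alpha>)"
      using xu \<alpha> by (intro mult_right_mono powr_mono2) auto
    finally have "\<bar>x - u\<bar> + \<bar>capu f x - capu f u\<bar> \<le> ((b - a) powr \<alpha> + C) * \<bar>x - u\<bar> powr (1 - \<alpha>)"
      using c by (simp add: distrib_right)
    from mult_left_mono[OF this \<Lambda>(1)] \<Lambda>(2)[OF xu]
    show "\<bar>p x - p u\<bar> \<le> \<Lambda> * ((b - a) powr \<alpha> + C) * \<bar>x - u\<bar> powr (1 - \<alpha>)" by (simp add: mult.assoc)
  qed
qed

text \<open>\<open>p\<close> is extended by constants beyond a and b and lowered by
  \<open>p b\<close>, so that it vanishes from b on without a jump. The cut-off \<open>p0\<close>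
  jumps at b unless p b = 0, which would destroy Hoelder continuity; the difference is restored in
  \<open>g_primitive\<close>.\<close>

definition clamped :: "real \<Rightarrow> real" where
  "clamped x = p (max a (min x b)) - p b"

lemma clamped_eq: "a \<le> x \<Longrightarrow> x \<le> b \<Longrightarrow> clamped x = p x - p b"
  by (simp add: clamped_def)

lemma clamped_zero: "b \<le> x \<Longrightarrow> clamped x = 0"
  using ab by (simp add: clamped_def)

lemma continuous_on_clamped: "continuous_on UNIV clamped"
  unfolding clamped_def
  by (intro continuous_intros continuous_on_compose2[OF continuous_on_p]) (use ab in auto)

lemma clamped_bounded:
  obtains P where "bounded_left_support clamped P b"
proof -
  have "bounded (p ` {a..b})" by (intro compact_imp_bounded compact_continuous_image continuous_on_p compact_Icc)
  then obtain P where "\<forall>x\<in>{a..b}. \<bar>p x\<bar> \<le> P" unfolding bounded_iff by auto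
  then have "\<bar>p (max a (min x b))\<bar> \<le> P" "\<bar>p b\<bar> \<le> P" for x using ab by auto
  then have "\<bar>clamped x\<bar> \<le> 2 * P" for x unfolding clamped_def
    using abs_triangle_ineq4[of "p (max a (min x b))" "p b"] by (smt (verit))
  moreover have "clamped \<in> borel_measurable borel"
    by (rule borel_measurable_continuous_onI[OF continuous_on_clamped])
  ultimately have "bounded_left_support clamped (2 * P) b"
    by unfold_locales (auto simp: clamped_zero)
  then show ?thesis by (rule that)
qed

text \<open>Half of the available exponent 1 - \<alpha> is given away: \<open>RI_Holder\<close>
  requires \<alpha> plus the exponent to be strictly less than 1.\<close>

lemma clamped_Holder:
  obtains H where "\<And>x t. 0 \<le> t \<Longrightarrow> \<bar>clamped (x + t) - clamped x\<bar> \<le> H * t powr ((1 - \<alpha>) / 2)"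
proof -
  obtain H where H: "0 \<le> H" "\<And>x u. \<lbrakk>x \<in> {a..b}; u \<in> {a..b}\<rbrakk> \<Longrightarrow> \<bar>p x - p u\<bar> \<le> H * \<bar>x - u\<bar> powr (1 - \<alpha>)"
    using p_Holder by blast
  show ?thesis
  proof (rule that[of "H * (b - a) powr ((1 - \<alpha>) / 2)"])
    fix x t :: real assume t: "0 \<le> t"
    define d where "d = \<bar>max a (min (x + t) b) - max a (min x b)\<bar>"
    have d: "0 \<le> d" "d \<le> t" "d \<le> b - a" using t ab by (auto simp: d_def)
    have "\<bar>clamped (x + t) - clamped x\<bar> \<le> H * d powr (1 - \<alpha>)"
      unfolding clamped_def d_def using H(2)[of "max a (min (x + t) b)" "max a (min x b)"] ab by auto
    also have "d powr (1 - \<alpha>) = d powr ((1 - \<alpha>) / 2) * d powr ((1 - \<alpha>) / 2)"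
      by (simp add: powr_add[symmetric])
    also have "\<dots> \<le> (b - a) powr ((1 - \<alpha>) / 2) * t powr ((1 - \<alpha>) / 2)"
      using d \<alpha> by (intro mult_mono powr_mono2) auto
    finally show "\<bar>clamped (x + t) - clamped x\<bar> \<le> H * (b - a) powr ((1 - \<alpha>) / 2) * t powr ((1 - \<alpha>) / 2)"
      using H by (simp add: mult_left_mono mult.assoc)
  qed
qed

text \<open>The increments of \<open>p\<close> are controlled by those of the Caputo derivative, since the partial derivatives of
  \<open>L\<close> are locally Lipschitz.\<close>

lemma clamped_energy:
  obtains E where "0 \<le> E" "\<And>c R. \<lbrakk>a \<le> c; 0 < R; R \<le> b - c\<rbrakk> \<Longrightarrow>
      (\<integral>\<^sup>+l. \<integral>\<^sup>+t. ennreal (indicator {c..c + 5/2 * R} l * (indicator {0<..} t * sqinc clamped (1 - \<alpha>) l t)) \<partial>lborel \<partial>lborel)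
        \<le> ennreal (E * R powr \<alpha>)"
proof -
  define s where "s = 1 - \<alpha>"
  have s: "0 < s" "s < 1" "1 - s = \<alpha>" using \<alpha> by (auto simp: s_def)
  define T where "T = b - a"
  have T: "0 < T" using ab by (simp add: T_def)
  obtain \<Lambda> where \<Lambda>: "0 \<le> \<Lambda>" "\<And>x u. \<lbrakk>x \<in> {a..b}; u \<in> {a..b}\<rbrakk> \<Longrightarrow> \<bar>p x - p u\<bar> \<le> \<Lambda> * (\<bar>x - u\<bar> + \<bar>capu f x - capu f u\<bar>)"
    using p_Lipschitz by blast
  obtain H where H: "0 \<le> H" "\<And>x u. \<lbrakk>x \<in> {a..b}; u \<in> {a..b}\<rbrakk> \<Longrightarrow> \<bar>p x - p u\<bar> \<le> H * \<bar>x - u\<bar> powr s"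
    unfolding s_def using p_Holder by blast
  define f0 where "f0 t = indicator {a..b} t * f t" for t
  obtain M where "bounded_support f0 M a b"
    using continuous_on_indicator_bounded[OF f] ab unfolding f0_def[abs_def] by auto
  then interpret f0: bounded_support f0 M a b .
  define \<Gamma> where "\<Gamma> = Gamma s"
  have G: "0 < \<Gamma>" using Gamma_pos by (simp add: \<Gamma>_def s_def)
  have cap: "capu f x = LI s f0 x / \<Gamma>" for x by (simp add: capu_def f0_def[abs_def] \<Gamma>_def s_def)
  obtain C where C: "0 \<le> C" "\<And>x R. \<lbrakk>0 < R; R \<le> T\<rbrakk> \<Longrightarrow>
      (\<integral>\<^sup>+l. \<integral>\<^sup>+t. ennreal (indicator {x..x + 5/2 * R} l * indicator {0<..T} t * sqinc (LI s f0) s l t) \<partial>lborel \<partial>lborel)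
        \<le> ennreal (C * R powr (1 - s))"
    by (rule f0.local_energy_bound[OF s(1,2) T], rule that)
  define K where "K = 2 * \<Lambda>^2 * (T powr (2 - 2 * s) / (2 - 2 * s)) + H^2 / (2 * s)"
  have K: "0 \<le> K" using s by (simp add: K_def)
  define E where "E = K * (5/2) * T powr s + 2 * \<Lambda>^2 / \<Gamma>^2 * C"
  have E: "0 \<le> E" using K C G by (simp add: E_def)
  obtain P where "bounded_left_support clamped P b" by (rule clamped_bounded)
  then interpret cl: bounded_left_support clamped P b .
  show ?thesis
  proof (rule that[OF E])
    fix c R assume cR: "a \<le> c" "0 < R" "R \<le> b - c"
    then have RT: "R \<le> T" by (simp add: T_def)
    define J where "J = {c..c + 5/2 * R}"
    have [measurable]: "J \<in> sets borel" by (simp add: J_def)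
    let ?A = "\<lambda>t. 2 * \<Lambda>^2 * (indicator {0<..T} t * t powr (1 - 2 * s))"
    \<comment> \<open>Increments that leap over b equal -\<open>clamped l\<close>, of size at most H
      * (b - l) powr s. The tail integral of the weight from b - l is of order (b - l) powr (-2 *
      s), so the singularity at b cancels and the contribution is bounded uniformly in l.\<close>
    let ?B = "\<lambda>l t. H^2 * (b - l) powr (2 * s) * (indicator {b - l..} t * t powr (-1 - 2 * s))"
    let ?V = "\<lambda>l t. 2 * \<Lambda>^2 / \<Gamma>^2 * (indicator {0<..T} t * sqinc (LI s f0) s l t)"
    have pw: "indicator {0<..} t * sqinc clamped s l t \<le> ?A t + ?B l t + ?V l t" if l: "a \<le> l" "l < b" for l t
    proof -
      have nn: "0 \<le> ?A t" "0 \<le> ?B l t" "0 \<le> ?V l t" by (auto simp: sqinc_nonneg)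
      consider "t \<le> 0" | "0 < t" "t \<le> b - l" | "0 < t" "b - l < t" by linarith
      then show ?thesis
      proof cases
        case 1
        then have "indicator {0<..} t * sqinc clamped s l t = 0" by simp
        then show ?thesis using nn by linarith
      next
        case 2
        then have tT: "t \<in> {0<..T}" using l by (auto simp: T_def)
        define \<delta> where "\<delta> = LI s f0 (l + t) - LI s f0 l"
        have "\<bar>clamped (l + t) - clamped l\<bar> \<le> \<Lambda> * (t + \<bar>\<delta>\<bar> / \<Gamma>)"
          using \<Lambda>(2)[of "l + t" l] 2 l G by (simp add: clamped_eq cap \<delta>_def diff_divide_distrib[symmetric])
        then have "(clamped (l + t) - clamped l)^2 \<le> (\<Lambda> * (t + \<bar>\<delta>\<bar> / \<Gamma>))^2"
          by (metis abs_ge_zero power2_abs power_mono)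
        also have "\<dots> \<le> \<Lambda>^2 * (2 * t^2 + 2 * (\<delta>^2 / \<Gamma>^2))"
        proof -
          have "(t + \<bar>\<delta>\<bar> / \<Gamma>)^2 \<le> 2 * t^2 + 2 * (\<bar>\<delta>\<bar> / \<Gamma>)^2"
            using sum_squares_bound[of t "\<bar>\<delta>\<bar> / \<Gamma>"] by (simp add: power2_sum)
          then show ?thesis unfolding power_mult_distrib by (intro mult_left_mono) (simp_all add: power_divide)
        qed
        finally have "(clamped (l + t) - clamped l)^2 * t powr (-1 - 2 * s) \<le> (\<Lambda>^2 * (2 * t^2 + 2 * (\<delta>^2 / \<Gamma>^2))) * t powr (-1 - 2 * s)"
          by (rule mult_right_mono) simp
        also have "\<dots> = 2 * \<Lambda>^2 * (t^2 * t powr (-1 - 2 * s)) + 2 * \<Lambda>^2 / \<Gamma>^2 * (\<delta>^2 * t powr (-1 - 2 * s))"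
          by (simp add: algebra_simps)
        also have "t^2 * t powr (-1 - 2 * s) = t powr (1 - 2 * s)"
          using 2 by (simp add: powr_add[symmetric] flip: powr_numeral)
        finally have "sqinc clamped s l t \<le> ?A t + ?V l t" using tT by (simp add: sqinc_def \<delta>_def)
        moreover have "indicator {0<..} t * sqinc clamped s l t = sqinc clamped s l t" using 2 by simp
        ultimately show ?thesis using nn by linarith
      next
        case 3
        have "\<bar>clamped (l + t) - clamped l\<bar> \<le> H * (b - l) powr s"
          using H(2)[of b l] 3 l by (simp add: clamped_eq clamped_zero)
        then have "(clamped (l + t) - clamped l)^2 \<le> (H * (b - l) powr s)^2"
          by (metis abs_ge_zero power2_abs power_mono)
        also have "\<dots> = H^2 * (b - l) powr (2 * s)"
          by (simp add: power_mult_distrib power2_eq_square powr_add[symmetric])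
        finally have "(clamped (l + t) - clamped l)^2 * t powr (-1 - 2 * s) \<le> H^2 * (b - l) powr (2 * s) * t powr (-1 - 2 * s)"
          by (rule mult_right_mono) simp
        then have "sqinc clamped s l t \<le> ?B l t" using 3 by (simp add: sqinc_def)
        moreover have "indicator {0<..} t * sqinc clamped s l t = sqinc clamped s l t" using 3 by simp
        ultimately show ?thesis using nn by linarith
      qed
    qed
    define V where "V l = (\<integral>\<^sup>+t. ennreal (indicator {0<..T} t * sqinc (LI s f0) s l t) \<partial>lborel)" for l
    have [measurable]: "V \<in> borel_measurable borel" unfolding V_def by measurable
    have inner: "(\<integral>\<^sup>+t. ennreal (indicator {0<..} t * sqinc clamped s l t) \<partial>lborel) \<le> ennreal K + ennreal (2 * \<Lambda>^2 / \<Gamma>^2) * V l"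
      if l: "a \<le> l" for l
    proof (cases "l < b")
      case True
      have "(\<integral>\<^sup>+t. ennreal (indicator {0<..} t * sqinc clamped s l t) \<partial>lborel) \<le> (\<integral>\<^sup>+t. ennreal (?A t) + ennreal (?B l t) + ennreal (?V l t) \<partial>lborel)"
      proof (intro nn_integral_mono)
        fix t
        have nn: "0 \<le> ?A t" "0 \<le> ?B l t" "0 \<le> ?V l t" by (auto simp: sqinc_nonneg)
        show "ennreal (indicator {0<..} t * sqinc clamped s l t) \<le> ennreal (?A t) + ennreal (?B l t) + ennreal (?V l t)"
          using pw[OF l True, of t] nn by (simp add: ennreal_leI flip: ennreal_plus)
      qed
      also have "\<dots> = (\<integral>\<^sup>+t. ennreal (?A t) \<partial>lborel) + (\<integral>\<^sup>+t. ennreal (?B l t) \<partial>lborel) + (\<integral>\<^sup>+t. ennreal (?V l t) \<partial>lborel)"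
        by (simp add: nn_integral_add)
      also have "(\<integral>\<^sup>+t. ennreal (?A t) \<partial>lborel) = ennreal (2 * \<Lambda>^2) * (\<integral>\<^sup>+t. ennreal (indicator {0<..T} t * t powr (1 - 2 * s)) \<partial>lborel)"
        by (subst nn_integral_cmult[symmetric]) (auto simp: ennreal_mult'[symmetric])
      also have "\<dots> = ennreal (2 * \<Lambda>^2 * (T powr (2 - 2 * s) / (2 - 2 * s)))"
        using nn_integral_powr_from_0[of "1 - 2 * s" T] T s by (simp add: ennreal_mult'[symmetric])
      also have "(\<integral>\<^sup>+t. ennreal (?B l t) \<partial>lborel) = ennreal (H^2 * (b - l) powr (2 * s)) * (\<integral>\<^sup>+t. ennreal (indicator {b - l..} t * t powr (-1 - 2 * s)) \<partial>lborel)"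
        by (subst nn_integral_cmult[symmetric]) (auto simp: ennreal_mult'[symmetric])
      also have "\<dots> = ennreal (H^2 / (2 * s))"
      proof -
        have "(b - l) powr (2 * s) * (b - l) powr (- (2 * s)) = 1" using True by (simp add: powr_add[symmetric])
        then have "H^2 * (b - l) powr (2 * s) * ((b - l) powr (- (2 * s)) / (2 * s)) = H^2 / (2 * s)"
          using s by (simp add: field_simps)
        then show ?thesis
          using nn_integral_powr_to_inf[of "-1 - 2 * s" "b - l"] True s by (simp add: ennreal_mult'[symmetric])
      qed
      also have "(\<integral>\<^sup>+t. ennreal (?V l t) \<partial>lborel) = ennreal (2 * \<Lambda>^2 / \<Gamma>^2) * V l"
        unfolding V_def by (subst nn_integral_cmult[symmetric]) (auto simp: ennreal_mult'[symmetric])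
      finally show ?thesis
        using s by (simp add: K_def flip: ennreal_plus)
    next
      \<comment> \<open>Windows may reach beyond b, where \<open>clamped\<close> and all its
        increments to the right vanish.\<close>
      case False
      then have z: "indicator {0<..} t * sqinc clamped s l t = 0" for t
        by (auto simp: sqinc_def clamped_zero indicator_def)
      show ?thesis unfolding z by simp
    qed
    have "(\<integral>\<^sup>+l. \<integral>\<^sup>+t. ennreal (indicator J l * (indicator {0<..} t * sqinc clamped s l t)) \<partial>lborel \<partial>lborel)
      \<le> (\<integral>\<^sup>+l. ennreal K * indicator J l + ennreal (2 * \<Lambda>^2 / \<Gamma>^2) * (\<integral>\<^sup>+t. ennreal (indicator J l * indicator {0<..T} t * sqinc (LI s f0) s l t) \<partial>lborel) \<partial>lborel)"
    proof (intro nn_integral_mono)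
      fix l
      show "(\<integral>\<^sup>+t. ennreal (indicator J l * (indicator {0<..} t * sqinc clamped s l t)) \<partial>lborel)
        \<le> ennreal K * indicator J l + ennreal (2 * \<Lambda>^2 / \<Gamma>^2) * (\<integral>\<^sup>+t. ennreal (indicator J l * indicator {0<..T} t * sqinc (LI s f0) s l t) \<partial>lborel)"
        using inner[of l] cR by (cases "l \<in> J") (auto simp: J_def V_def)
    qed
    also have "\<dots> = ennreal K * emeasure lborel J + ennreal (2 * \<Lambda>^2 / \<Gamma>^2) * (\<integral>\<^sup>+l. \<integral>\<^sup>+t. ennreal (indicator J l * indicator {0<..T} t * sqinc (LI s f0) s l t) \<partial>lborel \<partial>lborel)"
      by (simp add: nn_integral_add nn_integral_cmult nn_integral_cmult_indicator)
    also have "\<dots> \<le> ennreal (K * (5/2 * R)) + ennreal (2 * \<Lambda>^2 / \<Gamma>^2 * (C * R powr \<alpha>))"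
    proof (rule add_mono)
      show "ennreal K * emeasure lborel J \<le> ennreal (K * (5/2 * R))"
        using K cR by (simp add: J_def emeasure_lborel_Icc_eq ennreal_mult'[symmetric])
      show "ennreal (2 * \<Lambda>^2 / \<Gamma>^2) * (\<integral>\<^sup>+l. \<integral>\<^sup>+t. ennreal (indicator J l * indicator {0<..T} t * sqinc (LI s f0) s l t) \<partial>lborel \<partial>lborel) \<le> ennreal (2 * \<Lambda>^2 / \<Gamma>^2 * (C * R powr \<alpha>))"
        unfolding J_def using C(2)[OF cR(2) RT, of c] by (subst ennreal_mult') (auto simp: s(3) intro!: mult_left_mono)
    qed
    also have "\<dots> = ennreal (K * (5/2 * R) + 2 * \<Lambda>^2 / \<Gamma>^2 * (C * R powr \<alpha>))"
      using K C cR by (subst ennreal_plus) auto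
    also have "\<dots> \<le> ennreal (E * R powr \<alpha>)"
    proof (rule ennreal_leI)
      have "R = R powr s * R powr \<alpha>" using cR by (simp add: powr_add[symmetric] s_def)
      also have "\<dots> \<le> T powr s * R powr \<alpha>" using cR RT s by (intro mult_right_mono powr_mono2) auto
      finally have "K * (5/2) * R \<le> K * (5/2) * (T powr s * R powr \<alpha>)" using K by (intro mult_left_mono) auto
      then show "K * (5/2 * R) + 2 * \<Lambda>^2 / \<Gamma>^2 * (C * R powr \<alpha>) \<le> E * R powr \<alpha>"
        by (simp add: E_def algebra_simps)
    qed
    finally show "(\<integral>\<^sup>+l. \<integral>\<^sup>+t. ennreal (indicator {c..c + 5/2 * R} l * (indicator {0<..} t * sqinc clamped (1 - \<alpha>) l t)) \<partial>lborel \<partial>lborel)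
        \<le> ennreal (E * R powr \<alpha>)" by (simp add: J_def s_def)
  qed
qed

end

section \<open>The derivative of g and the Euler-Lagrange equation\<close>

context extremal_setting
begin

text \<open>\<open>G\<close> is the negative of the derivative of \<open>g\<close>, since
  \<open>g\<close> is written as a tail integral. It is obtained from g = - RI \<alpha> p0 / Gamma
  \<alpha>, with p0 split to the right of c into \<open>clamped\<close> and the constant p b cut off
  at b.\<close>

lemma g_primitive:
  assumes ext: "is_extremizer \<alpha> a b L ya yb y" and c: "c \<in> {a..<b}"
  obtains G where "integrable lborel G" "integrable lborel (\<lambda>t. G t * rker (1 - \<alpha>) (t - c))"
    "\<And>t. b \<le> t \<Longrightarrow> G t = 0" "\<And>x. c \<le> x \<Longrightarrow> g0 x = (\<integral>t. indicator {x..} t * G t \<partial>lborel)"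
proof -
  have c': "c < b" "a \<le> c" using c by auto
  obtain P where "bounded_left_support clamped P b" by (rule clamped_bounded)
  then interpret cl: bounded_left_support clamped P b .
  obtain H where H: "\<And>x t. 0 \<le> t \<Longrightarrow> \<bar>clamped (x + t) - clamped x\<bar> \<le> H * t powr ((1 - \<alpha>) / 2)"
    using clamped_Holder by blast
  obtain E where E: "0 \<le> E" "\<And>c R. \<lbrakk>a \<le> c; 0 < R; R \<le> b - c\<rbrakk> \<Longrightarrow>
      (\<integral>\<^sup>+l. \<integral>\<^sup>+t. ennreal (indicator {c..c + 5/2 * R} l * (indicator {0<..} t * sqinc clamped (1 - \<alpha>) l t)) \<partial>lborel \<partial>lborel)
        \<le> ennreal (E * R powr \<alpha>)"
    using clamped_energy by blast
  obtain Q where Q: "integrable lborel Q" "integrable lborel (\<lambda>t. Q t * rker (1 - \<alpha>) (t - c))"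
    and RQ: "\<And>x. x \<in> {c..b} \<Longrightarrow> RI \<alpha> clamped x = - (\<integral>t. indicator {x..<b} t * Q t \<partial>lborel)"
    using cl.RI_weighted_primitive[OF \<alpha> c'(1) H E(2)[OF c'(2)] E(1)] by blast
  have Ga: "0 < Gamma \<alpha>" using \<alpha> by (intro Gamma_real_pos)
  \<comment> \<open>The second term is the explicit contribution of the constant p b. The cut at c
    is necessary, because the kernel \<open>rker \<alpha> (b - t)\<close> is not integrable towards
    minus infinity.\<close>
  define G where "G t = (indicator {c..<b} t * Q t - p b * (indicator {c..} t * rker \<alpha> (b - t))) / Gamma \<alpha>" for t
  have iQ: "integrable lborel (\<lambda>t. indicator {x..<b} t * Q t)" for x
    using integrable_mult_indicator[OF _ Q(1), of "{x..<b}"] by simp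
  have iQ2: "integrable lborel (\<lambda>t. indicator {c..<b} t * (Q t * rker (1 - \<alpha>) (t - c)))"
    using integrable_mult_indicator[OF _ Q(2), of "{c..<b}"] by simp
  note rI = has_bochner_integral_rker_Ici[OF \<alpha>(1), of _ b, unfolded has_bochner_integral_iff]
  \<comment> \<open>The singular weight at c meets the singularity of the explicit term at b: their
    product is a Beta integrand.\<close>
  have iB: "integrable lborel (\<lambda>u. rker \<alpha> (b - u) * rker (1 - \<alpha>) (u - c))"
    using has_bochner_integral_rker_Beta[of "1 - \<alpha>" c b] \<alpha> c' by (simp add: has_bochner_integral_iff)
  show ?thesis
  proof (rule that)
    show "integrable lborel G" unfolding G_def using iQ rI by auto
    have eq: "G t * rker (1 - \<alpha>) (t - c)
      = (indicator {c..<b} t * (Q t * rker (1 - \<alpha>) (t - c)) - p b * (rker \<alpha> (b - t) * rker (1 - \<alpha>) (t - c))) / Gamma \<alpha>" for t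
      by (cases "c \<le> t") (simp_all add: G_def field_simps rker_nonpos)
    show "integrable lborel (\<lambda>t. G t * rker (1 - \<alpha>) (t - c))"
      unfolding eq using iQ2 iB by auto
    show G0: "G t = 0" if "b \<le> t" for t using that by (simp add: G_def rker_nonpos)
    fix x assume x: "c \<le> x"
    show "g0 x = (\<integral>t. indicator {x..} t * G t \<partial>lborel)"
    proof (cases "x < b")
      case False
      then have z: "indicator {x..} t * G t = 0" for t by (auto simp: indicator_def G0)
      show ?thesis unfolding z using False by simp
    next
      case True
      obtain M where "bounded_left_support p0 M b"
        using continuous_on_bounded_left_support[OF continuous_on_p] ab by auto
      then interpret p0: bounded_left_support p0 M b .
      note rc = has_bochner_integral_rker_Icc[OF \<alpha>(1), of b x, unfolded has_bochner_integral_iff]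
      have "RI \<alpha> p0 x = (\<integral>t. clamped t * rker \<alpha> (t - x) + p b * (indicator {..b} t * rker \<alpha> (t - x)) \<partial>lborel)"
        unfolding RI_def
      proof (rule integral_cong_AE)
        show "(\<lambda>t. p0 t * rker \<alpha> (t - x)) \<in> borel_measurable lborel" using p0.p_meas by measurable
        show "(\<lambda>t. clamped t * rker \<alpha> (t - x) + p b * (indicator {..b} t * rker \<alpha> (t - x))) \<in> borel_measurable lborel"
          using cl.p_meas by measurable
        show "AE t in lborel. p0 t * rker \<alpha> (t - x) = clamped t * rker \<alpha> (t - x) + p b * (indicator {..b} t * rker \<alpha> (t - x))"
          using AE_lborel_singleton[of b]
        proof eventually_elim
          fix t assume t: "t \<noteq> b"
          consider "t \<le> x" | "x < t" "t < b" | "b < t" using t by linarith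
          then show "p0 t * rker \<alpha> (t - x) = clamped t * rker \<alpha> (t - x) + p b * (indicator {..b} t * rker \<alpha> (t - x))"
            by cases (use x c' in \<open>auto simp: rker_nonpos clamped_eq clamped_zero algebra_simps\<close>)
        qed
      qed
      also have "\<dots> = RI \<alpha> clamped x + p b * frac_pow \<alpha> (b - x)"
        unfolding RI_def using cl.RI_integrable[OF \<alpha>(1), of x] rc by simp
      also have "RI \<alpha> clamped x = - (\<integral>t. indicator {x..<b} t * Q t \<partial>lborel)" using RQ x True by auto
      finally have R: "RI \<alpha> p0 x = p b * frac_pow \<alpha> (b - x) - (\<integral>t. indicator {x..<b} t * Q t \<partial>lborel)" by simp
      have "indicator {x..} t * G t = (indicator {x..<b} t * Q t - p b * (indicator {x..} t * rker \<alpha> (b - t))) / Gamma \<alpha>" for t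
        using x by (auto simp: G_def indicator_def)
      then have "(\<integral>t. indicator {x..} t * G t \<partial>lborel) = ((\<integral>t. indicator {x..<b} t * Q t \<partial>lborel) - p b * frac_pow \<alpha> (b - x)) / Gamma \<alpha>"
        using iQ[of x] rI[of x] by simp
      also have "\<dots> = - RI \<alpha> p0 x / Gamma \<alpha>" by (simp add: R)
      also have "\<dots> = g x"
        using RI_inversion[OF ab \<alpha> continuous_on_p continuous_on_g integrated_euler_lagrange[OF ext], of x] x True c' by auto
      also have "\<dots> = g0 x" using x True c' by simp
      finally show ?thesis by simp
    qed
  qed
qed

text \<open>The right derivative at c of the fractional integral of \<open>g0\<close> is computed
  twice: from the integrated equation, where it is that of an ordinary integral, and from the
  representation of \<open>g0\<close> by \<open>G\<close>.\<close>

lemma p_eq_integral: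
  assumes ext: "is_extremizer \<alpha> a b L ya yb y" and c: "c \<in> {a..<b}"
    and G: "integrable lborel G" "integrable lborel (\<lambda>t. G t * rker (1 - \<alpha>) (t - c))"
    and G0: "\<And>t. b \<le> t \<Longrightarrow> G t = 0" and g0: "\<And>x. c \<le> x \<Longrightarrow> g0 x = (\<integral>t. indicator {x..} t * G t \<partial>lborel)"
  shows "Gamma (1 - \<alpha>) * p c = - (\<integral>t. G t * rker (1 - \<alpha>) (t - c) \<partial>lborel)"
proof (rule RI_primitive_derivative[OF _ _ _ G G0 g0])
  have "(RI 1 p0 has_real_derivative - p c) (at c within {a..b})"
    using c by (intro RI_1_has_derivative continuous_on_p) auto
  then have "(RI 1 p0 has_real_derivative - p c) (at c within {c..b})"
    by (rule DERIV_subset) (use c in auto)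
  \<comment> \<open>Only the derivative from the right is available and needed: \<open>G\<close>
    represents \<open>g0\<close> to the right of c alone, and c may be the end point a.\<close>
  then have "((\<lambda>x. (RI 1 p0 x - RI 1 p0 c) / (x - c)) \<longlongrightarrow> - p c) (at_right c)"
    using c by (simp add: has_field_derivative_iff at_within_Icc_at_right)
  then have "((\<lambda>h. (RI 1 p0 (c + h) - RI 1 p0 c) / h) \<longlongrightarrow> - p c) (at_right 0)"
    unfolding filterlim_at_right_to_0[of _ _ c] by (simp add: add.commute)
  then have "((\<lambda>h. - Gamma (1 - \<alpha>) * ((RI 1 p0 (c + h) - RI 1 p0 c) / h)) \<longlongrightarrow> - Gamma (1 - \<alpha>) * - p c) (at_right 0)"
    by (rule tendsto_mult_left)
  then have lim: "((\<lambda>h. - Gamma (1 - \<alpha>) * ((RI 1 p0 (c + h) - RI 1 p0 c) / h)) \<longlongrightarrow> Gamma (1 - \<alpha>) * p c) (at_right 0)"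
    by simp
  have "\<forall>\<^sub>F h in at_right 0. h \<in> {0<..<b - c}"
    by (rule eventually_at_right_real) (use c in auto)
  then show "((\<lambda>h. (RI (1 - \<alpha>) g0 (c + h) - RI (1 - \<alpha>) g0 c) / h) \<longlongrightarrow> Gamma (1 - \<alpha>) * p c) (at_right 0)"
  proof (rule tendsto_cong[THEN iffD1, OF _ lim, OF eventually_mono])
    fix h assume h: "h \<in> {0<..<b - c}"
    show "- Gamma (1 - \<alpha>) * ((RI 1 p0 (c + h) - RI 1 p0 c) / h) = (RI (1 - \<alpha>) g0 (c + h) - RI (1 - \<alpha>) g0 c) / h"
      using integrated_euler_lagrange[OF ext, of "c + h"] integrated_euler_lagrange[OF ext, of c] c h
      by (simp add: algebra_simps diff_divide_distrib)
  qed
qed (use \<alpha> c in auto)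

lemma AE_derivative_g:
  assumes c: "c \<in> {a..<b}" and G: "integrable lborel G"
    and G0: "\<And>t. b \<le> t \<Longrightarrow> G t = 0" and g0: "\<And>x. c \<le> x \<Longrightarrow> g0 x = (\<integral>t. indicator {x..} t * G t \<partial>lborel)"
  shows "AE u in lborel. c < u \<and> u < b \<longrightarrow> (g has_real_derivative - G u) (at u)"
proof -
  have Gi: "G integrable_on {x..b}" "(\<integral>t. indicator {x..} t * G t \<partial>lborel) = integral {x..b} G" if "x \<le> b" for x
  proof -
    have s: "set_integrable lborel {x..b} G"
      unfolding set_integrable_def using integrable_mult_indicator[OF _ G, of "{x..b}"] by simp
    show "G integrable_on {x..b}" by (rule set_borel_integral_eq_integral(1)[OF s])
    have eq: "indicator {x..} t * G t = indicator {x..b} t *\<^sub>R G t" for t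
      by (cases "t \<le> b") (auto simp: G0 indicator_def)
    show "(\<integral>t. indicator {x..} t * G t \<partial>lborel) = integral {x..b} G"
      unfolding eq using set_borel_integral_eq_integral(2)[OF s] by (simp add: set_lebesgue_integral_def)
  qed
  define N where "N = {x \<in> {c<..<b}. \<not> ((\<lambda>x. integral {c..x} G) has_real_derivative G x) (at x)}"
  have "negligible N"
    unfolding N_def by (rule negligible_indefinite_integral_not_differentiable) (use Gi(1)[of c] c in auto)
  then have "AE u in lebesgue. u \<notin> N" by (simp add: negligible_iff_null_sets AE_not_in)
  then have "AE u in lborel. u \<notin> N" by (simp add: AE_completion_iff)
  then show ?thesis
  proof eventually_elim
    fix u assume u: "u \<notin> N"
    show "c < u \<and> u < b \<longrightarrow> (g has_real_derivative - G u) (at u)"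
    proof
      assume cu: "c < u \<and> u < b"
      then have "((\<lambda>x. integral {c..x} G) has_real_derivative G u) (at u)" using u by (simp add: N_def)
      then have d: "((\<lambda>x. integral {c..b} G - integral {c..x} G) has_real_derivative - G u) (at u)"
        by (auto intro!: derivative_eq_intros)
      have eq: "integral {c..b} G - integral {c..x} G = g x" if x: "x \<in> {c<..<b}" for x
      proof -
        have "integral {c..b} G - integral {c..x} G = integral {x..b} G"
          using Henstock_Kurzweil_Integration.integral_combine[of c x b G] Gi(1)[of c] x c by auto
        also have "\<dots> = g0 x" using g0[of x] Gi(2)[of x] x by simp
        also have "\<dots> = g x" using x c by simp
        finally show ?thesis .
      qed
      show "(g has_real_derivative - G u) (at u)"
        by (rule has_field_derivative_transform_within_open[OF d, of "{c<..<b}"]) (use cu eq in auto)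
    qed
  qed
qed

theorem euler_lagrange:
  assumes ext: "is_extremizer \<alpha> a b L ya yb y"
  shows "euler_lagrange \<alpha> a b L y"
proof -
  define h where "h = (\<lambda>x. partial3 L x (y x) (left_caputo \<alpha> a y x))"
  have cap: "left_caputo \<alpha> a y x = capu f x" if "x \<in> {a..b}" for x
    using left_caputo_eq_LI[OF y f that] by (simp add: capu_def)
  \<comment> \<open>\<open>h\<close> and \<open>g\<close> are compared on [a, b] only; this suffices
    to transfer derivatives at interior points.\<close>
  have hg: "h x = g x" and p2: "partial2 L x (y x) (left_caputo \<alpha> a y x) = p x" if "x \<in> {a..b}" for x
    using partial3_eq[OF L' that] partial2_eq[OF L' that] that by (auto simp: h_def g_def p_def cap)
  have "right_caputo_exists \<alpha> b h c \<and> right_caputo \<alpha> b h c = - p c" if c: "c \<in> {a..<b}" for c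
  proof -
    \<comment> \<open>\<open>G\<close> and the null set off which it is the negative derivative of
      \<open>g\<close> may depend on c. This is harmless, as the equation at c involves no other
      point of evaluation.\<close>
    obtain G where G: "integrable lborel G" "integrable lborel (\<lambda>t. G t * rker (1 - \<alpha>) (t - c))"
      and G0: "\<And>t. b \<le> t \<Longrightarrow> G t = 0" and g0: "\<And>x. c \<le> x \<Longrightarrow> g0 x = (\<integral>t. indicator {x..} t * G t \<partial>lborel)"
      using g_primitive[OF ext c] by blast
    have AE_g: "AE u in lborel. c < u \<and> u < b \<longrightarrow> (g has_real_derivative - G u) (at u)"
      using c G(1) G0 g0 by (rule AE_derivative_g)
    have AE: "AE u in lborel. u \<noteq> c \<and> u \<noteq> b \<and> (c < u \<and> u < b \<longrightarrow> (h has_real_derivative - G u) (at u))"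
      using AE_g AE_lborel_singleton[of b] AE_lborel_singleton[of c]
    proof eventually_elim
      fix u assume u: "c < u \<and> u < b \<longrightarrow> (g has_real_derivative - G u) (at u)" "u \<noteq> b" "u \<noteq> c"
      have "(h has_real_derivative - G u) (at u)" if cu: "c < u" "u < b"
        by (rule has_field_derivative_transform_within_open[of g _ _ "{c<..<b}"]) (use cu u c hg in auto)
      then show "u \<noteq> c \<and> u \<noteq> b \<and> (c < u \<and> u < b \<longrightarrow> (h has_real_derivative - G u) (at u))" using u by blast
    qed
    let ?k = "\<lambda>u. indicator {c..b} u *\<^sub>R (deriv h u / (u - c) powr \<alpha>)"
    have kG: "AE u in lborel. ?k u = - (G u * rker (1 - \<alpha>) (u - c))"
      using AE
    proof eventually_elim
      fix u assume u: "u \<noteq> c \<and> u \<noteq> b \<and> (c < u \<and> u < b \<longrightarrow> (h has_real_derivative - G u) (at u))"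
      consider "u < c" | "c < u" "u < b" | "b < u" using u by linarith
      then show "?k u = - (G u * rker (1 - \<alpha>) (u - c))"
      proof cases
        case 2
        then have "deriv h u = - G u" using u by (intro DERIV_imp_deriv) blast
        with 2 show ?thesis by (simp add: rker_def powr_minus_divide)
      qed (auto simp: rker_nonpos G0)
    qed
    have iG: "integrable lborel (\<lambda>u. - (G u * rker (1 - \<alpha>) (u - c)))" using G(2) by simp
    have "AE u in lebesgue. u \<in> {c..b} \<longrightarrow> h field_differentiable (at u)"
      unfolding AE_completion_iff using AE by eventually_elim (auto simp: field_differentiable_def order_le_less)
    moreover have "integrable lebesgue ?k"
      using lebesgue_integrable_AE_borel[OF _ kG] iG by simp
    ultimately have ex: "right_caputo_exists \<alpha> b h c"
      unfolding right_caputo_exists_def set_integrable_def by blast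
    have "integral\<^sup>L lebesgue ?k = (\<integral>u. - (G u * rker (1 - \<alpha>) (u - c)) \<partial>lborel)"
      by (rule lebesgue_integral_AE_borel[OF _ kG]) (use iG in auto)
    also have "\<dots> = Gamma (1 - \<alpha>) * p c" using p_eq_integral[OF ext c G G0 g0] by simp
    finally have "right_caputo \<alpha> b h c = - p c"
      using Gamma_pos by (simp add: right_caputo_def right_RL_integral_def set_lebesgue_integral_def)
    with ex show ?thesis by blast
  qed
  then show ?thesis
    unfolding euler_lagrange_def Let_def h_def[symmetric] using p2 by auto
qed

end

theorem theorem4p2:
  fixes a b \<alpha> ya yb :: real
    and L :: "real \<times> real \<times> real \<Rightarrow> real"
    and y :: "real \<Rightarrow> real"
  assumes "a < b"
    and "0 < \<alpha>" and "\<alpha> < 1"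
    and "C2_on ({a..b} \<times> UNIV) L"
    and "is_extremizer \<alpha> a b L ya yb y"
  shows "euler_lagrange \<alpha> a b L y"
proof -
  have "C1_on {a..b} y" using assms(5) by (simp add: is_extremizer_def admissible_def)
  then obtain f where f: "continuous_on {a..b} f" "\<And>x. x \<in> {a..b} \<Longrightarrow> (y has_real_derivative f x) (at x within {a..b})"
    using C1_on_IccE by blast
  obtain L' :: "real \<times> real \<times> real \<Rightarrow> (real \<times> real \<times> real) \<Rightarrow>\<^sub>L real" where
    "\<And>z. z \<in> strip a b \<Longrightarrow> (L has_derivative blinfun_apply (L' z)) (at z within strip a b)"
    "continuous_on (strip a b) L'"
    "\<And>N. \<exists>B\<ge>0. \<forall>z\<in>slab a b N. \<forall>z'\<in>slab a b N. norm (L' z - L' z') \<le> B * norm (z - z') \<and>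
       \<bar>L z' - L z - L' z (z' - z)\<bar> \<le> B * (norm (z' - z))^2"
    using C2_onE[OF assms(4)] by blast
  then interpret extremal_setting a b \<alpha> L L' y f
    using assms f by unfold_locales
  show ?thesis by (rule euler_lagrange[OF assms(5)])
qed

end
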